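(* Let $F: H\to\mathbb{R}\cup\{+\infty\}$ be a proper lower semicontinuous convex function and let $\mu\in\mathcal{M}(X,H)$, with Radon–Nikodym decomposition $\mu=\mu^a\gamma+\mu^s$. Then $$\int_X F(\mu)=\sup_{\Phi\in\mathcal{F}\mathcal{C}_b^1(X,H)}\left\{\int_X[\Phi,d\mu]_H-\int_X F^*(\Phi)\,d\gamma\right\}.$$
   Context: $X$ is a separable Banach space with dual $X^*$, endowed with a centered Gaussian probability measure $\gamma$ that is non-degenerate (not concentrated on any proper closed subspace of $X$). $\mathcal{H}$ is the closure in $L^2_\gamma(X)=L^2(X,\gamma)$ of the functions $x\mapsto\langle x^*,x\rangle$, $x^*\in X^*$; $R:\mathcal{H}\to X$ is $R\hat h=\int_X x\,\hat h(x)\,d\gamma(x)$ (Bochner integral), which is injective; $H=R\mathcal{H}\subset X$ is the Cameron–Martin space, a separable Hilbert space with scalar product $[h_1,h_2]_H=\langle\hat h_1,\hat h_2\rangle_{L^2_\gamma(X)}$ for $h_i=R\hat h_i$, and norm $|\cdot|_H$. $\mathcal{F}\mathcal{C}_b^1(X)$ is the space of functions $x\mapsto v(\langle x_1^*,x\rangle,\dots,\langle x_m^*,x\rangle)$ with $m\in\mathbb{N}$, $x_i^*\in X^*$, and $v:\mathbb{R}^m\to\mathbb{R}$ of class $C^1$, bounded with bounded first derivatives. $\mathcal{F}\mathcal{C}_b^1(X,H)$ is the linear span of the maps $\varphi h$ with $\varphi\in\mathcal{F}\mathcal{C}_b^1(X)$, $h\in H$. $\mathcal{M}(X,H)$ is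 the set of countably additive $H$-valued (Borel) measures on $X$ with finite total variation. For $\mu\in\mathcal{M}(X,H)$ we write $\mu=\mu^a\gamma+\mu^s$ with $\mu^a\in L^1_\gamma(X,H)$ and $\mu^s$ singular with respect to $\gamma$; $|\mu|$ is the total variation measure, and $[\Phi,d\mu]_H:=[\Phi,\frac{d\mu}{d|\mu|}]_H\,d|\mu|$. $F^*(\Phi)=\sup_{h\in H}\,[\Phi,h]_H-F(h)$ is the convex conjugate, and $F^\infty$ is the recession function $F^\infty(h)=\lim_{t\to+\infty}\frac{F(h_0+th)-F(h_0)}{t}$, for any $h_0$ with $F(h_0)<+\infty$ (the limit does not depend on $h_0$; if $F(0)<+\infty$, it equals $\lim_{t\to+\infty}F(th)/t$). Define $$\int_X F(\mu):=\int_X F(\mu^a)\,d\gamma+\int_X F^\infty\left(\frac{d\mu^s}{d|\mu^s|}\right)d|\mu^s|.$$ *)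

theory Defs
  imports "HOL-Probability.Probability"
begin

section \<open>Gaussian measures and the Cameron--Martin space\<close>

text \<open>The Dirac mass at 0 is the Gaussian law with variance 0.\<close>

definition centered_gaussian_measure ::
    "('a :: {banach, second_countable_topology}) measure \<Rightarrow> bool" where
  "centered_gaussian_measure \<gamma> \<longleftrightarrow>
     prob_space \<gamma> \<and> sets \<gamma> = sets borel \<and>
     (\<forall>\<xi> :: 'a \<Rightarrow>\<^sub>L real.
        distr \<gamma> borel (blinfun_apply \<xi>) = return borel 0 \<or>
        (\<exists>\<sigma>>0. distr \<gamma> borel (blinfun_apply \<xi>) =
           density lborel (\<lambda>t. ennreal (normal_density 0 \<sigma> t))))"

definition nondegenerate_measure :: "('a :: real_normed_vector) measure \<Rightarrow> bool" where
  "nondegenerate_measure \<gamma> \<longleftrightarrow>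
     (\<forall>V. subspace V \<and> closed V \<and> V \<noteq> UNIV \<longrightarrow> emeasure \<gamma> V \<noteq> emeasure \<gamma> UNIV)"

text \<open>The closure of the dual space in \<open>L\<^sup>2(\<gamma>)\<close>. Its elements are
  square-integrable functions, not equivalence classes modulo \<open>\<gamma>\<close>-null sets.\<close>

definition dual_L2_closure ::
    "('a :: {banach, second_countable_topology}) measure \<Rightarrow> ('a \<Rightarrow> real) set" where
  "dual_L2_closure \<gamma> =
     {f \<in> borel_measurable \<gamma>. integrable \<gamma> (\<lambda>x. (f x)\<^sup>2) \<and>
        (\<forall>e>0. \<exists>\<xi> :: 'a \<Rightarrow>\<^sub>L real. (\<integral>x. (f x - blinfun_apply \<xi> x)\<^sup>2 \<partial>\<gamma>) < e)}"

definition cm_map ::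
    "('a :: {banach, second_countable_topology}) measure \<Rightarrow> ('a \<Rightarrow> real) \<Rightarrow> 'a" where
  "cm_map \<gamma> f = (\<integral>x. f x *\<^sub>R x \<partial>\<gamma>)"

definition cameron_martin_space ::
    "('a :: {banach, second_countable_topology}) measure \<Rightarrow> 'a set" where
  "cameron_martin_space \<gamma> = cm_map \<gamma> ` dual_L2_closure \<gamma>"

text \<open>The Cameron--Martin space depends on the measure, hence it is not itself a type.
  The separable Hilbert space type \<open>'h\<close> represents it through the inclusion
  \<open>J\<close>, a linear bijection onto the Cameron--Martin space that carries the inner product of
  \<open>'h\<close> to the Cameron--Martin inner product.\<close>

definition represents_cameron_martin ::
    "('a :: {banach, second_countable_topology}) measure \<Rightarrow>
     ('h :: {real_inner, banach, second_countable_topology} \<Rightarrow> 'a) \<Rightarrow> bool" where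
  "represents_cameron_martin \<gamma> J \<longleftrightarrow>
     linear J \<and> bij_betw J UNIV (cameron_martin_space \<gamma>) \<and>
     (\<forall>h1 h2. \<forall>f1 \<in> dual_L2_closure \<gamma>. \<forall>f2 \<in> dual_L2_closure \<gamma>.
        J h1 = cm_map \<gamma> f1 \<and> J h2 = cm_map \<gamma> f2 \<longrightarrow>
        h1 \<bullet> h2 = (\<integral>x. f1 x * f2 x \<partial>\<gamma>))"

section \<open>Cylindrical functions\<close>

text \<open>A function on \<open>\<real>\<^sup>m\<close> is encoded as a function of real sequences that depends only on the
  coordinates with index \<open>i < m\<close>. For such functions, continuity in the product topology
  is continuity on \<open>\<real>\<^sup>m\<close>; of class \<open>C\<^sup>1\<close> means that all partial derivatives
  \<open>D i\<close> exist and are continuous.\<close>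

definition C1_bounded :: "nat \<Rightarrow> ((nat \<Rightarrow> real) \<Rightarrow> real) \<Rightarrow> bool" where
  "C1_bounded m v \<longleftrightarrow>
     (\<forall>y z. (\<forall>i<m. y i = z i) \<longrightarrow> v y = v z) \<and>
     bounded (range v) \<and>
     (\<exists>D. \<forall>i<m.
        (\<forall>y. ((\<lambda>t. v (y(i := t))) has_real_derivative D i y) (at (y i))) \<and>
        continuous_on UNIV (D i) \<and> bounded (range (D i)))"

definition FCb1 :: "('a :: real_normed_vector \<Rightarrow> real) set" where
  "FCb1 = {\<phi>. \<exists>m v. \<exists>\<xi> :: nat \<Rightarrow> ('a \<Rightarrow>\<^sub>L real).
     C1_bounded m v \<and> \<phi> = (\<lambda>x. v (\<lambda>i. blinfun_apply (\<xi> i) x))}"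

text \<open>The linear span, written out since functions are not an instance of
  \<^class>\<open>real_vector\<close>.\<close>

definition FCb1_vec :: "('a :: real_normed_vector \<Rightarrow> 'h :: real_vector) set" where
  "FCb1_vec = {\<Phi>. \<exists>(n::nat) c \<phi> h. (\<forall>i<n. \<phi> i \<in> FCb1) \<and>
     \<Phi> = (\<lambda>x. \<Sum>i<n. c i *\<^sub>R (\<phi> i x *\<^sub>R h i))}"

section \<open>Vector measures\<close>

definition total_variation ::
    "('a :: topological_space set \<Rightarrow> 'h :: real_normed_vector) \<Rightarrow> 'a set \<Rightarrow> ennreal" where
  "total_variation \<mu> B =
     (SUP A \<in> {A :: nat \<Rightarrow> 'a set.
        range A \<subseteq> sets borel \<and> disjoint_family A \<and> (\<Union>n. A n) = B}.
      \<Sum>n. ennreal (norm (\<mu> (A n))))"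

definition variation_measure ::
    "('a :: topological_space set \<Rightarrow> 'h :: real_normed_vector) \<Rightarrow> 'a measure" where
  "variation_measure \<mu> = measure_of UNIV (sets borel) (total_variation \<mu>)"

text \<open>Values on non-Borel sets are irrelevant.\<close>

definition vector_measures ::
    "('a :: topological_space set \<Rightarrow> 'h :: real_normed_vector) set" where
  "vector_measures = {\<mu>.
     (\<forall>A :: nat \<Rightarrow> 'a set. range A \<subseteq> sets borel \<longrightarrow> disjoint_family A \<longrightarrow>
        (\<lambda>n. \<mu> (A n)) sums \<mu> (\<Union>n. A n)) \<and>
     total_variation \<mu> UNIV < \<infinity>}"

text \<open>The Radon--Nikodym density of a vector measure with respect to its total variation; it is
  unique up to \<open>variation_measure \<mu>\<close>-null sets.\<close>

definition polar_density ::
    "('a :: topological_space set \<Rightarrow> 'h :: {banach, second_countable_topology}) \<Rightarrow> 'a \<Rightarrow> 'h" where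
  "polar_density \<mu> = (SOME g. integrable (variation_measure \<mu>) g \<and>
     (\<forall>B \<in> sets borel. \<mu> B = set_lebesgue_integral (variation_measure \<mu>) B g))"

definition pairing_integral ::
    "('a :: topological_space \<Rightarrow> 'h) \<Rightarrow>
     ('a set \<Rightarrow> 'h :: {real_inner, banach, second_countable_topology}) \<Rightarrow> real" where
  "pairing_integral \<Phi> \<mu> = (\<integral>x. \<Phi> x \<bullet> polar_density \<mu> x \<partial>variation_measure \<mu>)"

definition radon_nikodym_decomposition ::
    "('a :: topological_space) measure \<Rightarrow>
     ('a set \<Rightarrow> 'h :: {banach, second_countable_topology}) \<Rightarrow>
     ('a \<Rightarrow> 'h) \<Rightarrow> ('a set \<Rightarrow> 'h) \<Rightarrow> bool" where
  "radon_nikodym_decomposition \<gamma> \<mu> \<mu>a \<mu>s \<longleftrightarrow>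
     integrable \<gamma> \<mu>a \<and> \<mu>s \<in> vector_measures \<and>
     (\<forall>B \<in> sets borel. \<mu> B = set_lebesgue_integral \<gamma> B \<mu>a + \<mu>s B) \<and>
     (\<exists>N \<in> sets borel. emeasure \<gamma> N = 0 \<and> total_variation \<mu>s (- N) = 0)"

section \<open>Convex functionals\<close>

definition proper_fun :: "('h \<Rightarrow> ereal) \<Rightarrow> bool" where
  "proper_fun F \<longleftrightarrow> (\<forall>h. F h \<noteq> -\<infinity>) \<and> (\<exists>h. F h < \<infinity>)"

definition lsc_fun :: "('h :: topological_space \<Rightarrow> ereal) \<Rightarrow> bool" where
  "lsc_fun F \<longleftrightarrow> (\<forall>h. F h \<le> Liminf (at h) F)"

definition convex_fun :: "('h :: real_vector \<Rightarrow> ereal) \<Rightarrow> bool" where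
  "convex_fun F \<longleftrightarrow> (\<forall>h k t. 0 < t \<and> t < 1 \<longrightarrow>
     F ((1 - t) *\<^sub>R h + t *\<^sub>R k) \<le> ereal (1 - t) * F h + ereal t * F k)"

definition conjugate_fun :: "('h :: real_inner \<Rightarrow> ereal) \<Rightarrow> 'h \<Rightarrow> ereal" where
  "conjugate_fun F \<phi> = (SUP h. ereal (\<phi> \<bullet> h) - F h)"

text \<open>For proper convex lower semicontinuous functions the limit does not depend on the base
  point \<open>h0\<close>.\<close>

definition recession_fun :: "('h :: real_vector \<Rightarrow> ereal) \<Rightarrow> 'h \<Rightarrow> ereal" where
  "recession_fun F h = (let h0 = (SOME h0. F h0 < \<infinity>) in
     Lim at_top (\<lambda>t::real. (F (h0 + t *\<^sub>R h) - F h0) / ereal t))"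

text \<open>Integral of an extended-real function, meaningful when the positive or the negative part has
  finite integral.\<close>

definition ereal_integral :: "'a measure \<Rightarrow> ('a \<Rightarrow> ereal) \<Rightarrow> ereal" where
  "ereal_integral M f =
     enn2ereal (\<integral>\<^sup>+x. e2ennreal (f x) \<partial>M) - enn2ereal (\<integral>\<^sup>+x. e2ennreal (- f x) \<partial>M)"

text \<open>The functional of \<open>\<mu> = \<mu>a \<gamma> + \<mu>s\<close>.\<close>

definition measure_functional ::
    "('a :: topological_space) measure \<Rightarrow>
     ('h :: {real_inner, banach, second_countable_topology} \<Rightarrow> ereal) \<Rightarrow>
     ('a \<Rightarrow> 'h) \<Rightarrow> ('a set \<Rightarrow> 'h) \<Rightarrow> ereal" where
  "measure_functional \<gamma> F \<mu>a \<mu>s =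
     ereal_integral \<gamma> (\<lambda>x. F (\<mu>a x)) +
     ereal_integral (variation_measure \<mu>s) (\<lambda>x. recession_fun F (polar_density \<mu>s x))"

end

theory Submission
  imports Defs
begin

text \<open>
  \<^emph>\<open>Why the formula holds.\<close> A proper lower semicontinuous convex function on a separable Hilbert space
  is the supremum of countably many affine functions \<open>h \<mapsto> \<phi>\<^sub>n \<bullet> h - c\<^sub>n\<close>, and its recession function
  is the supremum of the slopes \<open>h \<mapsto> \<phi>\<^sub>n \<bullet> h\<close> alone (\<open>countable_affine_representation\<close>). Every
  such pair satisfies \<open>F\<^sup>*(\<phi>\<^sub>n) \<le> c\<^sub>n\<close>. Thus the left-hand side integrates a
  pointwise supremum, and the theorem says that this supremum may be taken outside the integral, over
  continuous choices of the slope.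

  \<^emph>\<open>The supremum is at most the functional.\<close> On the absolutely continuous part this is the
  Fenchel--Young inequality \<open>\<Phi> \<bullet> \<mu>\<^sup>a \<le> F(\<mu>\<^sup>a) + F\<^sup>*(\<Phi>)\<close>. On the singular part the inequality
  \<open>\<Phi>(x) \<bullet> h \<le> F\<^sup>\<infinity>(h)\<close> is needed on a \<open>\<gamma>\<close>-null set, while finiteness of \<open>\<integral>F\<^sup>*(\<Phi>) d\<gamma>\<close> puts \<open>\<Phi>(x)\<close>
  in the domain of \<open>F\<^sup>*\<close> only for \<open>\<gamma>\<close>-almost every \<open>x\<close>. The gap is closed by the full
  support of \<open>\<gamma>\<close>, in the form that every open cylinder has positive measure
  (\<open>gaussian_cylinder_positive\<close>): \<open>\<Phi>\<close> depends on finitely many functionals in a Lipschitz way, hence all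
  its values lie in the closure of the domain (\<open>recession_bound_on_support\<close>). Positivity of
  cylinders is reduced by Gram--Schmidt to orthonormal functionals. For these the integral of a product
  of narrow Gaussian bumps is computed from the characteristic function; it decays only polynomially
  in the inverse width, whereas it would decay exponentially if the cylinder were null.

  \<^emph>\<open>The functional is at most the supremum.\<close> By monotone convergence only finitely many affine
  functions matter. The index of the largest one at \<open>x\<close> selects a slope, where \<open>\<mu>\<^sup>a\<close> and the polar density
  of \<open>\<mu>\<^sup>s\<close> are treated separately on the two sets that carry the mutually singular measures. The
  indicators of this selection are then replaced by a partition of unity made of cylindrical functions
  (\<open>FCb1_partition_of_unity_approximates_Max\<close>). The resulting map \<open>\<Phi>\<close> is a convex combination of the
  slopes, so \<open>F\<^sup>*(\<Phi>)\<close> is at most the same combination of the constants \<open>c\<^sub>n\<close>. The approximation of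
  indicators rests on the fact that half-spaces generate the Borel sets, which follows from
  the Hahn--Banach theorem.

  Two further ingredients give the functional its meaning: the total variation of a vector measure
  is a finite measure, and a vector measure with values in a Hilbert space has a density with
  respect to its total variation (\<open>polar_density_exists\<close>).
\<close>

section \<open>Half-spaces generate the Borel sets\<close>

definition sublinear :: "('a::real_vector \<Rightarrow> real) \<Rightarrow> bool" where
  "sublinear q \<longleftrightarrow> (\<forall>x y. q (x + y) \<le> q x + q y) \<and> (\<forall>t>0. \<forall>x. q (t *\<^sub>R x) \<le> t * q x)"

lemma sublinear_zero:
  assumes "sublinear q" shows "q 0 = 0"
proof -
  have "q (0 + 0) \<le> q 0 + q 0" "q ((1/2) *\<^sub>R 0) \<le> (1/2) * q 0"
    using assms unfolding sublinear_def by (blast, metis half_gt_zero_iff zero_less_one)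
  then show ?thesis by simp
qed

lemma sublinear_uminus:
  assumes "sublinear q" shows "- q (- x) \<le> q x"
proof -
  have "q (x + - x) \<le> q x + q (- x)"
    using assms unfolding sublinear_def by blast
  then show ?thesis using sublinear_zero[OF assms] by simp
qed

lemma sublinear_INF:
  assumes "I \<noteq> {}" and bdd: "\<And>x. bdd_below ((\<lambda>i. f i x) ` I)"
    and add: "\<And>i j x y. i \<in> I \<Longrightarrow> j \<in> I \<Longrightarrow> \<exists>k\<in>I. f k (x + y) \<le> f i x + f j y"
    and scale: "\<And>i t x. i \<in> I \<Longrightarrow> t > 0 \<Longrightarrow> \<exists>k\<in>I. f k (t *\<^sub>R x) \<le> t * f i x"
  shows "sublinear (\<lambda>x. INF i\<in>I. f i x)"
  unfolding sublinear_def
proof (intro conjI allI impI)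
  fix x y
  have le: "(INF i\<in>I. f i (x + y)) \<le> f i x + f j y" if ij: "i \<in> I" "j \<in> I" for i j
    using add[OF ij] bdd by (meson cINF_lower order_trans)
  have "(INF i\<in>I. f i (x + y)) - f j y \<le> (INF i\<in>I. f i x)" if "j \<in> I" for j
    using \<open>I \<noteq> {}\<close> le[OF _ that] by (intro cINF_greatest) (auto simp: algebra_simps)
  then have "(INF i\<in>I. f i (x + y)) - (INF i\<in>I. f i x) \<le> (INF j\<in>I. f j y)"
    using \<open>I \<noteq> {}\<close> by (intro cINF_greatest) (auto simp: algebra_simps)
  then show "(INF i\<in>I. f i (x + y)) \<le> (INF i\<in>I. f i x) + (INF i\<in>I. f i y)"
    by simp
next
  fix t :: real and x assume t: "0 < t"
  have le: "(INF i\<in>I. f i (t *\<^sub>R x)) \<le> t * f i x" if "i \<in> I" for i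
    using scale[OF that t] bdd by (meson cINF_lower order_trans)
  have "(INF i\<in>I. f i (t *\<^sub>R x)) / t \<le> (INF i\<in>I. f i x)"
    using \<open>I \<noteq> {}\<close> le t by (intro cINF_greatest) (auto simp: divide_le_eq mult.commute)
  then show "(INF i\<in>I. f i (t *\<^sub>R x)) \<le> t * (INF i\<in>I. f i x)"
    using t by (simp add: divide_le_eq mult.commute)
qed

text \<open>This is the step that makes minimal sublinear functionals linear: a minimal \<open>q\<close> coincides
  with \<open>r\<close>, so that \<open>q x + q y \<le> q (x + y)\<close>. The witness is \<open>r x = inf (q (x + t y) - t q y)\<close> over \<open>t \<ge> 0\<close>.\<close>

lemma sublinear_lower_along:
  assumes q: "sublinear q"
  obtains r where "sublinear r" "r \<le> q" "\<And>x. r x \<le> q (x + y) - q y"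
proof -
  let ?f = "\<lambda>t x. q (x + t *\<^sub>R y) - t * q y"
  have sub: "q (u + v) \<le> q u + q v" for u v using q unfolding sublinear_def by blast
  have scale: "q (t *\<^sub>R u) \<le> t * q u" if "t > 0" for t u
    using q that unfolding sublinear_def by blast
  have scale': "t * q u \<le> q (t *\<^sub>R u)" if "t \<ge> 0" for t u
  proof (cases "t = 0")
    case True then show ?thesis using sublinear_zero[OF q] by simp
  next
    case False
    then have "q ((1/t) *\<^sub>R (t *\<^sub>R u)) \<le> (1/t) * q (t *\<^sub>R u)" using that by (intro scale) auto
    with False that show ?thesis by (simp add: field_simps)
  qed
  have bdd: "bdd_below ((\<lambda>t. ?f t x) ` {0..})" for x
  proof (rule bdd_belowI2)
    fix t :: real assume "t \<in> {0..}"
    then have "t * q y \<le> q (t *\<^sub>R y)" using scale' by simp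
    also have "t *\<^sub>R y = (x + t *\<^sub>R y) + - x" by simp
    also have "q \<dots> \<le> q (x + t *\<^sub>R y) + q (- x)" by (rule sub)
    finally show "- q (- x) \<le> ?f t x" by simp
  qed
  have r: "sublinear (\<lambda>x. INF t\<in>{0..}. ?f t x)"
  proof (rule sublinear_INF)
    fix s t :: real and u v assume "s \<in> {0..}" "t \<in> {0..}"
    moreover have "?f (s + t) (u + v) \<le> ?f s u + ?f t v"
      using sub[of "u + s *\<^sub>R y" "v + t *\<^sub>R y"] by (simp add: algebra_simps)
    ultimately show "\<exists>k\<in>{0..}. ?f k (u + v) \<le> ?f s u + ?f t v"
      by (intro bexI[of _ "s + t"]) auto
  next
    fix s t :: real and u assume "s \<in> {0..}" "t > 0"
    moreover have "?f (t * s) (t *\<^sub>R u) \<le> t * ?f s u"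
      using scale[OF \<open>t > 0\<close>, of "u + s *\<^sub>R y"] by (simp add: algebra_simps)
    ultimately show "\<exists>k\<in>{0..}. ?f k (t *\<^sub>R u) \<le> t * ?f s u"
      by (intro bexI[of _ "t * s"]) auto
  qed (use bdd in auto)
  show ?thesis
  proof (rule that[OF r])
    show "(\<lambda>x. INF t\<in>{0..}. ?f t x) \<le> q"
      using cINF_lower[OF bdd, of 0] by (auto simp: le_fun_def)
    show "(INF t\<in>{0..}. ?f t x) \<le> q (x + y) - q y" for x
      using cINF_lower[OF bdd, of 1 x] by simp
  qed
qed

text \<open>The analytic Hahn--Banach theorem. Zorn's lemma yields a minimal sublinear functional below
  \<open>p\<close>, where a chain is bounded from below by its pointwise infimum; minimal functionals are linear by
  the previous lemma.\<close>

lemma linear_below_sublinear: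
  assumes p: "sublinear p"
  obtains f where "linear f" "f \<le> p"
proof -
  let ?A = "{q. sublinear q \<and> q \<le> p}"
  let ?P = "\<lambda>q r. r \<le> (q :: 'a \<Rightarrow> real)"
  have "\<exists>m\<in>?A. \<forall>a\<in>?A. ?P m a \<longrightarrow> a = m"
  proof (rule predicate_Zorn)
    show "partial_order_on ?A (relation_of ?P ?A)"
      by (rule partial_order_on_relation_ofI) auto
  next
    fix C assume "C \<in> Chains (relation_of ?P ?A)"
    then have C: "C \<subseteq> ?A" and chain: "\<And>q r. q \<in> C \<Longrightarrow> r \<in> C \<Longrightarrow> q \<le> r \<or> r \<le> q"
      unfolding Chains_def relation_of_def by auto
    show "\<exists>u\<in>?A. \<forall>a\<in>C. ?P a u"
    proof (cases "C = {}")
      case True then show ?thesis using p by auto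
    next
      case False
      have bdd: "bdd_below ((\<lambda>q. q x) ` C)" for x
      proof (rule bdd_belowI2)
        fix q assume "q \<in> C"
        then show "- p (- x) \<le> q x"
          using C sublinear_uminus[of q x] by (auto simp: le_fun_def) (smt (verit) mem_Collect_eq subsetD)
      qed
      have "sublinear (\<lambda>x. INF q\<in>C. q x)"
      proof (rule sublinear_INF[OF False bdd])
        fix q r x y assume qr: "q \<in> C" "r \<in> C"
        then have s: "\<And>k u v. k \<in> C \<Longrightarrow> k (u + v) \<le> k u + k v" using C unfolding sublinear_def by blast
        from chain[OF qr] show "\<exists>k\<in>C. k (x + y) \<le> q x + r y"
        proof
          assume "q \<le> r" then have "q (x + y) \<le> q x + r y"
            using s[OF qr(1), of x y] by (smt (verit) le_funE)
          with qr show ?thesis by blast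
        next
          assume "r \<le> q" then have "r (x + y) \<le> q x + r y"
            using s[OF qr(2), of x y] by (smt (verit) le_funE)
          with qr show ?thesis by blast
        qed
      next
        fix q x and t :: real assume "q \<in> C" "t > 0"
        then have "sublinear q" using C by auto
        with \<open>t > 0\<close> have "q (t *\<^sub>R x) \<le> t * q x" unfolding sublinear_def by simp
        with \<open>q \<in> C\<close> show "\<exists>k\<in>C. k (t *\<^sub>R x) \<le> t * q x" by (intro bexI[of _ q])
      qed
      moreover have lower: "(\<lambda>x. INF q\<in>C. q x) \<le> r" if "r \<in> C" for r
        using cINF_lower[OF bdd that] by (auto simp: le_fun_def)
      moreover have "(\<lambda>x. INF q\<in>C. q x) \<le> p"
      proof -
        obtain r where "r \<in> C" using False by auto
        with C have "r \<le> p" by auto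
        with lower[OF \<open>r \<in> C\<close>] show ?thesis by (rule order_trans)
      qed
      ultimately show ?thesis by (intro bexI[of _ "\<lambda>x. INF q\<in>C. q x"]) simp_all
    qed
  qed
  then obtain m where m: "sublinear m" "m \<le> p"
    and min: "\<And>q. sublinear q \<Longrightarrow> q \<le> p \<Longrightarrow> q \<le> m \<Longrightarrow> q = m" by auto
  have add: "m (x + y) = m x + m y" for x y
  proof (rule antisym)
    show "m (x + y) \<le> m x + m y" using m unfolding sublinear_def by blast
    obtain r where r: "sublinear r" "r \<le> m" "\<And>x. r x \<le> m (x + y) - m y"
      using sublinear_lower_along[OF m(1)] by metis
    then have "r = m" using min m(2) by (meson order_trans)
    with r(3)[of x] show "m x + m y \<le> m (x + y)" by simp
  qed
  have neg: "m (- x) = - m x" for x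
    using add[of x "- x"] sublinear_zero[OF m(1)] by simp
  have pos: "m (t *\<^sub>R x) = t * m x" if "t > 0" for t x
  proof (rule antisym)
    show *: "m (t *\<^sub>R x) \<le> t * m x" for x using m that unfolding sublinear_def by blast
    from *[of "- x"] show "t * m x \<le> m (t *\<^sub>R x)" by (simp add: neg)
  qed
  have "linear m"
  proof (rule linearI)
    fix t :: real and x
    consider "t > 0" | "t = 0" | "- t > 0" by linarith
    then show "m (t *\<^sub>R x) = t *\<^sub>R m x"
    proof cases
      case 3
      from pos[OF this, of x] show ?thesis by (simp add: neg)
    qed (auto simp: pos sublinear_zero[OF m(1)])
  qed (rule add)
  with m(2) show ?thesis using that by blast
qed

text \<open>Lowering the norm along \<open>a\<close> before passing to a linear minorant forces the value \<open>- norm a\<close> at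
  \<open>- a\<close>, hence equality at \<open>a\<close>.\<close>

lemma norming_functional:
  fixes a :: "'a::real_normed_vector"
  obtains \<xi> :: "'a \<Rightarrow>\<^sub>L real"
  where "\<And>x. \<bar>blinfun_apply \<xi> x\<bar> \<le> norm x" "blinfun_apply \<xi> a = norm a"
proof -
  have norm: "sublinear (norm :: 'a \<Rightarrow> real)"
    unfolding sublinear_def by (auto simp: norm_triangle_ineq)
  obtain r where r: "sublinear r" "r \<le> norm" "\<And>x. r x \<le> norm (x + a) - norm a"
    using sublinear_lower_along[OF norm] by metis
  obtain f where f: "linear f" "f \<le> r" using linear_below_sublinear[OF r(1)] by metis
  have le: "f x \<le> norm x" for x using f(2) r(2) by (meson le_fun_def order_trans)
  have abs: "\<bar>f x\<bar> \<le> norm x" for x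
    using le[of x] le[of "- x"] by (simp add: linear_neg[OF f(1)] abs_le_iff)
  have "f (- a) \<le> - norm a" using f(2) r(3)[of "- a"] by (simp add: le_fun_def) (metis order_trans)
  with le[of a] have fa: "f a = norm a" by (simp add: linear_neg[OF f(1)])
  have "bounded_linear f"
    using f(1) abs by (intro bounded_linear_intro[where K=1]) (auto simp: linear_add linear_scale)
  then have "blinfun_apply (Blinfun f) = f" by (rule bounded_linear_Blinfun_apply)
  with abs fa that[of "Blinfun f"] show ?thesis by metis
qed

text \<open>Countably many norming functionals, chosen at the points of a dense set, already determine the
  norm. So a closed ball is a countable intersection of half-spaces, and an open set is a countable
  union of closed balls.\<close>

lemma borel_subset_sigma_halfspaces:
  "sets (borel :: 'a::{real_normed_vector, second_countable_topology} measure) \<subseteq>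
     sigma_sets UNIV {{x. blinfun_apply \<xi> x \<le> a} | (\<xi> :: 'a \<Rightarrow>\<^sub>L real) a. True}"
    (is "_ \<subseteq> sigma_sets UNIV ?G")
proof -
  obtain D :: "'a set" where D: "countable D" "\<And>X. open X \<Longrightarrow> X \<noteq> {} \<Longrightarrow> \<exists>d\<in>D. d \<in> X"
    using countable_dense_exists by metis
  then have "D \<noteq> {}" by force
  have dense: "\<exists>d\<in>D. norm (x - d) < e" if "e > 0" for x e
    using D(2)[of "ball x e"] that by (auto simp: dist_norm)
  have "\<exists>\<xi> :: 'a \<Rightarrow>\<^sub>L real. (\<forall>x. \<bar>blinfun_apply \<xi> x\<bar> \<le> norm x) \<and> blinfun_apply \<xi> d = norm d" for d
    using norming_functional[of d] by metis
  then obtain \<xi> :: "'a \<Rightarrow> 'a \<Rightarrow>\<^sub>L real"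
    where \<xi>: "\<And>d x. \<bar>blinfun_apply (\<xi> d) x\<bar> \<le> norm x" "\<And>d. blinfun_apply (\<xi> d) d = norm d" by metis
  have cball: "cball c r = (\<Inter>d\<in>D. {x. blinfun_apply (\<xi> d) x \<le> r + blinfun_apply (\<xi> d) c})" for c r
  proof (intro equalityI subsetI)
    fix x assume "x \<in> cball c r"
    then have "norm (x - c) \<le> r" by (simp add: dist_norm norm_minus_commute)
    then have "blinfun_apply (\<xi> d) (x - c) \<le> r" for d using \<xi>(1)[of d "x - c"] by linarith
    then show "x \<in> (\<Inter>d\<in>D. {x. blinfun_apply (\<xi> d) x \<le> r + blinfun_apply (\<xi> d) c})"
      by (simp add: blinfun.diff_right algebra_simps)
  next
    fix x assume x: "x \<in> (\<Inter>d\<in>D. {x. blinfun_apply (\<xi> d) x \<le> r + blinfun_apply (\<xi> d) c})"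
    have "norm (x - c) \<le> r + e" if "e > 0" for e
    proof -
      obtain d where d: "d \<in> D" "norm (x - c - d) < e / 2" using dense[of "e / 2" "x - c"] \<open>e > 0\<close> by auto
      have "norm (x - c) \<le> norm d + norm (x - c - d)" using norm_triangle_ineq[of d "x - c - d"] by simp
      also have "norm d = blinfun_apply (\<xi> d) (x - c) - blinfun_apply (\<xi> d) (x - c - d)"
        by (simp add: \<xi> blinfun.diff_right)
      also have "\<dots> \<le> r + e / 2"
        using x d \<xi>(1)[of d "x - c - d"] by (auto simp: blinfun.diff_right dest!: bspec[of _ _ d])
      finally show ?thesis using d by simp
    qed
    then have "norm (x - c) \<le> r" by (rule field_le_epsilon)
    then show "x \<in> cball c r" by (simp add: dist_norm norm_minus_commute)
  qed
  have halfspace: "{x. blinfun_apply (\<xi> d) x \<le> a} \<in> sigma_sets UNIV ?G" for d a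
    by (rule sigma_sets.Basic) blast
  have cball_in: "cball c r \<in> sigma_sets UNIV ?G" for c r
    unfolding cball using D(1) \<open>D \<noteq> {}\<close> halfspace
    by (intro sigma_algebra.countable_INT'[OF sigma_algebra_sigma_sets]) auto
  have "U \<in> sigma_sets UNIV ?G" if U: "open U" for U :: "'a set"
  proof -
    let ?J = "{(d, n::nat). d \<in> D \<and> cball d (1 / Suc n) \<subseteq> U}"
    have "U = (\<Union>(d, n)\<in>?J. cball d (1 / Suc n))"
    proof (intro equalityI subsetI)
      fix x assume "x \<in> U"
      then obtain e where e: "e > 0" "cball x e \<subseteq> U" using U open_contains_cball by metis
      obtain n where n: "1 / Suc n < e / 2" using nat_approx_posE[of "e / 2"] e by auto
      obtain d where d: "d \<in> D" "norm (x - d) < 1 / Suc n" using dense[of "1 / Suc n" x] by auto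
      have "cball d (1 / Suc n) \<subseteq> cball x e"
      proof
        fix y assume "y \<in> cball d (1 / Suc n)"
        then have "dist d y \<le> 1 / Suc n" by simp
        moreover have "dist x y \<le> dist x d + dist d y" by (rule dist_triangle)
        moreover have "dist x d < 1 / Suc n" using d by (simp add: dist_norm)
        ultimately show "y \<in> cball x e" using n by simp
      qed
      with e d show "x \<in> (\<Union>(d, n)\<in>?J. cball d (1 / Suc n))"
        by (auto simp: dist_norm norm_minus_commute intro!: exI[of _ d] exI[of _ n])
    qed auto
    moreover have "countable ?J"
      by (rule countable_subset[of _ "D \<times> UNIV"]) (use D(1) in auto)
    then have "(\<Union>(d, n)\<in>?J. cball d (1 / Suc n)) \<in> sigma_sets UNIV ?G"
      by (intro sigma_algebra.countable_UN'[OF sigma_algebra_sigma_sets])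
        (use cball_in in auto)
    ultimately show ?thesis by simp
  qed
  then show ?thesis unfolding borel_def
    by (simp add: sets_measure_of) (intro sigma_sets_mono, auto)
qed

section \<open>Cylindrical functions\<close>

lemma C1_bounded_lipschitz:
  assumes "C1_bounded m v"
  shows "\<exists>K\<ge>0. \<forall>y z. \<bar>v y - v z\<bar> \<le> K * (\<Sum>i<m. \<bar>y i - z i\<bar>)"
proof -
  obtain D where dep: "\<And>y z. (\<forall>i<m. y i = z i) \<Longrightarrow> v y = v z"
    and D: "\<And>i y. i < m \<Longrightarrow> ((\<lambda>t. v (y(i := t))) has_real_derivative D i y) (at (y i))"
    and bdd: "\<And>i. i < m \<Longrightarrow> bounded (range (D i))"
    using assms unfolding C1_bounded_def by metis
  have "\<forall>i. \<exists>C\<ge>0. i < m \<longrightarrow> (\<forall>y. \<bar>D i y\<bar> \<le> C)"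
  proof
    fix i
    show "\<exists>C\<ge>0. i < m \<longrightarrow> (\<forall>y. \<bar>D i y\<bar> \<le> C)"
    proof (cases "i < m")
      case True
      then obtain C where C: "\<And>y. \<bar>D i y\<bar> \<le> C" using bdd[OF True] unfolding bounded_iff by auto
      then have "0 \<le> C" using order_trans[OF abs_ge_zero] by blast
      with C show ?thesis by blast
    qed auto
  qed
  then obtain C where C: "\<And>i. 0 \<le> C i" "\<And>i y. i < m \<Longrightarrow> \<bar>D i y\<bar> \<le> C i" by metis
  define K where "K = (\<Sum>i<m. C i)"
  have CK: "C i \<le> K" if "i < m" for i
    unfolding K_def using C(1) that by (intro member_le_sum) auto
  have step: "\<bar>v (y(i := s)) - v (y(i := t))\<bar> \<le> K * \<bar>s - t\<bar>" if "i < m" for y i s t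
  proof -
    have "norm (v (y(i := s)) - v (y(i := t))) \<le> C i * norm (s - t)"
    proof (rule field_differentiable_bound[where S = UNIV and f' = "\<lambda>t. D i (y(i := t))"])
      show "((\<lambda>t. v (y(i := t))) has_real_derivative D i (y(i := r))) (at r within UNIV)" for r
        using D[OF that, of "y(i := r)"] by simp
    qed (use C(2)[OF that] in auto)
    also have "\<dots> \<le> K * norm (s - t)" by (intro mult_right_mono CK that) simp
    finally show ?thesis by simp
  qed
  have "\<bar>v y - v z\<bar> \<le> K * (\<Sum>i<m. \<bar>y i - z i\<bar>)" for y z
  proof -
    \<comment> \<open>The coordinates of \<open>y\<close> are replaced by those of \<open>z\<close> one at a time.\<close>
    define h where "h = (\<lambda>k i. if i < k then z i else y i)"
    have "\<bar>v (h 0) - v (h k)\<bar> \<le> K * (\<Sum>i<k. \<bar>y i - z i\<bar>)" if "k \<le> m" for k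
      using that
    proof (induction k)
      case (Suc k)
      have "h (Suc k) = (h k)(k := z k)" "h k = (h k)(k := y k)"
        by (auto simp: h_def fun_eq_iff less_Suc_eq)
      then have "\<bar>v (h k) - v (h (Suc k))\<bar> \<le> K * \<bar>y k - z k\<bar>"
        using step[of k "h k" "y k" "z k"] Suc.prems by simp
      then show ?case using Suc by (simp add: algebra_simps)
    qed simp
    from this[of m] have "\<bar>v (h 0) - v (h m)\<bar> \<le> K * (\<Sum>i<m. \<bar>y i - z i\<bar>)" by simp
    moreover have "v (h 0) = v y" "v (h m) = v z" by (auto intro!: dep simp: h_def)
    ultimately show ?thesis by simp
  qed
  moreover have "0 \<le> K" unfolding K_def using C(1) by (simp add: sum_nonneg)
  ultimately show ?thesis by blast
qed

lemma C1_bounded_continuous: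
  assumes "C1_bounded m v" shows "continuous_on UNIV v"
proof -
  obtain K where K: "\<And>y z. \<bar>v y - v z\<bar> \<le> K * (\<Sum>i<m. \<bar>y i - z i\<bar>)"
    using C1_bounded_lipschitz[OF assms] by blast
  have "isCont v z" for z
    unfolding isCont_def
  proof (rule LIM_zero_cancel, rule Lim_null_comparison)
    show "eventually (\<lambda>y. norm (v y - v z) \<le> K * (\<Sum>i<m. \<bar>y i - z i\<bar>)) (at z)"
      using K by simp
    have "continuous_on UNIV (\<lambda>y :: nat \<Rightarrow> real. y i)" for i
      by (rule continuous_on_product_coordinates)
    then have "isCont (\<lambda>y. y i) z" for i
      using continuous_on_eq_continuous_at[OF open_UNIV] by blast
    then have "((\<lambda>y. K * (\<Sum>i<m. \<bar>y i - z i\<bar>)) \<longlongrightarrow> K * (\<Sum>i<m. \<bar>z i - z i\<bar>)) (at z)"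
      unfolding isCont_def by (intro tendsto_intros)
    then show "((\<lambda>y. K * (\<Sum>i<m. \<bar>y i - z i\<bar>)) \<longlongrightarrow> 0) (at z)" by simp
  qed
  then show ?thesis by (simp add: continuous_on_eq_continuous_at)
qed

lemma FCb1_bounded: "\<phi> \<in> FCb1 \<Longrightarrow> bounded (range \<phi>)"
  unfolding FCb1_def C1_bounded_def by (auto intro: bounded_subset)

lemma FCb1_lipschitz:
  fixes \<phi> :: "'a::real_normed_vector \<Rightarrow> real"
  assumes "\<phi> \<in> FCb1"
  shows "\<exists>(L :: ('a \<Rightarrow>\<^sub>L real) set) K. finite L \<and> 0 \<le> K \<and>
    (\<forall>x y. \<bar>\<phi> x - \<phi> y\<bar> \<le> K * (\<Sum>\<eta>\<in>L. \<bar>blinfun_apply \<eta> (x - y)\<bar>))"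
proof -
  obtain m v and \<xi> :: "nat \<Rightarrow> ('a \<Rightarrow>\<^sub>L real)"
    where v: "C1_bounded m v" and \<phi>: "\<phi> = (\<lambda>x. v (\<lambda>i. blinfun_apply (\<xi> i) x))"
    using assms unfolding FCb1_def by blast
  obtain K where K: "0 \<le> K" "\<And>y z. \<bar>v y - v z\<bar> \<le> K * (\<Sum>i<m. \<bar>y i - z i\<bar>)"
    using C1_bounded_lipschitz[OF v] by blast
  have "\<bar>\<phi> x - \<phi> y\<bar> \<le> (K * m) * (\<Sum>\<eta>\<in>\<xi> ` {..<m}. \<bar>blinfun_apply \<eta> (x - y)\<bar>)" for x y
  proof -
    have "\<bar>\<phi> x - \<phi> y\<bar> \<le> K * (\<Sum>i<m. \<bar>blinfun_apply (\<xi> i) (x - y)\<bar>)"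
      unfolding \<phi> using K(2) by (simp add: blinfun.diff_right)
    also have "(\<Sum>i<m. \<bar>blinfun_apply (\<xi> i) (x - y)\<bar>) \<le> (\<Sum>i<m. \<Sum>\<eta>\<in>\<xi> ` {..<m}. \<bar>blinfun_apply \<eta> (x - y)\<bar>)"
      by (intro sum_mono member_le_sum) auto
    finally show ?thesis using K(1) by (simp add: mult_left_mono mult.assoc)
  qed
  then show ?thesis using K(1) by (intro exI[of _ "\<xi> ` {..<m}"] exI[of _ "K * m"]) auto
qed

text \<open>In this form all components share one finite set of functionals, so that the support argument needs
  no common system of coordinates for them.\<close>

lemma FCb1_vec_lipschitz:
  fixes \<Phi> :: "'a::real_normed_vector \<Rightarrow> 'h::real_normed_vector"
  assumes "\<Phi> \<in> FCb1_vec"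
  shows "\<exists>(L :: ('a \<Rightarrow>\<^sub>L real) set) K. finite L \<and> 0 \<le> K \<and>
    (\<forall>x y. norm (\<Phi> x - \<Phi> y) \<le> K * (\<Sum>\<eta>\<in>L. \<bar>blinfun_apply \<eta> (x - y)\<bar>))"
proof -
  obtain n :: nat and c \<phi> h where \<phi>: "\<And>i. i < n \<Longrightarrow> \<phi> i \<in> FCb1"
    and \<Phi>: "\<Phi> = (\<lambda>x. \<Sum>i<n. c i *\<^sub>R (\<phi> i x *\<^sub>R h i))"
    using assms unfolding FCb1_vec_def by blast
  have "\<exists>(L :: ('a \<Rightarrow>\<^sub>L real) set) K. finite L \<and> 0 \<le> K \<and>
    (i < n \<longrightarrow> (\<forall>x y. \<bar>\<phi> i x - \<phi> i y\<bar> \<le> K * (\<Sum>\<eta>\<in>L. \<bar>blinfun_apply \<eta> (x - y)\<bar>)))" for i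
    using FCb1_lipschitz[OF \<phi>, of i] by (cases "i < n") (blast, auto)
  then obtain L K where L: "\<And>i. finite (L i)" and K: "\<And>i. 0 \<le> K i"
    and le: "\<And>i x y. i < n \<Longrightarrow> \<bar>\<phi> i x - \<phi> i y\<bar> \<le> K i * (\<Sum>\<eta>\<in>L i. \<bar>blinfun_apply \<eta> (x - y)\<bar>)"
    by metis
  define A where "A = (\<Union>i<n. L i)"
  define C where "C = (\<Sum>i<n. \<bar>c i\<bar> * K i * norm (h i))"
  have "finite A" unfolding A_def using L by auto
  have "norm (\<Phi> x - \<Phi> y) \<le> C * (\<Sum>\<eta>\<in>A. \<bar>blinfun_apply \<eta> (x - y)\<bar>)" for x y
  proof -
    let ?s = "\<Sum>\<eta>\<in>A. \<bar>blinfun_apply \<eta> (x - y)\<bar>"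
    have "norm (\<Phi> x - \<Phi> y) = norm (\<Sum>i<n. c i *\<^sub>R ((\<phi> i x - \<phi> i y) *\<^sub>R h i))"
      unfolding \<Phi> by (simp add: sum_subtractf[symmetric] algebra_simps)
    also have "\<dots> \<le> (\<Sum>i<n. \<bar>c i\<bar> * \<bar>\<phi> i x - \<phi> i y\<bar> * norm (h i))"
      by (rule order_trans[OF norm_sum]) (simp add: abs_mult mult.assoc)
    also have "\<dots> \<le> (\<Sum>i<n. \<bar>c i\<bar> * (K i * ?s) * norm (h i))"
    proof (intro sum_mono mult_right_mono mult_left_mono)
      fix i assume i: "i \<in> {..<n}"
      then have "(\<Sum>\<eta>\<in>L i. \<bar>blinfun_apply \<eta> (x - y)\<bar>) \<le> ?s"
        using \<open>finite A\<close> by (intro sum_mono2) (auto simp: A_def)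
      then have "K i * (\<Sum>\<eta>\<in>L i. \<bar>blinfun_apply \<eta> (x - y)\<bar>) \<le> K i * ?s"
        using K by (rule mult_left_mono)
      with le[of i x y] i show "\<bar>\<phi> i x - \<phi> i y\<bar> \<le> K i * ?s" by simp
    qed auto
    also have "\<dots> = C * ?s" unfolding C_def by (simp add: sum_distrib_left sum_distrib_right ac_simps)
    finally show ?thesis .
  qed
  moreover have "0 \<le> C" unfolding C_def using K by (intro sum_nonneg mult_nonneg_nonneg) auto
  ultimately show ?thesis using \<open>finite A\<close> by blast
qed

text \<open>Continuity in the norm follows because each functional is continuous.\<close>

lemma continuous_if_functional_lipschitz:
  fixes f :: "'a::real_normed_vector \<Rightarrow> 'b::real_normed_vector" and L :: "('a \<Rightarrow>\<^sub>L real) set"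
  assumes "\<And>x y. norm (f x - f y) \<le> K * (\<Sum>\<eta>\<in>L. \<bar>blinfun_apply \<eta> (x - y)\<bar>)"
  shows "continuous_on UNIV f"
proof -
  have "isCont f y" for y
    unfolding isCont_def
  proof (rule LIM_zero_cancel, rule Lim_null_comparison)
    show "eventually (\<lambda>x. norm (f x - f y) \<le> K * (\<Sum>\<eta>\<in>L. \<bar>blinfun_apply \<eta> (x - y)\<bar>)) (at y)"
      using assms by simp
    have "((\<lambda>x. blinfun_apply \<eta> (x - y)) \<longlongrightarrow> blinfun_apply \<eta> (y - y)) (at y)" for \<eta> :: "'a \<Rightarrow>\<^sub>L real"
      by (intro bounded_linear.tendsto[OF blinfun.bounded_linear_right] tendsto_intros)
    then have "((\<lambda>x. K * (\<Sum>\<eta>\<in>L. \<bar>blinfun_apply \<eta> (x - y)\<bar>)) \<longlongrightarrow> K * (\<Sum>\<eta>\<in>L. \<bar>blinfun_apply \<eta> (y - y)\<bar>)) (at y)"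
      by (intro tendsto_intros)
    then show "((\<lambda>x. K * (\<Sum>\<eta>\<in>L. \<bar>blinfun_apply \<eta> (x - y)\<bar>)) \<longlongrightarrow> 0) (at y)"
      by (simp add: blinfun.zero_right)
  qed
  then show ?thesis by (simp add: continuous_on_eq_continuous_at)
qed

lemma FCb1_measurable: "\<phi> \<in> FCb1 \<Longrightarrow> \<phi> \<in> borel_measurable borel"
  using FCb1_lipschitz[of \<phi>] continuous_if_functional_lipschitz[of \<phi>]
  by (metis borel_measurable_continuous_onI real_norm_def)

lemma FCb1_vec_continuous:
  fixes \<Phi> :: "'a::real_normed_vector \<Rightarrow> 'h::real_normed_vector"
  shows "\<Phi> \<in> FCb1_vec \<Longrightarrow> continuous_on UNIV \<Phi>"
  using FCb1_vec_lipschitz[of \<Phi>] continuous_if_functional_lipschitz[of \<Phi>] by metis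

lemma FCb1_const: "(\<lambda>x. a) \<in> FCb1"
  unfolding FCb1_def C1_bounded_def by (auto intro!: exI[of _ "0::nat"] exI[of _ "\<lambda>_. a"])

lemma bounded_range_mult:
  fixes f g :: "'a \<Rightarrow> real"
  assumes "bounded (range f)" "bounded (range g)"
  shows "bounded (range (\<lambda>x. f x * g x))"
proof -
  obtain C D where C: "\<And>x. \<bar>f x\<bar> \<le> C" and D: "\<And>x. \<bar>g x\<bar> \<le> D"
    using assms unfolding bounded_iff by auto
  have "\<bar>f x * g x\<bar> \<le> C * D" for x
    unfolding abs_mult using C[of x] D[of x] by (intro mult_mono) auto
  then show ?thesis unfolding bounded_iff by auto
qed

text \<open>The coordinates of the second factor are placed behind the \<open>m\<close> coordinates of the first one;
  \<open>sh\<close> reads them off.\<close>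

lemma FCb1_affine_mult:
  fixes \<phi> \<psi> :: "'a::real_normed_vector \<Rightarrow> real"
  assumes "\<phi> \<in> FCb1" "\<psi> \<in> FCb1" shows "(\<lambda>x. a + b * (\<phi> x * \<psi> x)) \<in> FCb1"
proof -
  obtain m v and \<xi> :: "nat \<Rightarrow> ('a \<Rightarrow>\<^sub>L real)"
    where v: "C1_bounded m v" and \<phi>: "\<phi> = (\<lambda>x. v (\<lambda>i. blinfun_apply (\<xi> i) x))"
    using assms(1) unfolding FCb1_def by blast
  obtain n w and \<zeta> :: "nat \<Rightarrow> ('a \<Rightarrow>\<^sub>L real)"
    where w: "C1_bounded n w" and \<psi>: "\<psi> = (\<lambda>x. w (\<lambda>i. blinfun_apply (\<zeta> i) x))"
    using assms(2) unfolding FCb1_def by blast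
  from v obtain D where depv: "\<And>y z. (\<forall>i<m. y i = z i) \<Longrightarrow> v y = v z" and bddv: "bounded (range v)"
    and D: "\<And>i y. i < m \<Longrightarrow> ((\<lambda>t. v (y(i := t))) has_real_derivative D i y) (at (y i))"
      "\<And>i. i < m \<Longrightarrow> continuous_on UNIV (D i)" "\<And>i. i < m \<Longrightarrow> bounded (range (D i))"
    unfolding C1_bounded_def by metis
  from w obtain E where depw: "\<And>y z. (\<forall>i<n. y i = z i) \<Longrightarrow> w y = w z" and bddw: "bounded (range w)"
    and E: "\<And>i y. i < n \<Longrightarrow> ((\<lambda>t. w (y(i := t))) has_real_derivative E i y) (at (y i))"
      "\<And>i. i < n \<Longrightarrow> continuous_on UNIV (E i)" "\<And>i. i < n \<Longrightarrow> bounded (range (E i))"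
    unfolding C1_bounded_def by metis
  define sh where "sh = (\<lambda>(y :: nat \<Rightarrow> real) i. y (i + m))"
  have shc: "continuous_on UNIV (\<lambda>y. f (sh y))" if "continuous_on UNIV f" for f :: "_ \<Rightarrow> real"
  proof (rule continuous_on_compose2[OF that])
    show "continuous_on UNIV sh" unfolding sh_def
      by (intro continuous_on_coordinatewise_then_product continuous_on_product_coordinates)
  qed auto
  have shb: "bounded (range (\<lambda>y. f (sh y)))" if "bounded (range f)" for f :: "_ \<Rightarrow> real"
    using that by (rule bounded_subset) auto
  have cb: "bounded (range (\<lambda>y :: nat \<Rightarrow> real. b))" by simp
  have sh1: "sh (y(i := t)) = sh y" if "i < m" for y i t
    using that by (auto simp: sh_def fun_eq_iff)
  have sh2: "sh (y(i := t)) = (sh y)(i - m := t)" if "m \<le> i" for y i t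
    using that by (auto simp: sh_def fun_eq_iff)
  have v2: "v (y(i := t)) = v y" if "m \<le> i" for y i t
    using that by (intro depv) auto
  note contv = C1_bounded_continuous[OF v] and contw = C1_bounded_continuous[OF w]
  have "C1_bounded (m + n) (\<lambda>y. a + b * (v y * w (sh y)))"
    unfolding C1_bounded_def
  proof (intro conjI allI impI exI[of _ "\<lambda>i y. b * (if i < m then D i y * w (sh y) else v y * E (i - m) (sh y))"])
    fix y z :: "nat \<Rightarrow> real" assume "\<forall>i<m + n. y i = z i"
    then have "v y = v z" "w (sh y) = w (sh z)" by (auto intro!: depv depw simp: sh_def)
    then show "a + b * (v y * w (sh y)) = a + b * (v z * w (sh z))" by simp
  next
    have "bounded (range (\<lambda>y. b * (v y * w (sh y))))" 
      by (rule bounded_range_mult[OF cb bounded_range_mult[OF bddv shb[OF bddw]]])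
    from bounded_translation[OF this, of a] show "bounded (range (\<lambda>y. a + b * (v y * w (sh y))))"
      by (simp add: image_image)
  next
    fix i y assume i: "i < m + n"
    have "((\<lambda>t. v (y(i := t)) * w (sh (y(i := t)))) has_real_derivative
        (if i < m then D i y * w (sh y) else v y * E (i - m) (sh y))) (at (y i))"
    proof (cases "i < m")
      case True
      then show ?thesis using DERIV_cmult_right[OF D(1)[OF True]] by (simp add: sh1)
    next
      case False
      then have "((\<lambda>t. w ((sh y)(i - m := t))) has_real_derivative E (i - m) (sh y)) (at (y i))"
        using E(1)[of "i - m" "sh y"] i by (simp add: sh_def)
      from DERIV_cmult[OF this, of "v y"] False show ?thesis by (simp add: sh2 v2)
    qed
    from DERIV_add[OF DERIV_const DERIV_cmult[OF this]]
    show "((\<lambda>t. a + b * (v (y(i := t)) * w (sh (y(i := t))))) has_real_derivative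
        b * (if i < m then D i y * w (sh y) else v y * E (i - m) (sh y))) (at (y i))" by simp
  next
    fix i assume i: "i < m + n"
    show "continuous_on UNIV (\<lambda>y. b * (if i < m then D i y * w (sh y) else v y * E (i - m) (sh y)))"
      using i continuous_on_mult[OF D(2) shc[OF contw]] continuous_on_mult[OF contv shc[OF E(2)]]
      by (intro continuous_on_mult continuous_on_const) (cases "i < m"; simp)
    show "bounded (range (\<lambda>y. b * (if i < m then D i y * w (sh y) else v y * E (i - m) (sh y))))"
      using i bounded_range_mult[OF D(3) shb[OF bddw]] bounded_range_mult[OF bddv shb[OF E(3)]]
      by (intro bounded_range_mult cb) (cases "i < m"; simp)
  qed
  moreover have "(\<lambda>x. a + b * (\<phi> x * \<psi> x)) = (\<lambda>x. (\<lambda>y. a + b * (v y * w (sh y)))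
      (\<lambda>i. blinfun_apply (if i < m then \<xi> i else \<zeta> (i - m)) x))"
  proof -
    have "v (\<lambda>i. blinfun_apply (if i < m then \<xi> i else \<zeta> (i - m)) x) = \<phi> x" for x
      unfolding \<phi> by (rule depv) simp
    moreover have "w (sh (\<lambda>i. blinfun_apply (if i < m then \<xi> i else \<zeta> (i - m)) x)) = \<psi> x" for x
      by (simp add: \<psi> sh_def)
    ultimately show ?thesis by simp
  qed
  ultimately show ?thesis unfolding FCb1_def
    by (intro CollectI exI[of _ "m + n"] exI[of _ "\<lambda>y. a + b * (v y * w (sh y))"]
        exI[of _ "\<lambda>i. if i < m then \<xi> i else \<zeta> (i - m)"] conjI)
qed

lemma FCb1_affine: "\<phi> \<in> FCb1 \<Longrightarrow> (\<lambda>x. a + b * \<phi> x) \<in> FCb1"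
  using FCb1_affine_mult[OF _ FCb1_const[of 1]] by fastforce

lemma FCb1_mult: "\<phi> \<in> FCb1 \<Longrightarrow> \<psi> \<in> FCb1 \<Longrightarrow> (\<lambda>x. \<phi> x * \<psi> x) \<in> FCb1"
  using FCb1_affine_mult[of \<phi> \<psi> 0 1] by simp

lemma FCb1_prod:
  assumes "\<And>i. i \<in> I \<Longrightarrow> f i \<in> FCb1" shows "(\<lambda>x. \<Prod>i\<in>I. f i x) \<in> FCb1"
proof (cases "finite I")
  case True
  then show ?thesis using assms by (induction I) (auto intro: FCb1_const FCb1_mult)
qed (auto intro: FCb1_const)

text \<open>A smooth step: as \<open>n\<close> grows, \<open>logistic_step n a\<close> tends pointwise to the indicator of
  the closed half-line below \<open>a\<close>. The extra shift \<open>- n\<close> gives the limit 1 at \<open>a\<close> itself.\<close>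

definition logistic_step :: "nat \<Rightarrow> real \<Rightarrow> real \<Rightarrow> real" where
  "logistic_step n a t = 1 / (1 + exp ((real n)\<^sup>2 * (t - a) - real n))"

lemma logistic_step_bounds: "0 \<le> logistic_step n a t" "logistic_step n a t \<le> 1"
  unfolding logistic_step_def by (auto simp: divide_le_eq add_pos_pos add_nonneg_nonneg)

lemma logistic_step_tendsto: "(\<lambda>n. logistic_step n a t) \<longlonglongrightarrow> indicator {..a} t"
proof (cases "t \<le> a")
  case True
  have "filterlim (\<lambda>n. (real n)\<^sup>2 * (t - a) - real n) at_bot sequentially"
  proof (rule filterlim_at_bot_mono)
    show "filterlim (\<lambda>n. - real n) at_bot sequentially"
      by (simp add: filterlim_uminus_at_bot filterlim_real_sequentially)
    show "eventually (\<lambda>n. (real n)\<^sup>2 * (t - a) - real n \<le> - real n) sequentially"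
      using True by (auto simp: mult_nonneg_nonpos)
  qed
  then have "(\<lambda>n. exp ((real n)\<^sup>2 * (t - a) - real n)) \<longlonglongrightarrow> 0"
    by (rule filterlim_compose[OF exp_at_bot])
  then have "(\<lambda>n. logistic_step n a t) \<longlonglongrightarrow> 1 / (1 + 0)"
    unfolding logistic_step_def by (intro tendsto_intros) auto
  then show ?thesis using True by simp
next
  case False
  then have "0 < t - a" by simp
  have "filterlim (\<lambda>n. (t - a) * real n) at_top sequentially"
    by (rule filterlim_tendsto_pos_mult_at_top[OF tendsto_const \<open>0 < t - a\<close> filterlim_real_sequentially])
  then have "filterlim (\<lambda>n. - 1 + (t - a) * real n) at_top sequentially"
    by (rule filterlim_tendsto_add_at_top[OF tendsto_const])
  then have "filterlim (\<lambda>n. real n * (- 1 + (t - a) * real n)) at_top sequentially"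
    by (rule filterlim_at_top_mult_at_top[OF filterlim_real_sequentially])
  then have "filterlim (\<lambda>n. (real n)\<^sup>2 * (t - a) - real n) at_top sequentially"
    by (simp add: algebra_simps power2_eq_square)
  then have "filterlim (\<lambda>n. exp ((real n)\<^sup>2 * (t - a) - real n)) at_top sequentially"
    by (rule filterlim_compose[OF exp_at_top])
  then have "filterlim (\<lambda>n. 1 + exp ((real n)\<^sup>2 * (t - a) - real n)) at_infinity sequentially"
    by (intro filterlim_at_top_imp_at_infinity filterlim_tendsto_add_at_top[OF tendsto_const])
  then have "(\<lambda>n. logistic_step n a t) \<longlonglongrightarrow> 0"
    unfolding logistic_step_def by (intro tendsto_divide_0[OF tendsto_const])
  then show ?thesis using False by simp
qed

lemma logistic_step_FCb1: "(\<lambda>x. logistic_step n a (blinfun_apply \<xi> x)) \<in> FCb1"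
proof -
  let ?s = "\<lambda>t. (real n)\<^sup>2 * (t - a) - real n"
  let ?d = "\<lambda>t. - ((real n)\<^sup>2 * exp (?s t)) / (1 + exp (?s t))\<^sup>2"
  have pos: "0 < 1 + exp (?s t)" for t by (simp add: add_pos_pos)
  have der: "(logistic_step n a has_real_derivative ?d t) (at t)" for t
    unfolding logistic_step_def[abs_def] using pos[of t]
    by (auto intro!: derivative_eq_intros simp: power2_eq_square)
  have bdd: "\<bar>?d t\<bar> \<le> (real n)\<^sup>2" for t
  proof -
    have "exp (?s t) \<le> 1 * (1 + exp (?s t))\<^sup>2"
      using pos[of t] by (simp add: power2_eq_square algebra_simps)
    then have "exp (?s t) / (1 + exp (?s t))\<^sup>2 \<le> 1"
      using pos[of t] by (simp add: divide_le_eq)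
    then have "(real n)\<^sup>2 * (exp (?s t) / (1 + exp (?s t))\<^sup>2) \<le> (real n)\<^sup>2 * 1"
      by (intro mult_left_mono) auto
    then show ?thesis by (simp add: abs_mult)
  qed
  have c0: "continuous_on UNIV (\<lambda>y::nat \<Rightarrow> real. y 0)" by (rule continuous_on_product_coordinates)
  have "C1_bounded 1 (\<lambda>y. logistic_step n a (y 0))"
    unfolding C1_bounded_def
  proof (intro conjI allI impI exI[of _ "\<lambda>i y. ?d (y 0)"])
    show "bounded (range (\<lambda>y. logistic_step n a (y 0)))"
      unfolding bounded_iff using logistic_step_bounds[of n a] by (intro exI[of _ 1]) auto
    fix i :: nat assume i: "i < 1"
    show "((\<lambda>t. logistic_step n a ((y(i := t)) 0)) has_real_derivative ?d (y 0)) (at (y i))" for y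
      using der[of "y 0"] i by simp
    show "continuous_on UNIV (\<lambda>y::nat \<Rightarrow> real. ?d (y 0))"
      using pos less_imp_neq[OF pos] by (intro continuous_intros c0) (auto simp: power2_eq_square)
    show "bounded (range (\<lambda>y. ?d (y 0)))" unfolding bounded_iff using bdd by (intro exI[of _ "(real n)\<^sup>2"]) auto
  qed auto
  then show ?thesis unfolding FCb1_def
    by (intro CollectI exI[of _ 1] exI[of _ "\<lambda>y. logistic_step n a (y 0)"] exI[of _ "\<lambda>_. \<xi>"]) auto
qed

section \<open>Cylindrical approximation in mean\<close>

text \<open>The Borel sets whose indicator can be approximated contain the half-spaces, by smooth steps,
  and form a \<open>\<sigma>\<close>-algebra: complements correspond to \<open>1 - u\<close>, and a countable union is
  exhausted by finite unions, which correspond to \<open>1 - \<Prod>(1 - u\<^sub>i)\<close>. Several measures are treated at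
  once because the same \<open>u\<close> has to serve both \<open>\<gamma>\<close> and the singular part.\<close>

lemma FCb1_approximates_indicator:
  fixes \<M> :: "'a::{banach, second_countable_topology} measure set"
  assumes \<M>: "finite \<M>" "\<And>M. M \<in> \<M> \<Longrightarrow> finite_measure M" "\<And>M. M \<in> \<M> \<Longrightarrow> sets M = sets borel"
    and B: "B \<in> sets borel" and \<epsilon>: "0 < \<epsilon>"
  shows "\<exists>u\<in>FCb1. (\<forall>x. 0 \<le> u x \<and> u x \<le> 1) \<and> (\<forall>M\<in>\<M>. (\<integral>x. \<bar>u x - indicator B x\<bar> \<partial>M) < \<epsilon>)"
proof -
  have meas: "u \<in> borel_measurable M" if "u \<in> FCb1" "M \<in> \<M>" for u :: "'a \<Rightarrow> real" and M
    using FCb1_measurable[OF that(1)] \<M>(3)[OF that(2)] by (simp cong: measurable_cong_sets)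
  let ?G = "{{x. blinfun_apply \<xi> x \<le> a} | (\<xi> :: 'a \<Rightarrow>\<^sub>L real) a. True}"
  have "B \<in> sigma_sets UNIV ?G" using B borel_subset_sigma_halfspaces by blast
  then show ?thesis using \<epsilon>
  proof (induction arbitrary: \<epsilon> rule: sigma_sets.induct)
    case (Basic B)
    then obtain \<xi> :: "'a \<Rightarrow>\<^sub>L real" and a where B: "B = {x. blinfun_apply \<xi> x \<le> a}" by blast
    let ?u = "\<lambda>n x. logistic_step n a (blinfun_apply \<xi> x)"
    have "\<forall>M\<in>\<M>. eventually (\<lambda>n. (\<integral>x. \<bar>?u n x - indicator B x\<bar> \<partial>M) < \<epsilon>) sequentially"
    proof
      fix M assume M: "M \<in> \<M>"
      interpret finite_measure M by (rule \<M>(2)[OF M])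
      have [measurable]: "?u n \<in> borel_measurable M" for n by (rule meas[OF logistic_step_FCb1 M])
      have "B \<in> sets borel" unfolding B
        by (intro borel_closed closed_Collect_le continuous_intros linear_continuous_on blinfun.bounded_linear_right)
      then have [measurable]: "B \<in> sets M" using \<M>(3)[OF M] by simp
      have "(\<lambda>n. \<integral>x. \<bar>?u n x - indicator B x\<bar> \<partial>M) \<longlonglongrightarrow> (\<integral>x. 0 \<partial>M)"
      proof (rule integral_dominated_convergence[where w = "\<lambda>_. 1"])
        have "(\<lambda>n. \<bar>?u n x - indicator B x\<bar>) \<longlonglongrightarrow> \<bar>indicator {..a} (blinfun_apply \<xi> x) - indicator B x\<bar>" for x
          by (intro tendsto_intros logistic_step_tendsto)
        then show "AE x in M. (\<lambda>n. \<bar>?u n x - indicator B x\<bar>) \<longlonglongrightarrow> 0"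
          by (auto simp: B indicator_def)
        show "AE x in M. norm \<bar>?u n x - indicator B x\<bar> \<le> 1" for n
        proof (rule AE_I2)
          fix x
          show "norm \<bar>?u n x - indicator B x\<bar> \<le> 1"
            using logistic_step_bounds[of n a "blinfun_apply \<xi> x"] by (cases "x \<in> B") auto
        qed
      qed auto
      then show "eventually (\<lambda>n. (\<integral>x. \<bar>?u n x - indicator B x\<bar> \<partial>M) < \<epsilon>) sequentially"
        using Basic by (intro order_tendstoD) auto
    qed
    from eventually_ball_finite[OF \<M>(1) this] obtain n
      where "\<forall>M\<in>\<M>. (\<integral>x. \<bar>?u n x - indicator B x\<bar> \<partial>M) < \<epsilon>"
      by (auto simp: eventually_sequentially)
    then show ?case using logistic_step_FCb1 logistic_step_bounds by (intro bexI[of _ "?u n"]) auto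
  next
    case Empty
    then show ?case by (intro bexI[of _ "\<lambda>_. 0"] FCb1_const) auto
  next
    case (Compl B)
    then obtain u where u: "u \<in> FCb1" "\<forall>x. 0 \<le> u x \<and> u x \<le> 1" "\<forall>M\<in>\<M>. (\<integral>x. \<bar>u x - indicator B x\<bar> \<partial>M) < \<epsilon>"
      by blast
    have "\<bar>(1 + - 1 * u x) - indicator (UNIV - B) x\<bar> = \<bar>u x - indicator B x\<bar>" for x
      by (auto simp: indicator_def)
    with u show ?case by (intro bexI[of _ "\<lambda>x. 1 + - 1 * u x"] FCb1_affine) auto
  next
    case (Union B)
    define S where "S = (\<lambda>N::nat. \<Union>i<N. B i)"
    have "sigma_sets UNIV ?G \<subseteq> sets borel"
    proof (rule sets.sigma_sets_subset[of _ borel, simplified])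
      show "?G \<subseteq> sets borel"
        by (auto intro!: borel_closed closed_Collect_le continuous_intros linear_continuous_on blinfun.bounded_linear_right)
    qed
    then have Bb: "B i \<in> sets borel" for i using Union.hyps by blast
    have "\<forall>M\<in>\<M>. eventually (\<lambda>N. measure M ((\<Union>i. B i) - S N) < \<epsilon> / 2) sequentially"
    proof
      fix M assume M: "M \<in> \<M>"
      interpret finite_measure M by (rule \<M>(2)[OF M])
      have BM [measurable]: "B i \<in> sets M" for i using Bb \<M>(3)[OF M] by simp
      have SM [measurable]: "S N \<in> sets M" for N unfolding S_def by auto
      have "(\<lambda>N. measure M (S N)) \<longlonglongrightarrow> measure M (\<Union>N. S N)"
      proof (rule finite_Lim_measure_incseq)
        show "incseq S" unfolding S_def by (intro monoI UN_mono) auto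
      qed (use SM in auto)
      moreover have "(\<Union>N. S N) = (\<Union>i. B i)" by (auto simp: S_def)
      ultimately have "(\<lambda>N. measure M (\<Union>i. B i) - measure M (S N)) \<longlonglongrightarrow> measure M (\<Union>i. B i) - measure M (\<Union>i. B i)"
        by (intro tendsto_intros) simp
      then have "eventually (\<lambda>N. measure M (\<Union>i. B i) - measure M (S N) < \<epsilon> / 2) sequentially"
        using Union.prems by (intro order_tendstoD) auto
      moreover have "measure M ((\<Union>i. B i) - S N) = measure M (\<Union>i. B i) - measure M (S N)" for N
        by (rule finite_measure_Diff) (auto simp: S_def)
      ultimately show "eventually (\<lambda>N. measure M ((\<Union>i. B i) - S N) < \<epsilon> / 2) sequentially" by simp
    qed
    from eventually_ball_finite[OF \<M>(1) this] obtain N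
      where N: "\<And>M. M \<in> \<M> \<Longrightarrow> measure M ((\<Union>i. B i) - S N) < \<epsilon> / 2"
      by (auto simp: eventually_sequentially)
    define \<delta> where "\<delta> = \<epsilon> / (2 * (real N + 1))"
    have "0 < \<delta>" using Union.prems by (simp add: \<delta>_def)
    with Union.IH have "\<forall>i. \<exists>u\<in>FCb1. (\<forall>x. 0 \<le> u x \<and> u x \<le> 1) \<and> (\<forall>M\<in>\<M>. (\<integral>x. \<bar>u x - indicator (B i) x\<bar> \<partial>M) < \<delta>)"
      by blast
    then obtain u where u: "\<And>i. u i \<in> FCb1" "\<And>i x. 0 \<le> u i x" "\<And>i x. u i x \<le> 1"
      and err: "\<And>i M. M \<in> \<M> \<Longrightarrow> (\<integral>x. \<bar>u i x - indicator (B i) x\<bar> \<partial>M) < \<delta>" by metis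
    define w where "w = (\<lambda>x. 1 + - 1 * (\<Prod>i<N. 1 + - 1 * u i x))"
    have w: "w \<in> FCb1" unfolding w_def by (intro FCb1_affine FCb1_prod u)
    have w01: "0 \<le> w x \<and> w x \<le> 1" for x
    proof -
      have "0 \<le> (\<Prod>i<N. 1 + - 1 * u i x)" using u by (intro prod_nonneg) auto
      moreover have "(\<Prod>i<N. 1 + - 1 * u i x) \<le> 1" using u by (intro prod_le_1) auto
      ultimately show ?thesis by (simp add: w_def)
    qed
    have pt: "\<bar>w x - indicator (\<Union>i. B i) x\<bar> \<le> (\<Sum>i<N. \<bar>u i x - indicator (B i) x\<bar>) + indicator ((\<Union>i. B i) - S N) x" for x
    proof -
      have "indicator (S N) x = 1 - (\<Prod>i<N. 1 - indicator (B i) x :: real)"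
        unfolding S_def by (auto simp: indicator_def)
      then have "\<bar>w x - indicator (S N) x\<bar> = norm ((\<Prod>i<N. 1 + - 1 * u i x) - (\<Prod>i<N. 1 - indicator (B i) x))"
        unfolding w_def by simp
      also have "\<dots> \<le> (\<Sum>i<N. norm ((1 + - 1 * u i x) - (1 - indicator (B i) x)))"
        using u by (intro norm_prod_diff) (auto simp: indicator_def)
      also have "\<dots> = (\<Sum>i<N. \<bar>u i x - indicator (B i) x\<bar>)"
        by (intro sum.cong) auto
      finally have "\<bar>w x - indicator (S N) x\<bar> \<le> (\<Sum>i<N. \<bar>u i x - indicator (B i) x\<bar>)" .
      moreover have "indicator (\<Union>i. B i) x = indicator (S N) x + (indicator ((\<Union>i. B i) - S N) x :: real)"
        by (auto simp: indicator_def S_def)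
      moreover have "0 \<le> (indicator ((\<Union>i. B i) - S N) x :: real)" by simp
      ultimately show ?thesis by linarith
    qed
    have "(\<integral>x. \<bar>w x - indicator (\<Union>i. B i) x\<bar> \<partial>M) < \<epsilon>" if M: "M \<in> \<M>" for M
    proof -
      interpret finite_measure M by (rule \<M>(2)[OF M])
      have BM [measurable]: "B i \<in> sets M" for i using Bb \<M>(3)[OF M] by simp
      have SM [measurable]: "S N \<in> sets M" for N unfolding S_def by auto
      have [measurable]: "u i \<in> borel_measurable M" "w \<in> borel_measurable M" for i
        using meas[OF _ M] u w by auto
      have iu: "integrable M (\<lambda>x. \<bar>u i x - indicator (B i) x\<bar>)" for i
        using u by (intro integrable_const_bound[of _ 1]) (auto simp: indicator_def)
      have ii: "integrable M (\<lambda>x. indicator ((\<Union>i. B i) - S N) x :: real)"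
        by (intro integrable_const_bound[of _ 1]) (auto simp: indicator_def)
      have "(\<integral>x. \<bar>w x - indicator (\<Union>i. B i) x\<bar> \<partial>M) \<le> (\<integral>x. (\<Sum>i<N. \<bar>u i x - indicator (B i) x\<bar>) + indicator ((\<Union>i. B i) - S N) x \<partial>M)"
      proof (rule integral_mono)
        show "integrable M (\<lambda>x. \<bar>w x - indicator (\<Union>i. B i) x\<bar>)"
        proof (intro integrable_const_bound[of _ 1] AE_I2)
          show "norm \<bar>w x - indicator (\<Union>i. B i) x\<bar> \<le> 1" for x
            using w01[of x] by (cases "x \<in> (\<Union>i. B i)") auto
        qed measurable
      qed (use iu ii pt in auto)
      also have "\<dots> = (\<Sum>i<N. \<integral>x. \<bar>u i x - indicator (B i) x\<bar> \<partial>M) + measure M ((\<Union>i. B i) - S N)"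
        using iu ii by (subst Bochner_Integration.integral_add) auto
      also have "(\<Sum>i<N. \<integral>x. \<bar>u i x - indicator (B i) x\<bar> \<partial>M) \<le> (\<Sum>i<N. \<delta>)"
        using err[OF M] by (intro sum_mono less_imp_le)
      also have "(\<Sum>i<N. \<delta>) \<le> \<epsilon> / 2"
        using Union.prems by (simp add: \<delta>_def field_simps)
      also have "\<epsilon> / 2 + measure M ((\<Union>i. B i) - S N) < \<epsilon>" using N[OF M] by simp
      finally show ?thesis by simp
    qed
    with w w01 show ?case by blast
  qed
qed

lemma finite_measure_density_real:
  assumes "integrable M w" "\<And>x. 0 \<le> w x" shows "finite_measure (density M (\<lambda>x. ennreal (w x)))"
proof (rule finite_measureI)
  have [measurable]: "w \<in> borel_measurable M" using assms by auto
  have "emeasure (density M (\<lambda>x. ennreal (w x))) (space M) = (\<integral>\<^sup>+x. ennreal (w x) \<partial>M)"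
    by (simp add: emeasure_density nn_integral_set_ennreal[symmetric] cong: nn_integral_cong)
  also have "\<dots> \<noteq> \<infinity>" using assms(1) unfolding real_integrable_def by simp
  finally show "emeasure (density M (\<lambda>x. ennreal (w x))) (space (density M (\<lambda>x. ennreal (w x)))) \<noteq> \<infinity>"
    by simp
qed

definition running_max :: "(nat \<Rightarrow> 'a \<Rightarrow> real) \<Rightarrow> nat \<Rightarrow> 'a \<Rightarrow> real" where
  "running_max h n x = Max ((\<lambda>k. h k x) ` {..n})"

lemma running_max_0 [simp]: "running_max h 0 x = h 0 x"
  by (simp add: running_max_def)

lemma running_max_Suc: "running_max h (Suc n) x = max (h (Suc n) x) (running_max h n x)"
  by (simp add: running_max_def atMost_Suc)

lemma borel_measurable_running_max [measurable (raw)]: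
  "(\<And>k. h k \<in> borel_measurable M) \<Longrightarrow> running_max h n \<in> borel_measurable M"
  unfolding running_max_def by (intro borel_measurable_Max) auto

lemma integrable_running_max:
  assumes "\<And>k. integrable M (h k)" shows "integrable M (running_max h n)"
proof (induction n)
  case 0
  then show ?case using assms[of 0] by (simp cong: Bochner_Integration.integrable_cong)
next
  case (Suc n)
  then show ?case unfolding running_max_Suc[abs_def] using assms by (intro integrable_max)
qed

lemma incseq_running_max: "incseq (\<lambda>n. running_max h n x)"
  unfolding running_max_def by (intro monoI Max_mono image_mono) auto

lemma SUP_running_max: "(SUP n. ereal (h n x)) = (SUP n. ereal (running_max h n x))"
proof (rule antisym)
  show "(SUP n. ereal (h n x)) \<le> (SUP n. ereal (running_max h n x))"
    by (rule SUP_mono) (auto simp: running_max_def intro!: Max_ge)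
  show "(SUP n. ereal (running_max h n x)) \<le> (SUP n. ereal (h n x))"
  proof (rule SUP_least)
    fix n
    have "running_max h n x \<in> (\<lambda>k. h k x) ` {..n}" unfolding running_max_def by (intro Max_in) auto
    then obtain k where "running_max h n x = h k x" unfolding image_iff by blast
    then show "ereal (running_max h n x) \<le> (SUP n. ereal (h n x))"
      by (simp only:) (rule SUP_upper, simp)
  qed
qed

definition selection_error ::
    "'a measure \<Rightarrow> (nat \<Rightarrow> 'a \<Rightarrow> real) \<Rightarrow> (nat \<Rightarrow> 'a \<Rightarrow> real) \<Rightarrow> nat \<Rightarrow> real" where
  "selection_error M \<theta> h n = (\<integral>x. \<bar>(\<Sum>k\<le>n. \<theta> k x * h k x) - running_max h n x\<bar> \<partial>M)"

text \<open>By induction on the number of functions: the maximum of \<open>n + 2\<close> functions switches from the maximum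
  of the first \<open>n + 1\<close> to the last one on a Borel set, whose indicator is approximated by \<open>u\<close>
  with respect to the measure weighted by the height \<open>w\<close> of the jump. Mutual singularity allows this set
  to be chosen separately on \<open>N\<close> and on its complement.\<close>

lemma FCb1_partition_of_unity_approximates_Max:
  fixes M1 M2 :: "'a::{banach, second_countable_topology} measure" and f g :: "nat \<Rightarrow> 'a \<Rightarrow> real"
  assumes sets [measurable_cong]: "sets M1 = sets borel" "sets M2 = sets borel"
    and N: "N \<in> sets borel" "emeasure M1 N = 0" "emeasure M2 (- N) = 0"
    and f: "\<And>k. integrable M1 (f k)" and g: "\<And>k. integrable M2 (g k)" and \<epsilon>: "0 < \<epsilon>"
  shows "\<exists>\<theta>. (\<forall>k\<le>n. \<theta> k \<in> FCb1) \<and> (\<forall>k\<le>n. \<forall>x. 0 \<le> \<theta> k x) \<and> (\<forall>x. (\<Sum>k\<le>n. \<theta> k x) = 1) \<and>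
    selection_error M1 \<theta> f n < \<epsilon> \<and>
    selection_error M2 \<theta> g n < \<epsilon>"
  using \<epsilon>
proof (induction n arbitrary: \<epsilon>)
  case 0
  then show ?case by (intro exI[of _ "\<lambda>k x. 1"]) (auto simp: FCb1_const selection_error_def)
next
  case (Suc n)
  from Suc.IH[of "\<epsilon> / 2"] Suc.prems obtain \<theta> where \<theta>: "\<And>k. k \<le> n \<Longrightarrow> \<theta> k \<in> FCb1"
    "\<And>k x. k \<le> n \<Longrightarrow> 0 \<le> \<theta> k x" "\<And>x. (\<Sum>k\<le>n. \<theta> k x) = 1"
    and err: "selection_error M1 \<theta> f n < \<epsilon> / 2"
      "selection_error M2 \<theta> g n < \<epsilon> / 2"
    by auto
  have \<theta>_le: "\<theta> k x \<le> 1" if "k \<le> n" for k x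
    using member_le_sum[of k "{..n}" "\<lambda>k. \<theta> k x"] that \<theta> by auto
  define w where "w = (\<lambda>(h :: nat \<Rightarrow> 'a \<Rightarrow> real) x. \<bar>h (Suc n) x - running_max h n x\<bar>)"
  define B where "B = ({x. running_max f n x < f (Suc n) x} - N) \<union> ({x. running_max g n x < g (Suc n) x} \<inter> N)"
  have fm [measurable]: "f k \<in> borel_measurable borel" for k
    using f[of k] sets by (auto simp: measurable_cong_sets[OF sets(1) refl, of borel, symmetric])
  have gm [measurable]: "g k \<in> borel_measurable borel" for k
    using g[of k] sets by (auto simp: measurable_cong_sets[OF sets(2) refl, of borel, symmetric])
  have [measurable]: "N \<in> sets borel" by (rule N(1))
  have Bb [measurable]: "B \<in> sets borel" unfolding B_def by measurable
  let ?D = "\<lambda>M h. density M (\<lambda>x. ennreal (w h x))"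
  have w_int: "integrable M (w h)" if "\<And>k. integrable M (h k)" for M h
    unfolding w_def using integrable_running_max[of M h, OF that] that by auto
  have w_nonneg: "0 \<le> w h x" for h x by (simp add: w_def)
  have "\<exists>u\<in>FCb1. (\<forall>x. 0 \<le> u x \<and> u x \<le> 1) \<and>
    (\<forall>M\<in>{?D M1 f, ?D M2 g}. (\<integral>x. \<bar>u x - indicator B x\<bar> \<partial>M) < \<epsilon> / 2)"
    using Suc.prems sets f g Bb
    by (intro FCb1_approximates_indicator) (auto intro!: finite_measure_density_real w_int w_nonneg)
  then obtain u where u: "u \<in> FCb1" "\<And>x. 0 \<le> u x" "\<And>x. u x \<le> 1"
    and uerr: "(\<integral>x. \<bar>u x - indicator B x\<bar> \<partial>?D M1 f) < \<epsilon> / 2" "(\<integral>x. \<bar>u x - indicator B x\<bar> \<partial>?D M2 g) < \<epsilon> / 2"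
    by blast
  define \<theta>' where "\<theta>' = (\<lambda>k x. if k \<le> n then (1 + - 1 * u x) * \<theta> k x else u x)"
  have sum': "(\<Sum>k\<le>Suc n. \<theta>' k x * h k x) = (1 - u x) * (\<Sum>k\<le>n. \<theta> k x * h k x) + u x * h (Suc n) x" for h x
    by (simp add: \<theta>'_def sum_distrib_left mult.assoc)
  have estimate: "selection_error M \<theta>' h (Suc n) < \<epsilon>"
    if sM: "sets M = sets borel" and h: "\<And>k. integrable M (h k)"
      and AE_B: "AE x in M. x \<in> B \<longleftrightarrow> running_max h n x < h (Suc n) x"
      and e1: "selection_error M \<theta> h n < \<epsilon> / 2"
      and e2: "(\<integral>x. \<bar>u x - indicator B x\<bar> \<partial>?D M h) < \<epsilon> / 2"
    for M and h :: "nat \<Rightarrow> 'a \<Rightarrow> real"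
  proof -
    have mb: "borel_measurable M = (borel_measurable borel :: ('a \<Rightarrow> real) set)"
      by (rule measurable_cong_sets[OF sM refl])
    have [measurable]: "u \<in> borel_measurable M" "B \<in> sets M" "\<And>k. h k \<in> borel_measurable M"
      using FCb1_measurable[OF u(1)] Bb h sM by (auto simp: mb)
    have \<theta>m: "\<theta> k \<in> borel_measurable M" if "k \<le> n" for k
      using FCb1_measurable[OF \<theta>(1)[OF that]] by (simp add: mb)
    have wh: "integrable M (w h)" by (rule w_int[OF h])
    have "integrable M (\<lambda>x. \<theta> k x * h k x)" if "k \<le> n" for k
      using \<theta>m[OF that] \<theta>(2)[OF that] \<theta>_le[OF that]
      by (intro Bochner_Integration.integrable_bound[OF h[of k]]) (auto simp: abs_mult mult_left_le_one_le)
    then have S: "integrable M (\<lambda>x. \<Sum>k\<le>n. \<theta> k x * h k x)" by auto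
    have i1: "integrable M (\<lambda>x. \<bar>(\<Sum>k\<le>n. \<theta> k x * h k x) - running_max h n x\<bar>)"
      using S integrable_running_max[of M h, OF h] by auto
    have i2: "integrable M (\<lambda>x. w h x * \<bar>u x - indicator B x\<bar>)"
    proof (rule Bochner_Integration.integrable_bound[OF wh])
      have "\<bar>u x - indicator B x\<bar> \<le> 1" for x using u(2,3)[of x] by (auto simp: indicator_def)
      then show "AE x in M. norm (w h x * \<bar>u x - indicator B x\<bar>) \<le> norm (w h x)"
        by (intro AE_I2) (simp add: abs_mult mult_left_le)
    qed (use wh in auto)
    have i3: "integrable M (\<lambda>x. u x * h k x)" for k
      using u by (intro Bochner_Integration.integrable_bound[OF h[of k]]) (auto simp: abs_mult mult_left_le_one_le)
    have i4: "integrable M (\<lambda>x. (1 - u x) * (\<Sum>k\<le>n. \<theta> k x * h k x))"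
      using u S by (intro Bochner_Integration.integrable_bound[OF S]) (auto simp: abs_mult mult_left_le_one_le)
    have "selection_error M \<theta>' h (Suc n) \<le>
        (\<integral>x. \<bar>(\<Sum>k\<le>n. \<theta> k x * h k x) - running_max h n x\<bar> + w h x * \<bar>u x - indicator B x\<bar> \<partial>M)"
      unfolding selection_error_def
    proof (rule integral_mono_AE)
      show "integrable M (\<lambda>x. \<bar>(\<Sum>k\<le>Suc n. \<theta>' k x * h k x) - running_max h (Suc n) x\<bar>)"
        unfolding sum' using i3 i4 integrable_running_max[of M h "Suc n", OF h] by auto
      show "AE x in M. \<bar>(\<Sum>k\<le>Suc n. \<theta>' k x * h k x) - running_max h (Suc n) x\<bar> \<le>
          \<bar>(\<Sum>k\<le>n. \<theta> k x * h k x) - running_max h n x\<bar> + w h x * \<bar>u x - indicator B x\<bar>"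
        using AE_B
      proof eventually_elim
        case (elim x)
        let ?S = "\<Sum>k\<le>n. \<theta> k x * h k x" and ?m = "running_max h n x"
        have "max a m = m + indicator B x * (a - m)" if "x \<in> B \<longleftrightarrow> m < a" for a m :: real
          using that by (auto simp: indicator_def max_def)
        from this[OF elim] have "max (h (Suc n) x) ?m = ?m + indicator B x * (h (Suc n) x - ?m)" .
        then have "(1 - u x) * ?S + u x * h (Suc n) x - max (h (Suc n) x) ?m
            = (1 - u x) * (?S - ?m) + (u x - indicator B x) * (h (Suc n) x - ?m)"
          by (simp add: algebra_simps)
        also have "\<bar>\<dots>\<bar> \<le> \<bar>1 - u x\<bar> * \<bar>?S - ?m\<bar> + \<bar>u x - indicator B x\<bar> * \<bar>h (Suc n) x - ?m\<bar>"
          by (rule order_trans[OF abs_triangle_ineq]) (simp add: abs_mult)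
        also have "\<bar>1 - u x\<bar> * \<bar>?S - ?m\<bar> \<le> \<bar>?S - ?m\<bar>"
          using u(2,3)[of x] by (intro mult_left_le_one_le) auto
        finally show ?case unfolding sum' running_max_Suc w_def by (simp add: mult.commute)
      qed
    qed (use i1 i2 in auto)
    also have "\<dots> = selection_error M \<theta> h n + (\<integral>x. w h x * \<bar>u x - indicator B x\<bar> \<partial>M)"
      unfolding selection_error_def by (rule Bochner_Integration.integral_add[OF i1 i2])
    also have "(\<integral>x. w h x * \<bar>u x - indicator B x\<bar> \<partial>M) = (\<integral>x. \<bar>u x - indicator B x\<bar> \<partial>?D M h)"
      using wh w_nonneg by (subst integral_density) auto
    also have "selection_error M \<theta> h n + \<dots> < \<epsilon>"
      using e1 e2 by simp
    finally show ?thesis .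
  qed
  have "AE x in M1. x \<notin> N" using N sets by (intro AE_not_in) (auto simp: null_sets_def)
  then have "AE x in M1. x \<in> B \<longleftrightarrow> running_max f n x < f (Suc n) x"
    by eventually_elim (auto simp: B_def)
  from estimate[OF sets(1) f this err(1) uerr(1)]
  have 1: "selection_error M1 \<theta>' f (Suc n) < \<epsilon>" .
  have "AE x in M2. x \<notin> - N" using N sets by (intro AE_not_in) (auto simp: null_sets_def)
  then have "AE x in M2. x \<in> B \<longleftrightarrow> running_max g n x < g (Suc n) x"
    by eventually_elim (auto simp: B_def)
  from estimate[OF sets(2) g this err(2) uerr(2)]
  have 2: "selection_error M2 \<theta>' g (Suc n) < \<epsilon>" .
  show ?case
  proof (intro exI[of _ \<theta>'] conjI allI impI 1 2)
    show "\<theta>' k \<in> FCb1" if "k \<le> Suc n" for k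
    proof (cases "k \<le> n")
      case True
      then have "\<theta>' k = (\<lambda>x. (1 + - 1 * u x) * \<theta> k x)" unfolding \<theta>'_def by (simp only: if_True)
      then show ?thesis using \<theta>(1)[OF True] u(1) by (simp only:) (intro FCb1_mult FCb1_affine)
    next
      case False
      then show ?thesis using u(1) by (simp add: \<theta>'_def)
    qed
    show "0 \<le> \<theta>' k x" if "k \<le> Suc n" for k x
      using \<theta>(2)[of k x] u(2,3)[of x] by (auto simp: \<theta>'_def)
    show "(\<Sum>k\<le>Suc n. \<theta>' k x) = 1" for x
      using sum'[of x "\<lambda>_ _. 1"] \<theta>(3) by simp
  qed
qed

section \<open>Gram--Schmidt orthonormalization\<close>

function gram_schmidt :: "('v \<Rightarrow> 'v \<Rightarrow> real) \<Rightarrow> (nat \<Rightarrow> 'v::real_vector) \<Rightarrow> nat \<Rightarrow> 'v" where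
  "gram_schmidt b d n =
    (let r = d n - (\<Sum>i<n. b (d n) (gram_schmidt b d i) *\<^sub>R gram_schmidt b d i)
     in (1 / sqrt (b r r)) *\<^sub>R r)"
  by auto
termination by (relation "Wellfounded.measure (\<lambda>(b, d, n). n)") auto

declare gram_schmidt.simps [simp del]

text \<open>Linearly dependent vectors are not removed: at such an index the remainder is zero and so is
  the new vector, which is why the diagonal entries may vanish.\<close>

lemma gram_schmidt_orthonormal:
  fixes b :: "'v::real_vector \<Rightarrow> 'v \<Rightarrow> real" and d :: "nat \<Rightarrow> 'v"
  assumes lin: "\<And>y. linear (\<lambda>x. b x y)" and sym: "\<And>x y. b x y = b y x"
    and pos: "\<And>x. 0 \<le> b x x" and def: "\<And>x. b x x = 0 \<Longrightarrow> x = 0"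
  defines "e \<equiv> gram_schmidt b d"
  shows "b (e i) (e j) = (if i = j \<and> e i \<noteq> 0 then 1 else 0)"
    and "d n \<in> span (range e)"
proof -
  define r where "r = (\<lambda>n. d n - (\<Sum>i<n. b (d n) (e i) *\<^sub>R e i))"
  have e: "e n = (1 / sqrt (b (r n) (r n))) *\<^sub>R r n" for n
    unfolding e_def r_def by (subst gram_schmidt.simps) (simp add: Let_def)
  have zero: "b 0 y = 0" "b y 0 = 0" for y using linear_0[OF lin, of y] sym by auto
  have scale: "b (t *\<^sub>R x) y = t * b x y" "b y (t *\<^sub>R x) = t * b y x" for t x y
    using linear_scale[OF lin, of t x y] sym by auto
  have unit: "b (e n) (e n) = (if e n \<noteq> 0 then 1 else 0)" for n
    using pos[of "r n"] by (auto simp: e scale zero field_simps)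
  have orth: "\<forall>i<n. b (e n) (e i) = 0" for n
  proof (induction n rule: less_induct)
    case (less n)
    have o: "b (e j) (e i) = 0" if "i < n" "j < n" "i \<noteq> j" for i j
      using less that sym by (metis nat_neq_iff)
    show ?case
    proof (intro allI impI)
      fix i assume i: "i < n"
      have "b (r n) (e i) = b (d n) (e i) - (\<Sum>j<n. b (d n) (e j) * b (e j) (e i))"
        unfolding r_def by (simp add: linear_diff[OF lin] linear_sum[OF lin] scale)
      also have "(\<Sum>j<n. b (d n) (e j) * b (e j) (e i)) = (\<Sum>j\<in>{i}. b (d n) (e j) * b (e j) (e i))"
        using i o by (intro sum.mono_neutral_right) auto
      also have "b (d n) (e i) - \<dots> = 0" by (simp add: unit zero)
      finally show "b (e n) (e i) = 0" by (simp add: e[of n] scale)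
    qed
  qed
  show "b (e i) (e j) = (if i = j \<and> e i \<noteq> 0 then 1 else 0)"
    using orth[of i] orth[of j] unit[of i] sym[of "e i" "e j"] by (cases i j rule: linorder_cases) auto
  have "r n = sqrt (b (r n) (r n)) *\<^sub>R e n"
    using def[of "r n"] by (auto simp: e)
  then have "d n = sqrt (b (r n) (r n)) *\<^sub>R e n + (\<Sum>i<n. b (d n) (e i) *\<^sub>R e i)"
    unfolding r_def by (simp add: algebra_simps)
  also have "\<dots> \<in> span (range e)"
    by (intro span_add span_scale span_sum span_base) auto
  finally show "d n \<in> span (range e)" .
qed

section \<open>Supports of Gaussian measures\<close>

definition covariance :: "'a::real_normed_vector measure \<Rightarrow> ('a \<Rightarrow>\<^sub>L real) \<Rightarrow> ('a \<Rightarrow>\<^sub>L real) \<Rightarrow> real" where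
  "covariance \<gamma> \<xi> \<eta> = (\<integral>x. blinfun_apply \<xi> x * blinfun_apply \<eta> x \<partial>\<gamma>)"

lemma iexp_std_normal:
  "(CLINT g|std_normal_distribution. iexp (t * g)) = complex_of_real (exp (- t\<^sup>2 / 2))"
  using fun_cong[OF char_std_normal_distribution, of t] by (simp add: char_def)

lemma std_normal_prob_space: "prob_space std_normal_distribution"
  using real_dist_normal_dist by (simp add: real_distribution_def)

abbreviation bump :: "real \<Rightarrow> real \<Rightarrow> real \<Rightarrow> real" where
  "bump r s z \<equiv> exp (- (r * (z - s))\<^sup>2 / 2)"

text \<open>As the bump narrows, this decays only like \<open>1 / r\<close>, because the normal law has a positive density.\<close>

definition normal_bump :: "real \<Rightarrow> real \<Rightarrow> real" where
  "normal_bump r s = (\<integral>z. bump r s z \<partial>std_normal_distribution)"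

text \<open>Parseval's identity for two Gaussians: the bump is written as a superposition of
  characters and the two integrations are exchanged.\<close>

lemma normal_bump_Fourier:
  "(CLINT g|std_normal_distribution. iexp (- (r * s) * g) * complex_of_real (exp (- (r * g)\<^sup>2 / 2)))
    = complex_of_real (normal_bump r s)"
proof -
  let ?N = "std_normal_distribution"
  interpret N: prob_space ?N by (rule std_normal_prob_space)
  interpret P: pair_prob_space ?N ?N ..
  have "(CLINT g|?N. iexp (- (r * s) * g) * complex_of_real (exp (- (r * g)\<^sup>2 / 2)))
      = (CLINT g|?N. CLINT z|?N. iexp (r * (z - s) * g))"
  proof (rule Bochner_Integration.integral_cong[OF refl])
    fix g
    have "iexp (- (r * s) * g) * complex_of_real (exp (- (r * g)\<^sup>2 / 2))
        = iexp (- (r * s) * g) * (CLINT z|?N. iexp ((r * g) * z))"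
      unfolding iexp_std_normal ..
    also have "\<dots> = (CLINT z|?N. iexp (- (r * s) * g) * iexp ((r * g) * z))" by simp
    also have "\<dots> = (CLINT z|?N. iexp (r * (z - s) * g))"
      by (intro Bochner_Integration.integral_cong refl) (simp add: exp_add[symmetric] algebra_simps)
    finally show "iexp (- (r * s) * g) * complex_of_real (exp (- (r * g)\<^sup>2 / 2)) = (CLINT z|?N. iexp (r * (z - s) * g))" .
  qed
  also have "\<dots> = (CLINT z|?N. CLINT g|?N. iexp (r * (z - s) * g))"
  proof (rule P.Fubini_integral)
    show "integrable (?N \<Otimes>\<^sub>M ?N) (\<lambda>(z, g). iexp (r * (z - s) * g))"
      by (intro P.P.integrable_const_bound[of _ 1]) (auto simp: split_beta')
  qed
  also have "\<dots> = (CLINT z|?N. complex_of_real (bump r s z))"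
    unfolding iexp_std_normal ..
  also have "\<dots> = complex_of_real (normal_bump r s)"
    unfolding normal_bump_def by (rule integral_complex_of_real)
  finally show ?thesis .
qed

text \<open>On the interval of radius \<open>1 / r\<close> around \<open>s\<close> the bump is at least \<open>exp (- 1 / 2)\<close>, and for
  \<open>r \<ge> 1\<close> the normal density on this interval is at least its value at \<open>\<bar>s\<bar> + 1\<close>.\<close>

lemma normal_bump_lower_bound: "\<exists>C>0. \<forall>r\<ge>1. C / r \<le> normal_bump r s"
proof -
  let ?N = "std_normal_distribution"
  interpret N: prob_space ?N by (rule std_normal_prob_space)
  define C where "C = exp (- 1 / 2) * (2 * std_normal_density (\<bar>s\<bar> + 1))"
  have "0 < C" unfolding C_def by (simp add: normal_density_pos)
  moreover have "C / r \<le> normal_bump r s" if r: "r \<ge> 1" for r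
  proof -
    let ?I = "{s - 1 / r..s + 1 / r}"
    have I: "exp (- 1 / 2) * indicator ?I z \<le> bump r s z" for z
    proof (cases "z \<in> ?I")
      case True
      then have "\<bar>z - s\<bar> \<le> 1 / r" by auto
      then have "r * \<bar>z - s\<bar> \<le> 1" using r by (simp add: field_simps)
      then have "\<bar>r * (z - s)\<bar> \<le> 1" unfolding abs_mult using r by simp
      then have "(r * (z - s))\<^sup>2 \<le> 1" by (simp add: abs_square_le_1)
      then show ?thesis using True by simp
    qed simp
    have dens: "std_normal_density (\<bar>s\<bar> + 1) \<le> std_normal_density z" if "z \<in> ?I" for z
    proof -
      have "1 / r \<le> 1" using r by simp
      then have "\<bar>z\<bar> \<le> \<bar>s\<bar> + 1" using that by (auto simp: abs_le_iff)
      then have "\<bar>z\<bar>\<^sup>2 \<le> (\<bar>s\<bar> + 1)\<^sup>2" by (intro power_mono) auto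
      then show ?thesis by (simp add: std_normal_density_def divide_right_mono)
    qed
    have "(\<integral>z. std_normal_density (\<bar>s\<bar> + 1) * indicator ?I z \<partial>lborel) \<le> (\<integral>z. std_normal_density z * indicator ?I z \<partial>lborel)"
    proof (rule integral_mono)
      have "integrable lborel (\<lambda>z. std_normal_density z)" by simp
      then show "integrable lborel (\<lambda>z. std_normal_density z * indicator ?I z)"
        by (rule integrable_real_mult_indicator[rotated]) simp
      show "integrable lborel (\<lambda>z. std_normal_density (\<bar>s\<bar> + 1) * indicator ?I z)"
        by (intro integrable_mult_right integrable_real_indicator) (auto simp: emeasure_lborel_Icc_eq)
    qed (use dens in \<open>auto simp: indicator_def\<close>)
    moreover have "(\<integral>z. std_normal_density (\<bar>s\<bar> + 1) * indicator ?I z \<partial>lborel) = std_normal_density (\<bar>s\<bar> + 1) * (2 / r)"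
    proof -
      have "s - 1 / r \<le> s + 1 / r" using r by simp
      then have "measure lborel ?I = (s + 1 / r) - (s - 1 / r)" by (rule measure_lborel_Icc)
      moreover have "(\<integral>z. indicator ?I z \<partial>lborel) = measure lborel (?I \<inter> space lborel)"
        by (rule Bochner_Integration.integral_indicator)
      ultimately have "(\<integral>z. indicator ?I z \<partial>lborel) = 2 / r" by simp
      then show ?thesis by (simp only: integral_mult_right_zero)
    qed
    moreover have "(\<integral>z. std_normal_density z * indicator ?I z \<partial>lborel) = (\<integral>z. indicator ?I z \<partial>?N)"
      by (subst integral_density) (auto simp: normal_density_nonneg)
    ultimately have "exp (- 1 / 2) * (std_normal_density (\<bar>s\<bar> + 1) * (2 / r)) \<le> exp (- 1 / 2) * (\<integral>z. indicator ?I z \<partial>?N)"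
      by (intro mult_left_mono) auto
    also have "\<dots> = (\<integral>z. exp (- 1 / 2) * indicator ?I z \<partial>?N)" by simp
    also have "\<dots> \<le> normal_bump r s"
      unfolding normal_bump_def
      by (intro integral_mono I N.integrable_const_bound[of _ 1]) (auto simp: indicator_def)
    finally show ?thesis by (simp add: C_def ac_simps)
  qed
  ultimately show ?thesis by blast
qed

context
  fixes \<gamma> :: "'a::{banach, second_countable_topology} measure"
  assumes \<gamma>: "centered_gaussian_measure \<gamma>"
begin

lemma gaussian_prob_space: "prob_space \<gamma>" and gaussian_sets: "sets \<gamma> = sets borel"
  using \<gamma> unfolding centered_gaussian_measure_def by auto

lemma functional_measurable: "blinfun_apply \<xi> \<in> borel_measurable \<gamma>" for \<xi> :: "'a \<Rightarrow>\<^sub>L real"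
proof -
  have "blinfun_apply \<xi> \<in> borel_measurable borel"
    by (intro borel_measurable_continuous_onI linear_continuous_on blinfun.bounded_linear_right)
  then show ?thesis using gaussian_sets by (simp cong: measurable_cong_sets)
qed

lemma gaussian_functional:
  fixes \<xi> :: "'a \<Rightarrow>\<^sub>L real"
  shows integrable_functional_square: "integrable \<gamma> (\<lambda>x. (blinfun_apply \<xi> x)\<^sup>2)"
    and gaussian_characteristic_function:
      "(CLINT x|\<gamma>. iexp (blinfun_apply \<xi> x)) = complex_of_real (exp (- covariance \<gamma> \<xi> \<xi> / 2))"
proof -
  interpret prob_space \<gamma> by (rule gaussian_prob_space)
  note [measurable] = functional_measurable[of \<xi>]
  have cov: "covariance \<gamma> \<xi> \<xi> = (\<integral>x. (blinfun_apply \<xi> x)\<^sup>2 \<partial>\<gamma>)"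
    by (simp add: covariance_def power2_eq_square)
  consider "distr \<gamma> borel (blinfun_apply \<xi>) = return borel 0"
    | \<sigma> where "\<sigma> > 0" "distr \<gamma> borel (blinfun_apply \<xi>) = density lborel (\<lambda>t. ennreal (normal_density 0 \<sigma> t))"
    using \<gamma> unfolding centered_gaussian_measure_def by blast
  then have "integrable \<gamma> (\<lambda>x. (blinfun_apply \<xi> x)\<^sup>2) \<and>
    (CLINT x|\<gamma>. iexp (blinfun_apply \<xi> x)) = complex_of_real (exp (- covariance \<gamma> \<xi> \<xi> / 2))"
  proof cases
    case 1
    have "AE y in distr \<gamma> borel (blinfun_apply \<xi>). y = 0"
      unfolding 1 by (subst AE_return) auto
    then have AE: "AE x in \<gamma>. blinfun_apply \<xi> x = 0" by (subst (asm) AE_distr_iff) auto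
    have "integrable \<gamma> (\<lambda>x. (blinfun_apply \<xi> x)\<^sup>2) \<longleftrightarrow> integrable \<gamma> (\<lambda>x. 0::real)"
      by (rule integrable_cong_AE) (use AE in \<open>auto elim: eventually_mono\<close>)
    moreover have "covariance \<gamma> \<xi> \<xi> = (\<integral>x. 0 \<partial>\<gamma>)"
      unfolding cov by (rule integral_cong_AE) (use AE in \<open>auto elim: eventually_mono\<close>)
    moreover have "(CLINT x|\<gamma>. iexp (blinfun_apply \<xi> x)) = (CLINT x|\<gamma>. 1)"
      by (rule integral_cong_AE) (use AE in \<open>auto elim: eventually_mono\<close>)
    ultimately show ?thesis by (simp add: prob_space)
  next
    case 2
    let ?Z = "\<lambda>x. (blinfun_apply \<xi> x - 0) / \<sigma>"
    have "distr \<gamma> lborel (blinfun_apply \<xi>) = distr \<gamma> borel (blinfun_apply \<xi>)"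
      by (rule distr_cong) auto
    then have "distributed \<gamma> lborel (blinfun_apply \<xi>) (\<lambda>t. ennreal (normal_density 0 \<sigma> t))"
      unfolding distributed_def using 2 by auto
    then have "distributed \<gamma> lborel ?Z (\<lambda>t. ennreal (std_normal_density t))"
      using normal_standard_normal_convert[OF 2(1)] by blast
    then have Z: "distr \<gamma> lborel ?Z = std_normal_distribution" by (simp add: distributed_def)
    have scale: "blinfun_apply \<xi> x = \<sigma> * ?Z x" for x using 2(1) by simp
    have sq: "integrable std_normal_distribution (\<lambda>z. z\<^sup>2)"
      using integrable_std_normal_distribution_moment[of 2] by simp
    have sq_int: "(\<integral>z. z\<^sup>2 \<partial>std_normal_distribution) = 1"
      using std_normal_distribution_even_moments(1)[of 1] by (simp add: numeral_2_eq_2)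
    have iZ: "integrable \<gamma> (\<lambda>x. (?Z x)\<^sup>2)"
      using sq unfolding Z[symmetric] by (subst (asm) integrable_distr_eq) auto
    have "integrable \<gamma> (\<lambda>x. \<sigma>\<^sup>2 * (?Z x)\<^sup>2)" using iZ by (rule integrable_mult_right)
    then have 1: "integrable \<gamma> (\<lambda>x. (blinfun_apply \<xi> x)\<^sup>2)"
      using 2(1) by (simp add: power_divide)
    have "(\<integral>x. (?Z x)\<^sup>2 \<partial>\<gamma>) = 1"
      using sq_int unfolding Z[symmetric] by (subst (asm) integral_distr) auto
    moreover have "covariance \<gamma> \<xi> \<xi> = (\<integral>x. \<sigma>\<^sup>2 * (?Z x)\<^sup>2 \<partial>\<gamma>)"
      unfolding cov using 2(1) by (simp add: power_divide)
    ultimately have c: "covariance \<gamma> \<xi> \<xi> = \<sigma>\<^sup>2" by simp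
    have "(CLINT x|\<gamma>. iexp (blinfun_apply \<xi> x)) = (CLINT x|\<gamma>. iexp (\<sigma> * ?Z x))"
      by (subst scale) simp
    also have "\<dots> = (CLINT z|std_normal_distribution. iexp (\<sigma> * z))"
      unfolding Z[symmetric] by (subst integral_distr) auto
    also have "\<dots> = complex_of_real (exp (- covariance \<gamma> \<xi> \<xi> / 2))"
      unfolding iexp_std_normal c ..
    finally show ?thesis using 1 by simp
  qed
  then show "integrable \<gamma> (\<lambda>x. (blinfun_apply \<xi> x)\<^sup>2)"
    "(CLINT x|\<gamma>. iexp (blinfun_apply \<xi> x)) = complex_of_real (exp (- covariance \<gamma> \<xi> \<xi> / 2))" by auto
qed

lemma integrable_functional_mult:
  fixes \<xi> \<eta> :: "'a \<Rightarrow>\<^sub>L real"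
  shows "integrable \<gamma> (\<lambda>x. blinfun_apply \<xi> x * blinfun_apply \<eta> x)"
proof (rule Bochner_Integration.integrable_bound)
  show "integrable \<gamma> (\<lambda>x. (blinfun_apply \<xi> x)\<^sup>2 + (blinfun_apply \<eta> x)\<^sup>2)"
    by (intro Bochner_Integration.integrable_add integrable_functional_square)
  have "\<bar>s * t\<bar> \<le> \<bar>s\<^sup>2 + t\<^sup>2\<bar>" for s t :: real
  proof -
    have "2 * (\<bar>s\<bar> * \<bar>t\<bar>) \<le> s\<^sup>2 + t\<^sup>2"
      using zero_le_power2[of "\<bar>s\<bar> - \<bar>t\<bar>"] by (simp add: power2_diff)
    moreover have "0 \<le> \<bar>s\<bar> * \<bar>t\<bar>" by simp
    ultimately have "\<bar>s * t\<bar> \<le> s\<^sup>2 + t\<^sup>2" unfolding abs_mult by linarith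
    then show ?thesis by simp
  qed
  then show "AE x in \<gamma>. norm (blinfun_apply \<xi> x * blinfun_apply \<eta> x) \<le> norm ((blinfun_apply \<xi> x)\<^sup>2 + (blinfun_apply \<eta> x)\<^sup>2)"
    by simp
qed (use functional_measurable in measurable)

lemma linear_covariance: "linear (\<lambda>\<xi>. covariance \<gamma> \<xi> \<eta>)"
  unfolding covariance_def using integrable_functional_mult
  by (intro linearI) (simp_all add: blinfun.add_left blinfun.scaleR_left distrib_right mult.assoc)

lemma covariance_sym: "covariance \<gamma> \<xi> \<eta> = covariance \<gamma> \<eta> \<xi>"
  unfolding covariance_def by (simp add: mult.commute)

lemma covariance_nonneg: "0 \<le> covariance \<gamma> \<xi> \<xi>"
  unfolding covariance_def by simp

text \<open>Non-degeneracy enters here: the kernel of a functional of variance zero is a closed subspace of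
  full measure.\<close>

lemma covariance_definite:
  assumes nd: "nondegenerate_measure \<gamma>" and 0: "covariance \<gamma> \<xi> \<xi> = 0" shows "\<xi> = 0"
proof -
  have AE: "AE x in \<gamma>. blinfun_apply \<xi> x = 0"
  proof -
    have "AE x in \<gamma>. blinfun_apply \<xi> x * blinfun_apply \<xi> x = 0"
      using 0 integral_nonneg_eq_0_iff_AE[OF integrable_functional_mult[of \<xi> \<xi>]]
      by (simp add: covariance_def)
    then show ?thesis by eventually_elim simp
  qed
  let ?V = "{x. blinfun_apply \<xi> x = 0}"
  have "closed ?V"
    by (intro closed_Collect_eq continuous_intros linear_continuous_on blinfun.bounded_linear_right)
  moreover have "subspace ?V" by (auto simp: subspace_def blinfun.add_right blinfun.scaleR_right blinfun.zero_right)
  moreover have "emeasure \<gamma> ?V = emeasure \<gamma> UNIV"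
    using AE \<open>closed ?V\<close> gaussian_sets by (intro emeasure_eq_AE) auto
  ultimately have "?V = UNIV" using nd unfolding nondegenerate_measure_def by blast
  then show "\<xi> = 0" by (intro blinfun_eqI) auto
qed

text \<open>Orthogonal functionals behave like independent Gaussian variables. Each Gaussian factor is a
  superposition of characters, so the characteristic function determines the integral.\<close>

lemma gaussian_integral_prod_bumps:
  fixes T :: "('a \<Rightarrow>\<^sub>L real) set"
  assumes "finite T" and "\<And>a b. a \<in> T \<Longrightarrow> b \<in> T \<Longrightarrow> covariance \<gamma> a b = (if a = b then 1 else 0)"
    and "\<And>a. a \<in> T \<Longrightarrow> covariance \<gamma> a \<zeta> = 0"
  shows "(CLINT x|\<gamma>. complex_of_real (\<Prod>a\<in>T. bump r (s a) (blinfun_apply a x)) * iexp (blinfun_apply \<zeta> x))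
    = complex_of_real ((\<Prod>a\<in>T. normal_bump r (s a)) * exp (- covariance \<gamma> \<zeta> \<zeta> / 2))"
  using assms
proof (induction T arbitrary: \<zeta> rule: finite_induct)
  case empty
  show ?case by (simp add: gaussian_characteristic_function)
next
  case (insert a T)
  let ?N = "std_normal_distribution"
  interpret G: prob_space \<gamma> by (rule gaussian_prob_space)
  interpret N: prob_space ?N by (rule std_normal_prob_space)
  interpret P: pair_prob_space \<gamma> ?N ..
  note [measurable] = functional_measurable
  let ?f = "\<lambda>x. complex_of_real (\<Prod>a\<in>T. bump r (s a) (blinfun_apply a x))"
  have f1: "norm (?f x) \<le> 1" for x
  proof -
    have "0 \<le> (\<Prod>a\<in>T. bump r (s a) (blinfun_apply a x))"
      "(\<Prod>a\<in>T. bump r (s a) (blinfun_apply a x)) \<le> 1"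
      by (auto intro!: prod_nonneg prod_le_1)
    then show ?thesis by (simp only: norm_of_real abs_of_nonneg)
  qed
  let ?\<zeta> = "\<lambda>g. \<zeta> + (r * g) *\<^sub>R a"
  have aT: "covariance \<gamma> b a = 0" if "b \<in> T" for b using insert.prems(1)[of b a] insert.hyps that by auto
  have orth: "covariance \<gamma> b (?\<zeta> g) = 0" if "b \<in> T" for b g
    using insert.prems(2)[of b] aT[OF that] that
    by (simp add: covariance_sym[of b] linear_add[OF linear_covariance] linear_scale[OF linear_covariance])
  have cov: "covariance \<gamma> (?\<zeta> g) (?\<zeta> g) = covariance \<gamma> \<zeta> \<zeta> + (r * g)\<^sup>2" for g
  proof -
    have "covariance \<gamma> a a = 1" "covariance \<gamma> a \<zeta> = 0" "covariance \<gamma> \<zeta> a = 0"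
      using insert.prems covariance_sym[of a \<zeta>] by auto
    then show ?thesis
      by (simp add: linear_add[OF linear_covariance] linear_scale[OF linear_covariance]
          covariance_sym[of \<zeta> "?\<zeta> g"] covariance_sym[of a "?\<zeta> g"] power2_eq_square)
  qed
  \<comment> \<open>Once the bump of \<open>a\<close> is written as a superposition of characters with frequency \<open>r * g\<close>, it only shifts
    \<open>\<zeta>\<close> by a multiple of \<open>a\<close>; this multiple is orthogonal to the remaining functionals.\<close>
  have "(CLINT x|\<gamma>. complex_of_real (\<Prod>a\<in>insert a T. bump r (s a) (blinfun_apply a x)) * iexp (blinfun_apply \<zeta> x))
      = (CLINT x|\<gamma>. CLINT g|?N. ?f x * iexp (blinfun_apply \<zeta> x) * iexp (r * (blinfun_apply a x - s a) * g))"
  proof (rule Bochner_Integration.integral_cong[OF refl])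
    fix x
    have "complex_of_real (\<Prod>a\<in>insert a T. bump r (s a) (blinfun_apply a x)) * iexp (blinfun_apply \<zeta> x)
      = ?f x * iexp (blinfun_apply \<zeta> x) * (CLINT g|?N. iexp (r * (blinfun_apply a x - s a) * g))"
      unfolding iexp_std_normal using insert.hyps by simp
    also have "\<dots> = (CLINT g|?N. ?f x * iexp (blinfun_apply \<zeta> x) * iexp (r * (blinfun_apply a x - s a) * g))"
      by (rule integral_mult_right_zero[symmetric])
    finally show "complex_of_real (\<Prod>a\<in>insert a T. bump r (s a) (blinfun_apply a x)) * iexp (blinfun_apply \<zeta> x) = \<dots>" .
  qed
  also have "\<dots> = (CLINT g|?N. CLINT x|\<gamma>. ?f x * iexp (blinfun_apply \<zeta> x) * iexp (r * (blinfun_apply a x - s a) * g))"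
  proof (rule P.Fubini_integral[symmetric])
    show "integrable (\<gamma> \<Otimes>\<^sub>M ?N) (\<lambda>(x, g). ?f x * iexp (blinfun_apply \<zeta> x) * iexp (r * (blinfun_apply a x - s a) * g))"
    proof (rule P.P.integrable_const_bound[of _ 1])
      show "AE z in \<gamma> \<Otimes>\<^sub>M ?N. norm (case z of (x, g) \<Rightarrow> ?f x * iexp (blinfun_apply \<zeta> x) * iexp (r * (blinfun_apply a x - s a) * g)) \<le> 1"
        using f1 by (intro AE_I2) (simp add: split_beta' norm_mult)
    qed simp
  qed
  also have "\<dots> = (CLINT g|?N. iexp (- (r * s a) * g) * (CLINT x|\<gamma>. ?f x * iexp (blinfun_apply (?\<zeta> g) x)))"
  proof (rule Bochner_Integration.integral_cong[OF refl])
    fix g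
    have "?f x * iexp (blinfun_apply \<zeta> x) * iexp (r * (blinfun_apply a x - s a) * g)
        = iexp (- (r * s a) * g) * (?f x * iexp (blinfun_apply (?\<zeta> g) x))" for x
      by (simp add: exp_add[symmetric] blinfun.add_left blinfun.scaleR_left algebra_simps)
    then show "(CLINT x|\<gamma>. ?f x * iexp (blinfun_apply \<zeta> x) * iexp (r * (blinfun_apply a x - s a) * g))
        = iexp (- (r * s a) * g) * (CLINT x|\<gamma>. ?f x * iexp (blinfun_apply (?\<zeta> g) x))"
      by (simp only: integral_mult_right_zero)
  qed
  also have "\<dots> = (CLINT g|?N. complex_of_real ((\<Prod>a\<in>T. normal_bump r (s a)) * exp (- covariance \<gamma> \<zeta> \<zeta> / 2))
      * (iexp (- (r * s a) * g) * complex_of_real (exp (- (r * g)\<^sup>2 / 2))))"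
  proof (rule Bochner_Integration.integral_cong[OF refl])
    fix g
    have e: "exp (- (covariance \<gamma> \<zeta> \<zeta> + (r * g)\<^sup>2) / 2) = exp (- covariance \<gamma> \<zeta> \<zeta> / 2) * exp (- (r * g)\<^sup>2 / 2)"
      by (simp add: exp_add[symmetric] field_simps)
    have "(CLINT x|\<gamma>. ?f x * iexp (blinfun_apply (?\<zeta> g) x))
      = complex_of_real ((\<Prod>a\<in>T. normal_bump r (s a)) * exp (- covariance \<gamma> (?\<zeta> g) (?\<zeta> g) / 2))"
      using insert.prems(1) orth by (intro insert.IH) auto
    then show "iexp (- (r * s a) * g) * (CLINT x|\<gamma>. ?f x * iexp (blinfun_apply (?\<zeta> g) x))
      = complex_of_real ((\<Prod>a\<in>T. normal_bump r (s a)) * exp (- covariance \<gamma> \<zeta> \<zeta> / 2))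
      * (iexp (- (r * s a) * g) * complex_of_real (exp (- (r * g)\<^sup>2 / 2)))"
      unfolding cov e by (simp only: of_real_mult ac_simps)
  qed
  also have "\<dots> = complex_of_real ((\<Prod>a\<in>T. normal_bump r (s a)) * exp (- covariance \<gamma> \<zeta> \<zeta> / 2)) * complex_of_real (normal_bump r (s a))"
    by (simp only: integral_mult_right_zero normal_bump_Fourier)
  also have "\<dots> = complex_of_real ((\<Prod>a\<in>insert a T. normal_bump r (s a)) * exp (- covariance \<gamma> \<zeta> \<zeta> / 2))"
    using insert.hyps by (simp add: ac_simps)
  finally show ?case .
qed

text \<open>Outside the slab the product of bumps of width \<open>1 / n\<close> is at most \<open>exp (- n\<^sup>2 \<delta>\<^sup>2 / 2)\<close>, while its
  integral is at least a positive constant times \<open>n\<close> to the power \<open>- card T\<close>. For large \<open>n\<close> both cannot hold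
  if the outside has full measure.\<close>

lemma gaussian_orthonormal_slab_positive:
  fixes T :: "('a \<Rightarrow>\<^sub>L real) set"
  assumes T: "finite T" "\<And>a b. a \<in> T \<Longrightarrow> b \<in> T \<Longrightarrow> covariance \<gamma> a b = (if a = b then 1 else 0)"
    and \<delta>: "0 < \<delta>"
  shows "\<not> (AE x in \<gamma>. \<exists>a\<in>T. \<delta> \<le> \<bar>blinfun_apply a x - s a\<bar>)"
proof
  assume AE: "AE x in \<gamma>. \<exists>a\<in>T. \<delta> \<le> \<bar>blinfun_apply a x - s a\<bar>"
  interpret prob_space \<gamma> by (rule gaussian_prob_space)
  note [measurable] = functional_measurable
  have "\<forall>a. \<exists>C>0. \<forall>r\<ge>1. C / r \<le> normal_bump r (s a)" using normal_bump_lower_bound by blast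
  then obtain C where C: "\<And>a. C a > 0" "\<And>a r. r \<ge> 1 \<Longrightarrow> C a / r \<le> normal_bump r (s a)" by metis
  let ?m = "card T" and ?c = "\<delta>\<^sup>2 / 2"
  have "0 < ?c" using \<delta> by simp
  \<comment> \<open>Bumps of width \<open>1 / n\<close> give the square of \<open>n\<close> in the exponent; its first power is enough and matches
    the limit of \<open>t\<^sup>m / exp t\<close>.\<close>
  have bound: "(\<Prod>a\<in>T. C a) * ?c ^ ?m \<le> (?c * real n) ^ ?m / exp (?c * real n)" if n: "n \<ge> 1" for n
  proof -
    let ?r = "real n"
    let ?f = "\<lambda>x. \<Prod>a\<in>T. bump ?r (s a) (blinfun_apply a x)"
    have "covariance \<gamma> a 0 = 0" for a using linear_0[OF linear_covariance] covariance_sym by metis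
    then have "(CLINT x|\<gamma>. complex_of_real (?f x) * iexp (blinfun_apply 0 x)) = complex_of_real ((\<Prod>a\<in>T. normal_bump ?r (s a)) * exp (- covariance \<gamma> 0 0 / 2))"
      using T by (intro gaussian_integral_prod_bumps) auto
    moreover have "covariance \<gamma> 0 0 = 0" by (simp add: covariance_def blinfun.zero_left)
    ultimately have "(CLINT x|\<gamma>. complex_of_real (?f x)) = complex_of_real (\<Prod>a\<in>T. normal_bump ?r (s a))"
      by (simp add: blinfun.zero_left)
    then have "complex_of_real (\<integral>x. ?f x \<partial>\<gamma>) = complex_of_real (\<Prod>a\<in>T. normal_bump ?r (s a))"
      by (simp only: integral_complex_of_real)
    then have eq: "(\<integral>x. ?f x \<partial>\<gamma>) = (\<Prod>a\<in>T. normal_bump ?r (s a))" by (simp only: of_real_eq_iff)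
    have f_le: "?f x \<le> exp (- (?c * ?r))" if ex: "\<exists>a\<in>T. \<delta> \<le> \<bar>blinfun_apply a x - s a\<bar>" for x
    proof -
      obtain a where a: "a \<in> T" "\<delta> \<le> \<bar>blinfun_apply a x - s a\<bar>" using ex by blast
      have "?f x = bump ?r (s a) (blinfun_apply a x) * (\<Prod>b\<in>T - {a}. bump ?r (s b) (blinfun_apply b x))"
        using T(1) a(1) by (rule prod.remove)
      also have "\<dots> \<le> bump ?r (s a) (blinfun_apply a x) * 1"
        by (intro mult_left_mono prod_le_1) auto
      also have "\<dots> \<le> exp (- (?c * ?r))"
      proof -
        have "\<delta>\<^sup>2 * ?r \<le> (blinfun_apply a x - s a)\<^sup>2 * ?r\<^sup>2"
        proof (rule mult_mono)
          show "\<delta>\<^sup>2 \<le> (blinfun_apply a x - s a)\<^sup>2" using a(2) \<delta> by (simp add: abs_le_square_iff[symmetric])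
          show "?r \<le> ?r\<^sup>2" using n by (simp add: power2_eq_square)
        qed auto
        then show ?thesis by (simp add: power_mult_distrib mult.commute)
      qed
      finally show ?thesis .
    qed
    have "(\<Prod>a\<in>T. C a / ?r) \<le> (\<Prod>a\<in>T. normal_bump ?r (s a))"
      using C n by (intro prod_mono) (auto intro: less_imp_le)
    also have "\<dots> \<le> (\<integral>x. exp (- (?c * ?r)) \<partial>\<gamma>)"
      unfolding eq[symmetric]
    proof (rule integral_mono_AE)
      show "integrable \<gamma> ?f"
        by (intro integrable_const_bound[of _ 1]) (auto simp: abs_prod intro!: prod_le_1)
      show "AE x in \<gamma>. ?f x \<le> exp (- (?c * ?r))"
        using AE by eventually_elim (rule f_le)
    qed simp
    also have "\<dots> = exp (- (?c * ?r))" by (simp add: prob_space)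
    finally have "(\<Prod>a\<in>T. C a) / ?r ^ ?m \<le> exp (- (?c * ?r))" by (simp add: prod_dividef)
    then have "(\<Prod>a\<in>T. C a) \<le> ?r ^ ?m * exp (- (?c * ?r))" using n by (simp add: divide_le_eq mult.commute)
    then have "(\<Prod>a\<in>T. C a) * ?c ^ ?m \<le> ?r ^ ?m * exp (- (?c * ?r)) * ?c ^ ?m"
      using \<open>0 < ?c\<close> by (intro mult_right_mono) auto
    then show ?thesis by (simp only: exp_minus power_mult_distrib divide_inverse mult_ac)
  qed
  have "((\<lambda>t::real. t ^ ?m / exp t) \<longlongrightarrow> 0) at_top" by (rule tendsto_power_div_exp_0)
  moreover have "filterlim (\<lambda>n. ?c * real n) at_top sequentially"
    by (rule filterlim_tendsto_pos_mult_at_top[OF tendsto_const \<open>0 < ?c\<close> filterlim_real_sequentially])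
  ultimately have "(\<lambda>n. (?c * real n) ^ ?m / exp (?c * real n)) \<longlonglongrightarrow> 0"
    by (rule filterlim_compose)
  then have "(\<Prod>a\<in>T. C a) * ?c ^ ?m \<le> 0"
    by (rule LIMSEQ_le_const) (use bound in blast)
  moreover have "0 < (\<Prod>a\<in>T. C a) * ?c ^ ?m" using C(1) \<open>0 < ?c\<close> by (intro mult_pos_pos prod_pos) auto
  ultimately show False by simp
qed

text \<open>Full support for cylinders. Every functional in \<open>L\<close> is a combination of orthonormal ones, so a
  sufficiently thin orthonormal slab is contained in the given cylinder.\<close>

lemma gaussian_cylinder_positive:
  fixes L :: "('a \<Rightarrow>\<^sub>L real) set"
  assumes nd: "nondegenerate_measure \<gamma>" and L: "finite L" and \<epsilon>: "0 < \<epsilon>"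
    and AE: "AE x in \<gamma>. Q x"
  shows "\<exists>x. Q x \<and> (\<forall>\<eta>\<in>L. \<bar>blinfun_apply \<eta> (x - x0)\<bar> < \<epsilon>)"
proof -
  define d where "d = from_nat_into (insert 0 L)"
  have range_d: "range d = insert 0 L" unfolding d_def using L by (intro range_from_nat_into) (auto intro: countable_finite)
  define e where "e = gram_schmidt (covariance \<gamma>) d"
  have orth: "covariance \<gamma> (e i) (e j) = (if i = j \<and> e i \<noteq> 0 then 1 else 0)" for i j
    unfolding e_def
    by (rule gram_schmidt_orthonormal[OF linear_covariance covariance_sym covariance_nonneg covariance_definite[OF nd]])
  have d_span: "d n \<in> span (range e)" for n
    unfolding e_def
    by (rule gram_schmidt_orthonormal[OF linear_covariance covariance_sym covariance_nonneg covariance_definite[OF nd]])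
  have "\<forall>\<eta>\<in>L. \<exists>p. finite (fst p) \<and> fst p \<subseteq> range e \<and> \<eta> = (\<Sum>a\<in>fst p. snd p a *\<^sub>R a)"
  proof
    fix \<eta> assume "\<eta> \<in> L"
    then have "\<eta> \<in> range d" using range_d by simp
    then have "\<eta> \<in> span (range e)" using d_span by auto
    then obtain T r where "finite T" "T \<subseteq> range e" "\<eta> = (\<Sum>a\<in>T. r a *\<^sub>R a)"
      unfolding span_explicit by blast
    then show "\<exists>p. finite (fst p) \<and> fst p \<subseteq> range e \<and> \<eta> = (\<Sum>a\<in>fst p. snd p a *\<^sub>R a)"
      by (intro exI[of _ "(T, r)"]) simp
  qed
  from bchoice[OF this] obtain p where p: "\<forall>\<eta>\<in>L. finite (fst (p \<eta>)) \<and> fst (p \<eta>) \<subseteq> range e \<and> \<eta> = (\<Sum>a\<in>fst (p \<eta>). snd (p \<eta>) a *\<^sub>R a)"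
    by blast
  define T r where "T = (\<lambda>\<eta>. fst (p \<eta>))" and "r = (\<lambda>\<eta>. snd (p \<eta>))"
  have T: "finite (T \<eta>)" "T \<eta> \<subseteq> range e" and r: "\<eta> = (\<Sum>a\<in>T \<eta>. r \<eta> a *\<^sub>R a)" if "\<eta> \<in> L" for \<eta>
    using p that unfolding T_def r_def by blast+
  define U where "U = (\<Union>\<eta>\<in>L. T \<eta>) - {0}"
  have "finite U" unfolding U_def using L T(1) by auto
  have orthU: "covariance \<gamma> a b = (if a = b then 1 else 0)" if ab: "a \<in> U" "b \<in> U" for a b
  proof -
    obtain i j where "a = e i" "b = e j" "e i \<noteq> 0" "e j \<noteq> 0" using ab T(2) unfolding U_def by blast
    then show ?thesis using orth[of i j] orth[of i i] by metis
  qed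
  define K where "K = 1 + (\<Sum>\<eta>\<in>L. \<Sum>a\<in>T \<eta>. \<bar>r \<eta> a\<bar>)"
  have "1 \<le> K" unfolding K_def by (simp add: sum_nonneg)
  define \<delta> where "\<delta> = \<epsilon> / K"
  have "0 < \<delta>" unfolding \<delta>_def using \<epsilon> \<open>1 \<le> K\<close> by simp
  have not_AE: "\<not> (AE x in \<gamma>. \<exists>a\<in>U. \<delta> \<le> \<bar>blinfun_apply a x - blinfun_apply a x0\<bar>)"
    using \<open>finite U\<close> orthU \<open>0 < \<delta>\<close> by (rule gaussian_orthonormal_slab_positive)
  have "\<exists>x. Q x \<and> \<not> (\<exists>a\<in>U. \<delta> \<le> \<bar>blinfun_apply a x - blinfun_apply a x0\<bar>)"
  proof (rule ccontr)
    assume "\<not> ?thesis"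
    then have "AE x in \<gamma>. \<exists>a\<in>U. \<delta> \<le> \<bar>blinfun_apply a x - blinfun_apply a x0\<bar>"
      using AE by (auto elim!: eventually_mono)
    then show False using not_AE by contradiction
  qed
  then obtain x where "Q x" and x: "\<not> (\<exists>a\<in>U. \<delta> \<le> \<bar>blinfun_apply a x - blinfun_apply a x0\<bar>)" by blast
  have small: "\<bar>blinfun_apply a (x - x0)\<bar> < \<delta>" if "a \<in> U \<or> a = 0" for a
    using that x \<open>0 < \<delta>\<close> by (auto simp: blinfun.diff_right blinfun.zero_left not_le)
  have "\<bar>blinfun_apply \<eta> (x - x0)\<bar> < \<epsilon>" if \<eta>: "\<eta> \<in> L" for \<eta>
  proof -
    have "\<bar>blinfun_apply \<eta> (x - x0)\<bar> = \<bar>\<Sum>a\<in>T \<eta>. r \<eta> a * blinfun_apply a (x - x0)\<bar>"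
      by (subst r[OF \<eta>]) (simp add: blinfun.sum_left blinfun.scaleR_left)
    also have "\<dots> \<le> (\<Sum>a\<in>T \<eta>. \<bar>r \<eta> a\<bar> * \<bar>blinfun_apply a (x - x0)\<bar>)"
      by (rule order_trans[OF sum_abs]) (simp add: abs_mult)
    also have "\<dots> \<le> (\<Sum>a\<in>T \<eta>. \<bar>r \<eta> a\<bar> * \<delta>)"
    proof (intro sum_mono mult_left_mono)
      fix a assume "a \<in> T \<eta>"
      then have "a \<in> U \<or> a = 0" using \<eta> by (auto simp: U_def)
      then show "\<bar>blinfun_apply a (x - x0)\<bar> \<le> \<delta>" using small by (simp add: less_imp_le)
    qed auto
    also have "\<dots> = (\<Sum>a\<in>T \<eta>. \<bar>r \<eta> a\<bar>) * \<delta>" by (simp add: sum_distrib_right)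
    also have "\<dots> < K * \<delta>"
    proof (rule mult_strict_right_mono[OF _ \<open>0 < \<delta>\<close>])
      have "(\<Sum>a\<in>T \<eta>. \<bar>r \<eta> a\<bar>) \<le> (\<Sum>\<eta>\<in>L. \<Sum>a\<in>T \<eta>. \<bar>r \<eta> a\<bar>)"
        using L \<eta> by (intro member_le_sum) (auto intro: sum_nonneg)
      then show "(\<Sum>a\<in>T \<eta>. \<bar>r \<eta> a\<bar>) < K" by (simp add: K_def)
    qed
    also have "K * \<delta> = \<epsilon>" using \<open>1 \<le> K\<close> by (simp add: \<delta>_def)
    finally show ?thesis .
  qed
  with \<open>Q x\<close> show ?thesis by blast
qed

end

section \<open>The total variation of a vector measure\<close>

definition borel_partitions :: "'a::topological_space set \<Rightarrow> (nat \<Rightarrow> 'a set) set" where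
  "borel_partitions B = {A. range A \<subseteq> sets borel \<and> disjoint_family A \<and> (\<Union>n. A n) = B}"

lemma total_variation_eq:
  "total_variation \<mu> B = (SUP A\<in>borel_partitions B. \<Sum>n. ennreal (norm (\<mu> (A n))))"
  unfolding total_variation_def borel_partitions_def ..

lemma ennreal_norm_le_suminf:
  fixes f :: "nat \<Rightarrow> 'b::real_normed_vector"
  assumes "f sums s" shows "ennreal (norm s) \<le> (\<Sum>n. ennreal (norm (f n)))"
proof (rule LIMSEQ_le_const2)
  show "(\<lambda>n. ennreal (norm (sum f {..<n}))) \<longlonglongrightarrow> ennreal (norm s)"
    using assms unfolding sums_def by (intro tendsto_ennrealI tendsto_norm)
  have "ennreal (norm (sum f {..<n})) \<le> (\<Sum>n. ennreal (norm (f n)))" for n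
  proof -
    have "ennreal (norm (sum f {..<n})) \<le> ennreal (\<Sum>i<n. norm (f i))"
      by (intro ennreal_leI norm_sum)
    also have "\<dots> = (\<Sum>i<n. ennreal (norm (f i)))" by (simp add: sum_ennreal)
    also have "\<dots> \<le> (\<Sum>n. ennreal (norm (f n)))" by (intro sum_le_suminf) auto
    finally show ?thesis .
  qed
  then show "\<exists>N. \<forall>n\<ge>N. ennreal (norm (sum f {..<n})) \<le> (\<Sum>n. ennreal (norm (f n)))" by blast
qed

lemma suminf_ennreal_swap:
  fixes f :: "nat \<Rightarrow> nat \<Rightarrow> ennreal"
  shows "(\<Sum>i. \<Sum>j. f i j) = (\<Sum>j. \<Sum>i. f i j)"
proof -
  have "(\<integral>\<^sup>+j. (\<Sum>i. f i j) \<partial>count_space UNIV) = (\<Sum>i. \<integral>\<^sup>+j. f i j \<partial>count_space UNIV)"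
    by (rule nn_integral_suminf) simp
  then show ?thesis unfolding nn_integral_count_space_nat by (rule sym)
qed

lemma sets_variation_measure [simp, measurable_cong]: "sets (variation_measure \<mu>) = sets borel"
  unfolding variation_measure_def
  using sets.sets_measure_of_eq[of borel] by simp

lemma space_variation_measure [simp]: "space (variation_measure \<mu>) = UNIV"
  unfolding variation_measure_def by (rule space_measure_of) simp

context
  fixes \<mu> :: "'a::topological_space set \<Rightarrow> 'h::real_normed_vector"
  assumes \<mu>: "\<mu> \<in> vector_measures"
begin

lemma vector_measure_sums:
  assumes "range A \<subseteq> sets borel" "disjoint_family A"
  shows "(\<lambda>n. \<mu> (A n)) sums \<mu> (\<Union>n::nat. A n)"
  using \<mu> assms unfolding vector_measures_def by blast

lemma vector_measure_empty [simp]: "\<mu> {} = 0"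
proof -
  have "(\<lambda>n::nat. \<mu> {}) sums \<mu> (\<Union>n::nat. {})"
    by (rule vector_measure_sums) (auto simp: disjoint_family_on_def)
  then have "(\<lambda>n::nat. \<mu> {}) \<longlonglongrightarrow> 0" by (intro summable_LIMSEQ_zero) (auto simp: summable_def)
  then show ?thesis by (simp add: LIMSEQ_const_iff)
qed

lemma norm_le_total_variation:
  assumes "B \<in> sets borel" shows "ennreal (norm (\<mu> B)) \<le> total_variation \<mu> B"
proof -
  let ?A = "\<lambda>n::nat. if n = 0 then B else {}"
  have "?A \<in> borel_partitions B"
    using assms by (auto simp: borel_partitions_def disjoint_family_on_def split: if_splits)
  then have "(\<Sum>n. ennreal (norm (\<mu> (?A n)))) \<le> total_variation \<mu> B"
    unfolding total_variation_eq by (rule SUP_upper)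
  moreover have "(\<Sum>n. ennreal (norm (\<mu> (?A n)))) = (\<Sum>n\<in>{0}. ennreal (norm (\<mu> (?A n))))"
    by (rule suminf_finite) auto
  ultimately show ?thesis by simp
qed

lemma total_variation_mono:
  assumes "B \<subseteq> C" "B \<in> sets borel" "C \<in> sets borel"
  shows "total_variation \<mu> B \<le> total_variation \<mu> C"
  unfolding total_variation_eq
proof (rule SUP_mono)
  fix A assume A: "A \<in> borel_partitions B"
  define A' where "A' = case_nat (C - B) A"
  have "A' \<in> borel_partitions C"
  proof -
    have An: "A n \<in> sets borel" "A n \<subseteq> B" for n using A by (auto simp: borel_partitions_def)
    have dis: "A m \<inter> A n = {}" if "m \<noteq> n" for m n
      using A that by (auto simp: borel_partitions_def disjoint_family_on_def)
    have "A' n \<in> sets borel" for n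
      using An(1) assms by (cases n) (auto simp: A'_def)
    moreover have "A' m \<inter> A' n = {}" if "m \<noteq> n" for m n
      using that dis An(2) by (cases m; cases n) (fastforce simp: A'_def)+
    moreover have "(\<Union>n. A' n) = C"
    proof -
      have "(\<Union>n. A' n) = A' 0 \<union> (\<Union>n. A' (Suc n))" 
        by (subst UNIV_nat_eq) auto
      also have "\<dots> = (C - B) \<union> B" using A by (simp add: A'_def borel_partitions_def)
      finally show ?thesis using assms(1) by auto
    qed
    ultimately show ?thesis by (auto simp: borel_partitions_def disjoint_family_on_def)
  qed
  moreover have "(\<Sum>n. ennreal (norm (\<mu> (A' (n + 1))))) \<le> (\<Sum>n. ennreal (norm (\<mu> (A' n))))"
    by (subst (2) suminf_offset[of _ 1]) auto
  ultimately show "\<exists>A'\<in>borel_partitions C. (\<Sum>n. ennreal (norm (\<mu> (A n)))) \<le> (\<Sum>n. ennreal (norm (\<mu> (A' n))))"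
    by (intro bexI[of _ A']) (simp_all add: A'_def)
qed

lemma total_variation_finite:
  assumes "B \<in> sets borel" shows "total_variation \<mu> B < \<infinity>"
  using total_variation_mono[of B UNIV] assms \<mu> unfolding vector_measures_def
  by (auto intro: le_less_trans)

text \<open>A partition of the union refines to partitions of the pieces, which gives one inequality by the
  triangle inequality. For the other one, nearly optimal partitions of the pieces are merged
  into a single sequence through a bijection between \<open>\<nat>\<close> and \<open>\<nat> \<times> \<nat>\<close>.\<close>

lemma total_variation_countably_additive:
  "countably_additive (sets borel) (total_variation \<mu>)"
proof (rule countably_additiveI)
  fix B :: "nat \<Rightarrow> 'a set"
  assume B: "range B \<subseteq> sets borel" "disjoint_family B" "(\<Union>k. B k) \<in> sets borel"
  let ?v = "\<lambda>A. ennreal (norm (\<mu> A))"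
  have Bk: "B k \<in> sets borel" for k using B by auto
  show "(\<Sum>k. total_variation \<mu> (B k)) = total_variation \<mu> (\<Union>k. B k)"
  proof (rule antisym)
    show "total_variation \<mu> (\<Union>k. B k) \<le> (\<Sum>k. total_variation \<mu> (B k))"
      unfolding total_variation_eq[of \<mu> "\<Union>k. B k"]
    proof (rule SUP_least)
      fix P assume P: "P \<in> borel_partitions (\<Union>k. B k)"
      then have Pn: "P n \<in> sets borel" for n by (auto simp: borel_partitions_def)
      have "(\<Sum>n. ?v (P n)) \<le> (\<Sum>n. \<Sum>k. ?v (P n \<inter> B k))"
      proof (rule suminf_le)
        fix n
        have "(\<lambda>k. \<mu> (P n \<inter> B k)) sums \<mu> (\<Union>k. P n \<inter> B k)"
          using B Bk Pn by (intro vector_measure_sums) (auto simp: disjoint_family_on_def)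
        moreover have "(\<Union>k. P n \<inter> B k) = P n" using P by (auto simp: borel_partitions_def)
        ultimately show "?v (P n) \<le> (\<Sum>k. ?v (P n \<inter> B k))"
          using ennreal_norm_le_suminf by metis
      qed auto
      also have "\<dots> = (\<Sum>k. \<Sum>n. ?v (P n \<inter> B k))" by (rule suminf_ennreal_swap)
      also have "\<dots> \<le> (\<Sum>k. total_variation \<mu> (B k))"
      proof (rule suminf_le)
        fix k
        have "(\<lambda>n. P n \<inter> B k) \<in> borel_partitions (B k)"
        proof -
          have "P m \<inter> P n = {}" if "m \<noteq> n" for m n
            using P that by (auto simp: borel_partitions_def disjoint_family_on_def)
          then have "disjoint_family (\<lambda>n. P n \<inter> B k)" unfolding disjoint_family_on_def by blast
          moreover have "(\<Union>n. P n \<inter> B k) = B k" using P by (auto simp: borel_partitions_def)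
          ultimately show ?thesis using Bk[of k] Pn by (auto simp: borel_partitions_def)
        qed
        then show "(\<Sum>n. ?v (P n \<inter> B k)) \<le> total_variation \<mu> (B k)"
          unfolding total_variation_eq by (rule SUP_upper)
      qed auto
      finally show "(\<Sum>n. ?v (P n)) \<le> (\<Sum>k. total_variation \<mu> (B k))" .
    qed
    show "(\<Sum>k. total_variation \<mu> (B k)) \<le> total_variation \<mu> (\<Union>k. B k)"
    proof (rule ennreal_le_epsilon)
      fix \<epsilon> :: real assume \<epsilon>: "0 < \<epsilon>"
      have "\<exists>P\<in>borel_partitions (B k). total_variation \<mu> (B k) < (\<Sum>n. ?v (P n)) + ennreal (\<epsilon> * (1/2) ^ Suc k)" for k
      proof -
        have "(\<lambda>n. if n = 0 then B k else {}) \<in> borel_partitions (B k)"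
          using Bk[of k] by (auto simp: borel_partitions_def disjoint_family_on_def split: if_splits)
        then have ne: "borel_partitions (B k) \<noteq> {}" by blast
        have "0 < \<epsilon> * (1/2) ^ Suc k" using \<epsilon> by simp
        then show ?thesis
          using ne total_variation_eq total_variation_finite[OF Bk[of k]]
          by (intro SUP_approx_ennreal) auto
      qed
      then obtain P where P: "\<And>k. P k \<in> borel_partitions (B k)"
        and le: "\<And>k. total_variation \<mu> (B k) < (\<Sum>n. ?v (P k n)) + ennreal (\<epsilon> * (1/2) ^ Suc k)" by metis
      define Q where "Q = (\<lambda>m. case prod_decode m of (k, n) \<Rightarrow> P k n)"
      have "Q \<in> borel_partitions (\<Union>k. B k)"
      proof -
        have Psub: "P k n \<subseteq> B k" and Pin: "P k n \<in> sets borel" for k n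
          using P[of k] by (auto simp: borel_partitions_def)
        have dis: "P k n \<inter> P k' n' = {}" if "(k, n) \<noteq> (k', n')" for k n k' n'
        proof (cases "k = k'")
          case True
          then show ?thesis using P[of k] that by (auto simp: borel_partitions_def disjoint_family_on_def)
        next
          case False
          then have "B k \<inter> B k' = {}" using B(2) by (auto simp: disjoint_family_on_def)
          then show ?thesis using Psub[of k n] Psub[of k' n'] by auto
        qed
        have "Q i \<inter> Q j = {}" if "i \<noteq> j" for i j
        proof -
          have "prod_decode i \<noteq> prod_decode j" using that by (metis prod_decode_inverse)
          then have "(fst (prod_decode i), snd (prod_decode i)) \<noteq> (fst (prod_decode j), snd (prod_decode j))"
            by simp
          then show ?thesis unfolding Q_def case_prod_beta by (rule dis)
        qed
        moreover have "(\<Union>m. Q m) = (\<Union>k. B k)"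
        proof -
          have "(\<Union>m. Q m) = (\<Union>(k, n)\<in>range prod_decode. P k n)"
            unfolding Q_def by (simp only: image_image)
          also have "\<dots> = (\<Union>k. \<Union>n. P k n)" unfolding surj_prod_decode by auto
          also have "\<dots> = (\<Union>k. B k)" using P by (auto simp: borel_partitions_def)
          finally show ?thesis .
        qed
        moreover have "range Q \<subseteq> sets borel" using Pin by (auto simp: Q_def split: prod.splits)
        ultimately show ?thesis by (simp add: borel_partitions_def disjoint_family_on_def)
      qed
      then have Q: "(\<Sum>m. ?v (Q m)) \<le> total_variation \<mu> (\<Union>k. B k)"
        unfolding total_variation_eq[of \<mu> "\<Union>k. B k"] by (rule SUP_upper)
      have "(\<Sum>m. (\<lambda>(k, n). ?v (P k n)) (prod_decode m)) = (\<Sum>k. \<Sum>n. ?v (P k n))"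
        by (rule suminf_ennreal_2dimen) simp
      moreover have "(\<lambda>(k, n). ?v (P k n)) (prod_decode m) = ?v (Q m)" for m
        unfolding Q_def by (simp split: prod.splits)
      ultimately have Q2: "(\<Sum>k. \<Sum>n. ?v (P k n)) = (\<Sum>m. ?v (Q m))" by simp
      have "(\<Sum>k. total_variation \<mu> (B k)) \<le> (\<Sum>k. (\<Sum>n. ?v (P k n)) + ennreal (\<epsilon> * (1/2) ^ Suc k))"
        by (intro suminf_le less_imp_le le) auto
      also have "\<dots> = (\<Sum>k. \<Sum>n. ?v (P k n)) + (\<Sum>k. ennreal (\<epsilon> * (1/2) ^ Suc k))"
        by (intro suminf_add[symmetric]) auto
      also have "(\<Sum>k. ennreal (\<epsilon> * (1/2) ^ Suc k)) = ennreal \<epsilon>"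
        using sums_mult[OF power_half_series, of \<epsilon>] \<epsilon> by (subst suminf_ennreal2) (auto simp: sums_iff)
      finally show "(\<Sum>k. total_variation \<mu> (B k)) \<le> total_variation \<mu> (\<Union>k. B k) + ennreal \<epsilon>"
        using Q unfolding Q2 by (meson add_right_mono order_trans)
    qed
  qed
qed

lemma emeasure_variation_measure:
  assumes "B \<in> sets borel" shows "emeasure (variation_measure \<mu>) B = total_variation \<mu> B"
proof (rule emeasure_measure_of[OF variation_measure_def])
  have "total_variation \<mu> {} = 0"
    
    unfolding total_variation_eq
  proof (intro antisym SUP_least)
    fix A :: "nat \<Rightarrow> 'a set" assume "A \<in> borel_partitions {}"
    then have "A n = {}" for n by (auto simp: borel_partitions_def)
    then show "(\<Sum>n. ennreal (norm (\<mu> (A n)))) \<le> 0" by simp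
  qed simp

  then show "positive (sets (variation_measure \<mu>)) (total_variation \<mu>)" by (simp add: positive_def)
  show "countably_additive (sets (variation_measure \<mu>)) (total_variation \<mu>)"
    using total_variation_countably_additive by simp
qed (use assms in auto)

lemma finite_measure_variation: "finite_measure (variation_measure \<mu>)"
  using total_variation_finite[of UNIV] by (intro finite_measureI) (auto simp: emeasure_variation_measure)

lemma norm_le_variation_measure:
  assumes "B \<in> sets borel" shows "norm (\<mu> B) \<le> measure (variation_measure \<mu>) B"
proof -
  interpret finite_measure "variation_measure \<mu>" by (rule finite_measure_variation)
  have "ennreal (norm (\<mu> B)) \<le> ennreal (measure (variation_measure \<mu>) B)"
    using norm_le_total_variation[OF assms] assms
    by (simp add: emeasure_variation_measure[symmetric] emeasure_eq_measure)
  then show ?thesis by simp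
qed

end

text \<open>Adding \<open>norm e\<close> times the total variation makes the signed measure \<open>B \<mapsto> \<mu> B \<bullet> e\<close> nonnegative, so that
  the Radon--Nikodym theorem for positive measures applies.\<close>

lemma scalar_density:
  fixes \<mu> :: "'a::topological_space set \<Rightarrow> 'h::real_inner"
  assumes \<mu>: "\<mu> \<in> vector_measures"
  shows "\<exists>g. integrable (variation_measure \<mu>) g \<and>
    (\<forall>B\<in>sets borel. set_lebesgue_integral (variation_measure \<mu>) B g = \<mu> B \<bullet> e)"
proof -
  let ?V = "variation_measure \<mu>"
  interpret V: finite_measure ?V by (rule finite_measure_variation[OF \<mu>])
  define m where "m = (\<lambda>B. \<mu> B \<bullet> e + norm e * measure ?V B)"
  have m_nonneg: "0 \<le> m B" if "B \<in> sets borel" for B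
  proof -
    have "\<bar>\<mu> B \<bullet> e\<bar> \<le> norm (\<mu> B) * norm e" by (rule Cauchy_Schwarz_ineq2)
    also have "\<dots> \<le> measure ?V B * norm e"
      by (intro mult_right_mono norm_le_variation_measure[OF \<mu> that]) simp
    finally show ?thesis by (simp add: m_def mult.commute)
  qed
  define N where "N = measure_of UNIV (sets borel) (\<lambda>B. ennreal (m B))"
  have setsN [simp, measurable_cong]: "sets N = sets borel" unfolding N_def
    using sets.sets_measure_of_eq[of borel] by simp
  have N: "emeasure N B = ennreal (m B)" if "B \<in> sets borel" for B
  proof (rule emeasure_measure_of[OF N_def])
    show "positive (sets N) (\<lambda>B. ennreal (m B))"
      by (simp add: positive_def m_def vector_measure_empty[OF \<mu>])
    show "countably_additive (sets N) (\<lambda>B. ennreal (m B))"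
    proof (rule countably_additiveI)
      fix A :: "nat \<Rightarrow> 'a set" assume A: "range A \<subseteq> sets N" "disjoint_family A"
      have "(\<lambda>n. m (A n)) sums m (\<Union>n. A n)"
        unfolding m_def using A
        by (intro sums_add sums_mult bounded_linear.sums[OF bounded_linear_inner_left]
            vector_measure_sums[OF \<mu>] V.finite_measure_UNION) auto
      then show "(\<Sum>n. ennreal (m (A n))) = ennreal (m (\<Union>n. A n))"
        using A m_nonneg by (subst suminf_ennreal2) (auto simp: sums_iff)
    qed
  qed (use that in auto)
  have "absolutely_continuous ?V N"
    unfolding absolutely_continuous_def
  proof
    fix B assume B: "B \<in> null_sets ?V"
    then have "B \<in> sets borel" "measure ?V B = 0" by (auto simp: null_sets_def measure_def)
    moreover from this have "\<mu> B = 0" using norm_le_variation_measure[OF \<mu>, of B] by simp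
    ultimately show "B \<in> null_sets N" by (simp add: null_sets_def N m_def)
  qed
  then obtain f where f [measurable]: "f \<in> borel_measurable ?V" and dens: "density ?V f = N"
    using V.Radon_Nikodym[of N] by auto
  have f_int: "(\<integral>\<^sup>+x. f x * indicator B x \<partial>?V) = ennreal (m B)" if "B \<in> sets borel" for B
    using that by (simp add: N[symmetric] dens[symmetric] emeasure_density)
  have "AE x in ?V. f x \<noteq> \<infinity>"
    using f_int[of UNIV] by (intro nn_integral_PInf_AE) auto
  then have fin: "AE x in ?V. ennreal (enn2real (f x)) = f x"
    by (auto simp: less_top)
  have int: "has_bochner_integral ?V (\<lambda>x. indicator B x *\<^sub>R enn2real (f x)) (m B)"
    if B: "B \<in> sets borel" for B
  proof (rule has_bochner_integral_nn_integral)
    have "(\<integral>\<^sup>+x. ennreal (indicator B x *\<^sub>R enn2real (f x)) \<partial>?V) = (\<integral>\<^sup>+x. f x * indicator B x \<partial>?V)"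
      using fin by (intro nn_integral_cong_AE) (auto elim!: eventually_mono split: split_indicator)
    then show "(\<integral>\<^sup>+x. ennreal (indicator B x *\<^sub>R enn2real (f x)) \<partial>?V) = ennreal (m B)"
      using f_int[OF B] by simp
  qed (use B m_nonneg in auto)
  have fint: "integrable ?V (\<lambda>x. enn2real (f x))"
    using int[of UNIV] by (auto simp: has_bochner_integral_iff)
  show ?thesis
  proof (intro exI[of _ "\<lambda>x. enn2real (f x) - norm e"] conjI ballI)
    show "integrable ?V (\<lambda>x. enn2real (f x) - norm e)" using fint by auto
    fix B :: "'a set" assume B: "B \<in> sets borel"
    have "set_lebesgue_integral ?V B (\<lambda>x. enn2real (f x) - norm e) =
      set_lebesgue_integral ?V B (\<lambda>x. enn2real (f x)) - set_lebesgue_integral ?V B (\<lambda>x. norm e)"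
      using B integrable_mult_indicator[OF _ fint, of B] integrable_mult_indicator[OF _ V.integrable_const[of "norm e"], of B]
      by (intro set_integral_diff) (simp_all only: set_integrable_def sets_variation_measure)
    also have "set_lebesgue_integral ?V B (\<lambda>x. enn2real (f x)) = m B"
      using int[OF B] unfolding set_lebesgue_integral_def by (rule has_bochner_integral_integral_eq)
    also have "set_lebesgue_integral ?V B (\<lambda>x. norm e) = norm e * measure ?V B"
      using B by (simp add: set_lebesgue_integral_def)
    finally show "set_lebesgue_integral ?V B (\<lambda>x. enn2real (f x) - norm e) = \<mu> B \<bullet> e"
      by (simp add: m_def)
  qed
qed

section \<open>The polar decomposition\<close>

text \<open>Tested on the set where \<open>g < f\<close>.\<close>

lemma AE_le_of_set_integral_le:
  fixes f g :: "'a \<Rightarrow> real"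
  assumes f: "integrable M f" and g: "integrable M g"
    and le: "\<And>B. B \<in> sets M \<Longrightarrow> set_lebesgue_integral M B f \<le> set_lebesgue_integral M B g"
  shows "AE x in M. f x \<le> g x"
proof -
  have [measurable]: "f \<in> borel_measurable M" "g \<in> borel_measurable M" using f g by auto
  define B where "B = {x\<in>space M. g x < f x}"
  have B [measurable]: "B \<in> sets M" unfolding B_def by measurable
  have int: "integrable M (\<lambda>x. indicator B x *\<^sub>R (f x - g x))"
    using f g B by (intro integrable_mult_indicator) auto
  have "(\<integral>x. indicator B x *\<^sub>R (f x - g x) \<partial>M) = set_lebesgue_integral M B f - set_lebesgue_integral M B g"
    unfolding set_lebesgue_integral_def using integrable_mult_indicator[OF B f] integrable_mult_indicator[OF B g]
    by (subst Bochner_Integration.integral_diff[symmetric]) (auto simp: algebra_simps)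
  also have "\<dots> \<le> 0" using le[OF B] by simp
  finally have "(\<integral>x. indicator B x *\<^sub>R (f x - g x) \<partial>M) \<le> 0" .
  moreover have nonneg: "AE x in M. 0 \<le> indicator B x *\<^sub>R (f x - g x)"
    by (auto simp: B_def indicator_def)
  ultimately have "(\<integral>x. indicator B x *\<^sub>R (f x - g x) \<partial>M) = 0"
    using integral_nonneg_AE[OF nonneg] by linarith
  then have "AE x in M. indicator B x *\<^sub>R (f x - g x) = 0"
    using integral_nonneg_eq_0_iff_AE[OF int nonneg] by simp
  then show ?thesis using AE_space by eventually_elim (auto simp: B_def indicator_def split: if_splits)
qed

text \<open>The scalar densities along an orthonormal system are the coordinates of the vector
  density. Their square sums are bounded by 1 almost everywhere, because the partial sums pair
  with each vector \<open>d\<close> of a countable dense set to at most \<open>norm d\<close>; hence the series converges.\<close>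

lemma polar_density_exists:
  fixes \<mu> :: "'a::topological_space set \<Rightarrow> 'h::{real_inner, banach, second_countable_topology}"
  assumes \<mu>: "\<mu> \<in> vector_measures"
  shows "\<exists>g. integrable (variation_measure \<mu>) g \<and>
    (\<forall>B\<in>sets borel. \<mu> B = set_lebesgue_integral (variation_measure \<mu>) B g)"
proof -
  let ?V = "variation_measure \<mu>"
  interpret V: finite_measure ?V by (rule finite_measure_variation[OF \<mu>])
  obtain D :: "'h set" where D: "countable D" "\<And>X. open X \<Longrightarrow> X \<noteq> {} \<Longrightarrow> \<exists>d\<in>D. d \<in> X"
    using countable_dense_exists by metis
  then have "D \<noteq> {}" by force
  define d where "d = from_nat_into D"
  have range_d: "range d = D" unfolding d_def using \<open>D \<noteq> {}\<close> D(1) by (rule range_from_nat_into)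
  have dense: "closure (range d) = UNIV"
  proof (rule ccontr)
    assume "closure (range d) \<noteq> UNIV"
    then have "- closure (range d) \<noteq> {}" by blast
    then obtain v where "v \<in> D" "v \<in> - closure (range d)" using D(2)[of "- closure (range d)"] by auto
    then show False using closure_subset[of "range d"] unfolding range_d by blast
  qed
  define e where "e = gram_schmidt (\<bullet>) d"
  have bilin: "linear (\<lambda>x::'h. x \<bullet> y)" for y
    by (intro bounded_linear.linear bounded_linear_inner_left)
  have orth: "e i \<bullet> e j = (if i = j \<and> e i \<noteq> 0 then 1 else 0)" for i j
    unfolding e_def by (rule gram_schmidt_orthonormal[OF bilin inner_commute])  simp_all
  have d_span: "d n \<in> span (range e)" for n
    unfolding e_def by (rule gram_schmidt_orthonormal[OF bilin inner_commute])  simp_all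
  have "\<exists>g. \<forall>i. integrable ?V (g i) \<and> (\<forall>B\<in>sets borel. set_lebesgue_integral ?V B (g i) = \<mu> B \<bullet> e i)"
    by (intro choice allI scalar_density[OF \<mu>])
  then obtain g where g_int: "\<And>i::nat. integrable ?V (g i)"
    and g: "\<And>i B. B \<in> sets borel \<Longrightarrow> set_lebesgue_integral ?V B (g i) = \<mu> B \<bullet> e i" by blast
  have [measurable]: "\<And>i. g i \<in> borel_measurable ?V" using g_int by auto
  \<comment> \<open>Bessel's inequality bounds the pairing of the partial sums with the dense sequence.\<close>
  have AE_le: "AE x in ?V. (\<Sum>i<N. g i x * (d n \<bullet> e i)) \<le> norm (d n)" for N n
  proof (rule AE_le_of_set_integral_le)
    show "integrable ?V (\<lambda>x. \<Sum>i<N. g i x * (d n \<bullet> e i))" using g_int by auto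
    fix B assume "B \<in> sets ?V"
    then have B: "B \<in> sets borel" by simp
    define P where "P = (\<Sum>i<N. (d n \<bullet> e i) *\<^sub>R e i)"
    have "P \<bullet> e i = d n \<bullet> e i" if "i < N" for i
    proof -
      have "P \<bullet> e i = (\<Sum>j<N. (d n \<bullet> e j) * (e j \<bullet> e i))" unfolding P_def by (simp add: inner_sum_left)
      also have "\<dots> = (\<Sum>j\<in>{i}. (d n \<bullet> e j) * (e j \<bullet> e i))"
        using that by (intro sum.mono_neutral_right) (auto simp: orth)
      finally show ?thesis by (simp add: orth)
    qed
    then have "(\<Sum>i<N. (d n \<bullet> e i) * (P \<bullet> e i)) = (\<Sum>i<N. (d n \<bullet> e i) * (d n \<bullet> e i))"
      by (intro sum.cong) auto
    moreover have "v \<bullet> P = (\<Sum>i<N. (d n \<bullet> e i) * (v \<bullet> e i))" for v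
      unfolding P_def by (simp add: inner_sum_right)
    ultimately have "P \<bullet> P = d n \<bullet> P" by metis
    then have "norm P * norm P \<le> norm (d n) * norm P"
      using norm_cauchy_schwarz[of "d n" P] by (simp add: power2_norm_eq_inner[symmetric] power2_eq_square)
    then have P: "norm P \<le> norm (d n)"
      by (cases "P = 0") auto
    have "set_lebesgue_integral ?V B (\<lambda>x. \<Sum>i<N. g i x * (d n \<bullet> e i)) = (\<Sum>i<N. set_lebesgue_integral ?V B (g i) * (d n \<bullet> e i))"
      unfolding set_lebesgue_integral_def using B g_int integrable_mult_indicator[of B ?V, OF _ g_int]
      by (simp add: sum_distrib_left mult.assoc[symmetric])
    also have "\<dots> = \<mu> B \<bullet> P" unfolding P_def by (simp add: g[OF B] inner_sum_right mult.commute)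
    also have "\<dots> \<le> norm (\<mu> B) * norm P" by (rule norm_cauchy_schwarz)
    also have "\<dots> \<le> measure ?V B * norm (d n)"
      using P norm_le_variation_measure[OF \<mu> B] by (intro mult_mono) auto
    also have "\<dots> = set_lebesgue_integral ?V B (\<lambda>x. norm (d n))"
      using B by (simp add: set_lebesgue_integral_def)
    finally show "set_lebesgue_integral ?V B (\<lambda>x. \<Sum>i<N. g i x * (d n \<bullet> e i))
      \<le> set_lebesgue_integral ?V B (\<lambda>x. norm (d n))" .
  qed simp
  define G where "G = (\<lambda>N x. \<Sum>i<N. g i x *\<^sub>R e i)"
  have [measurable]: "\<And>N. G N \<in> borel_measurable ?V" unfolding G_def by measurable
  define h where "h = (\<lambda>x. lim (\<lambda>N. G N x))"
  have h_meas [measurable]: "h \<in> borel_measurable ?V" unfolding h_def by measurable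
  have good: "(\<lambda>N. G N x) \<longlonglongrightarrow> h x \<and> norm (h x) \<le> 1"
    if x: "\<And>N n. (\<Sum>i<N. g i x * (d n \<bullet> e i)) \<le> norm (d n)" for x
  proof -
    have le: "norm (G N x) \<le> 1" for N
    proof -
      have "range d \<subseteq> {v. G N x \<bullet> v \<le> norm v}"
        using x by (auto simp: G_def inner_sum_left inner_commute[of "e _" "d _"])
      moreover have "closed {v. G N x \<bullet> v \<le> norm v}"
        by (intro closed_Collect_le continuous_intros)
      ultimately have "closure (range d) \<subseteq> {v. G N x \<bullet> v \<le> norm v}" by (rule closure_minimal)
      then have "G N x \<bullet> G N x \<le> norm (G N x)" unfolding dense by auto
      then have "norm (G N x) * norm (G N x) \<le> 1 * norm (G N x)"
        by (simp add: power2_norm_eq_inner[symmetric] power2_eq_square)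
      then show ?thesis by (cases "G N x = 0") auto
    qed
    define a where "a = (\<lambda>i. if e i = 0 then 0 else (g i x)\<^sup>2)"
    have sq: "(norm (\<Sum>i\<in>I. g i x *\<^sub>R e i))\<^sup>2 = sum a I" if "finite I" for I
    proof -
      have "(\<Sum>i\<in>I. g i x *\<^sub>R e i) \<bullet> (\<Sum>i\<in>I. g i x *\<^sub>R e i) = (\<Sum>i\<in>I. \<Sum>j\<in>I. g i x * (g j x * (e i \<bullet> e j)))"
        by (simp add: inner_sum_left inner_sum_right sum_distrib_left inner_commute mult.left_commute)
      also have "\<dots> = (\<Sum>i\<in>I. \<Sum>j\<in>I. if j = i then a i else 0)"
        by (intro sum.cong refl) (auto simp: orth a_def power2_eq_square)
      finally show ?thesis using that by (simp add: power2_norm_eq_inner)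
    qed
    have "summable a"
    proof (rule bounded_imp_summable)
      show "0 \<le> a i" for i by (simp add: a_def)
      show "sum a {..n} \<le> 1" for n
        using sq[of "{..n}"] le[of "Suc n"] power_le_one[of "norm (G (Suc n) x)" 2]
        by (simp add: G_def lessThan_Suc_atMost)
    qed
    have "summable (\<lambda>i. g i x *\<^sub>R e i)"
      unfolding summable_Cauchy
    proof (intro allI impI)
      fix r :: real assume r: "0 < r"
      then have "0 < r\<^sup>2" by simp
      then obtain N where N: "\<And>m n. m \<ge> N \<Longrightarrow> norm (sum a {m..<n}) < r\<^sup>2"
        using \<open>summable a\<close> unfolding summable_Cauchy by blast
      have "norm (\<Sum>i\<in>{m..<n}. g i x *\<^sub>R e i) < r" if "m \<ge> N" for m n
      proof (rule power_less_imp_less_base)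
        show "(norm (\<Sum>i\<in>{m..<n}. g i x *\<^sub>R e i))\<^sup>2 < r\<^sup>2"
          using N[OF that, of n] by (simp add: sq)
      qed (use r in simp)
      then show "\<exists>N. \<forall>m\<ge>N. \<forall>n. norm (\<Sum>i\<in>{m..<n}. g i x *\<^sub>R e i) < r" by blast
    qed
    then have "convergent (\<lambda>N. G N x)"
      unfolding G_def by (simp add: summable_iff_convergent)
    then have lim: "(\<lambda>N. G N x) \<longlonglongrightarrow> h x" unfolding h_def by (simp add: convergent_LIMSEQ_iff)
    moreover have "norm (h x) \<le> 1"
      using tendsto_norm[OF lim] by (rule LIMSEQ_le_const2) (use le in auto)
    ultimately show ?thesis by simp
  qed
  have AE_good: "AE x in ?V. (\<lambda>N. G N x) \<longlonglongrightarrow> h x \<and> norm (h x) \<le> 1"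
  proof -
    have "AE x in ?V. \<forall>N n. (\<Sum>i<N. g i x * (d n \<bullet> e i)) \<le> norm (d n)"
      unfolding AE_all_countable using AE_le by blast
    then show ?thesis by eventually_elim (use good in blast)
  qed
  have h_int: "integrable ?V h"
    using AE_good by (intro V.integrable_const_bound[of _ 1] h_meas) auto
  have "\<mu> B = set_lebesgue_integral ?V B h" if B: "B \<in> sets borel" for B
  proof -
    define w where "w = \<mu> B - set_lebesgue_integral ?V B h"
    have coord: "w \<bullet> e i = 0" for i
    proof (cases "e i = 0")
      case False
      have "AE x in ?V. h x \<bullet> e i = g i x"
        using AE_good
      proof eventually_elim
        case (elim x)
        then have "(\<lambda>N. G N x \<bullet> e i) \<longlonglongrightarrow> h x \<bullet> e i" by (intro tendsto_intros) auto
        moreover have "eventually (\<lambda>N. G N x \<bullet> e i = g i x) sequentially"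
          using eventually_gt_at_top[of i]
        proof eventually_elim
          case (elim N)
          have "G N x \<bullet> e i = (\<Sum>j<N. g j x * (e j \<bullet> e i))" by (simp add: G_def inner_sum_left)
          also have "\<dots> = (\<Sum>j\<in>{i}. g j x * (e j \<bullet> e i))"
            using elim by (intro sum.mono_neutral_right) (auto simp: orth)
          finally show ?case using False by (simp add: orth)
        qed
        then have "(\<lambda>N. G N x \<bullet> e i) \<longlonglongrightarrow> g i x" by (rule tendsto_eventually)
        ultimately show ?case by (rule LIMSEQ_unique)
      qed
      then have "set_lebesgue_integral ?V B (\<lambda>x. h x \<bullet> e i) = set_lebesgue_integral ?V B (g i)"
        unfolding set_lebesgue_integral_def using B by (intro integral_cong_AE) (auto elim!: eventually_mono)
      moreover have "set_lebesgue_integral ?V B (\<lambda>x. h x \<bullet> e i) = set_lebesgue_integral ?V B h \<bullet> e i"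
        unfolding set_lebesgue_integral_def using integrable_mult_indicator[of B ?V, OF _ h_int] B
        by (subst integral_inner_left[symmetric]) auto
      ultimately show ?thesis by (simp add: w_def inner_diff_left g[OF B])
    qed simp
    have "range e \<subseteq> {v. w \<bullet> v = 0}" using coord by auto
    moreover have "subspace {v. w \<bullet> v = 0}" by (auto simp: subspace_def inner_add_right)
    ultimately have "range d \<subseteq> {v. w \<bullet> v = 0}" using d_span span_minimal by blast
    then have "closure (range d) \<subseteq> {v. w \<bullet> v = 0}"
      by (intro closure_minimal closed_Collect_eq continuous_intros)
    then have "w \<bullet> w = 0" unfolding dense by blast
    then show ?thesis by (simp add: w_def)
  qed
  with h_int show ?thesis by blast
qed

lemma polar_density:
  fixes \<mu> :: "'a::topological_space set \<Rightarrow> 'h::{real_inner, banach, second_countable_topology}"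
  assumes \<mu>: "\<mu> \<in> vector_measures"
  shows integrable_polar_density: "integrable (variation_measure \<mu>) (polar_density \<mu>)"
    and set_integral_polar_density: "B \<in> sets borel \<Longrightarrow>
      set_lebesgue_integral (variation_measure \<mu>) B (polar_density \<mu>) = \<mu> B"
proof -
  have "integrable (variation_measure \<mu>) (polar_density \<mu>) \<and>
    (\<forall>B\<in>sets borel. \<mu> B = set_lebesgue_integral (variation_measure \<mu>) B (polar_density \<mu>))"
    unfolding polar_density_def by (rule someI_ex[OF polar_density_exists[OF \<mu>]])
  then show "integrable (variation_measure \<mu>) (polar_density \<mu>)"
    "B \<in> sets borel \<Longrightarrow> set_lebesgue_integral (variation_measure \<mu>) B (polar_density \<mu>) = \<mu> B" by auto
qed

section \<open>Convex functions on a Hilbert space as suprema of affine functions\<close>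

text \<open>The separating direction points from \<open>z\<close> to its projection on \<open>S\<close>, which exists by
  completeness even in infinite dimension.\<close>

lemma closed_convex_separation:
  fixes S :: "'a::{real_inner, complete_space} set"
  assumes S: "closed S" "convex S" and z: "z \<notin> S"
  obtains a b where "a \<bullet> z < b" "\<And>s. s \<in> S \<Longrightarrow> b \<le> a \<bullet> s"
proof (cases "S = {}")
  case True
  then show ?thesis using that[of 0 1] by simp
next
  case False
  let ?q = "\<lambda>s. (norm (z - s))\<^sup>2"
  define \<delta> where "\<delta> = (INF s\<in>S. ?q s)"
  have bdd: "bdd_below (?q ` S)" by (rule bdd_belowI2[of _ 0]) simp
  have \<delta>_le: "\<delta> \<le> ?q s" if "s \<in> S" for s
    unfolding \<delta>_def using bdd that by (rule cINF_lower)
  have "\<exists>s\<in>S. ?q s < \<delta> + 1 / Suc n" for n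
  proof (rule ccontr)
    assume "\<not> (\<exists>s\<in>S. ?q s < \<delta> + 1 / Suc n)"
    then have "\<delta> + 1 / Suc n \<le> \<delta>"
      unfolding \<delta>_def using False by (intro cINF_greatest) (auto simp: not_less \<delta>_def)
    then show False by simp
  qed
  then obtain s where s: "\<And>n. s n \<in> S" "\<And>n::nat. ?q (s n) < \<delta> + 1 / Suc n" by metis
  \<comment> \<open>The parallelogram law turns almost minimality into the Cauchy property.\<close>
  have close: "(norm (s m - s n))\<^sup>2 \<le> 2 / Suc m + 2 / Suc n" for m n
  proof -
    have "(1 - 1/2) *\<^sub>R s m + (1/2) *\<^sub>R s n \<in> S"
      using S(2) s(1) by (intro convexD_alt) auto
    then have "\<delta> \<le> ?q ((1/2) *\<^sub>R (s m + s n))" using \<delta>_le by (simp add: scaleR_add_right)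
    moreover have "(norm (s m - s n))\<^sup>2 = 2 * ?q (s m) + 2 * ?q (s n) - 4 * ?q ((1/2) *\<^sub>R (s m + s n))"
      by (simp add: power2_norm_eq_inner inner_diff_left inner_diff_right inner_add_left
          inner_add_right inner_commute algebra_simps)
    ultimately show ?thesis using s(2)[of m] s(2)[of n] by simp
  qed
  have "Cauchy s"
  proof (rule metric_CauchyI)
    fix e :: real assume "e > 0"
    then obtain N where N: "1 / Suc N < e\<^sup>2 / 4" using nat_approx_posE[of "e\<^sup>2 / 4"] by auto
    have "dist (s m) (s n) < e" if "m \<ge> N" "n \<ge> N" for m n
    proof -
      have "2 / Suc m \<le> 2 / Suc N" "2 / Suc n \<le> 2 / Suc N"
        using that by (auto intro!: divide_left_mono)
      then have "(norm (s m - s n))\<^sup>2 < e\<^sup>2" using close[of m n] N by simp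
      then show ?thesis using \<open>e > 0\<close> by (simp add: dist_norm power_less_imp_less_base)
    qed
    then show "\<exists>M. \<forall>m\<ge>M. \<forall>n\<ge>M. dist (s m) (s n) < e" by blast
  qed
  then obtain p where p: "s \<longlonglongrightarrow> p" using Cauchy_convergent convergent_def by blast
  then have pS: "p \<in> S" using S(1) s(1) closed_sequentially by blast
  have "?q p \<le> \<delta>"
  proof (rule LIMSEQ_le)
    show "(\<lambda>n. ?q (s n)) \<longlonglongrightarrow> ?q p" by (intro tendsto_intros p)
    have "(\<lambda>n. \<delta> + 1 / Suc n) \<longlonglongrightarrow> \<delta> + 0"
      by (intro tendsto_intros LIMSEQ_Suc[OF lim_1_over_n])
    then show "(\<lambda>n. \<delta> + 1 / Suc n) \<longlonglongrightarrow> \<delta>" by simp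
    show "\<exists>N. \<forall>n\<ge>N. ?q (s n) \<le> \<delta> + 1 / Suc n" using s(2) less_imp_le by blast
  qed
  then have min: "?q p \<le> ?q t" if "t \<in> S" for t using \<delta>_le[OF that] by linarith
  have dot: "(p - z) \<bullet> p \<le> (p - z) \<bullet> t" if "t \<in> S" for t
  proof -
    have "dist z p \<le> dist z u" if "u \<in> S" for u
      using min[OF that] by (simp add: dist_norm)
    then have "(z - p) \<bullet> (t - p) \<le> 0"
      using S pS that by (intro any_closest_point_dot) auto
    then show ?thesis by (simp add: inner_diff_left inner_diff_right)
  qed
  have "p - z \<noteq> 0" using pS z by auto
  then have "0 < (p - z) \<bullet> (p - z)" by simp
  then have "(p - z) \<bullet> z < (p - z) \<bullet> p" by (simp add: inner_diff_right)
  with dot that show ?thesis by blast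
qed

definition affine_minorants :: "('h::real_inner \<Rightarrow> ereal) \<Rightarrow> ('h \<times> real) set" where
  "affine_minorants F = {(\<phi>, c). \<forall>h. ereal (\<phi> \<bullet> h - c) \<le> F h}"

lemma conjugate_le_iff:
  "conjugate_fun F \<phi> \<le> ereal c \<longleftrightarrow> (\<phi>, c) \<in> affine_minorants F"
proof -
  have "ereal (\<phi> \<bullet> h) - F h \<le> ereal c \<longleftrightarrow> ereal (\<phi> \<bullet> h - c) \<le> F h" for h
    by (cases "F h") auto
  then show ?thesis by (simp add: conjugate_fun_def affine_minorants_def SUP_le_iff)
qed

definition epigraph :: "('h \<Rightarrow> ereal) \<Rightarrow> ('h \<times> real) set" where
  "epigraph F = {(h, r). F h \<le> ereal r}"

lemma convex_epigraph:
  assumes "convex_fun F" shows "convex (epigraph F)"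
  unfolding convex_alt
proof (intro ballI allI impI, clarify)
  fix h k and r s u :: real assume hk: "(h, r) \<in> epigraph F" "(k, s) \<in> epigraph F" and u: "0 \<le> u" "u \<le> 1"
  consider "u = 0" | "u = 1" | "0 < u" "u < 1" using u by linarith
  then show "(1 - u) *\<^sub>R (h, r) + u *\<^sub>R (k, s) \<in> epigraph F"
  proof cases
    case 3
    then have "F ((1 - u) *\<^sub>R h + u *\<^sub>R k) \<le> ereal (1 - u) * F h + ereal u * F k"
      using assms unfolding convex_fun_def by blast
    also have "\<dots> \<le> ereal (1 - u) * ereal r + ereal u * ereal s"
      using hk 3 unfolding epigraph_def by (intro add_mono ereal_mult_left_mono) auto
    finally show ?thesis by (simp add: epigraph_def)
  qed (use hk in auto)
qed

lemma closed_epigraph: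
  fixes F :: "'h::metric_space \<Rightarrow> ereal"
  assumes "lsc_fun F" shows "closed (epigraph F)"
  unfolding closed_sequential_limits
proof (intro allI impI, elim conjE)
  fix x l assume x: "\<forall>n. x n \<in> epigraph F" and lim: "x \<longlonglongrightarrow> l"
  obtain h r where l: "l = (h, r)" by force
  have "F h \<le> ereal r"
  proof (rule ccontr)
    assume "\<not> F h \<le> ereal r"
    then obtain s where s: "ereal r < s" "s < F h" using dense by (auto simp: not_le)
    have "s < Liminf (at h) F" using assms s(2) unfolding lsc_fun_def by (meson less_le_trans)
    then have "eventually (\<lambda>k. s < F k) (at h)" by (simp add: less_LiminfD)
    with s(2) have "eventually (\<lambda>k. s < F k) (nhds h)"
      unfolding eventually_at_filter by (auto elim!: eventually_mono)
    moreover have "(\<lambda>n. fst (x n)) \<longlonglongrightarrow> h" "(\<lambda>n. snd (x n)) \<longlonglongrightarrow> r"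
      using tendsto_fst[OF lim] tendsto_snd[OF lim] l by auto
    ultimately have 1: "eventually (\<lambda>n. s < F (fst (x n))) sequentially"
      by (auto simp: filterlim_iff)
    have "(\<lambda>n. ereal (snd (x n))) \<longlonglongrightarrow> ereal r"
      using \<open>(\<lambda>n. snd (x n)) \<longlonglongrightarrow> r\<close> by simp
    then have 2: "eventually (\<lambda>n. ereal (snd (x n)) < s) sequentially" using s(1) by (rule order_tendstoD)
    from eventually_conj[OF 1 2] obtain n where "s < F (fst (x n))" "ereal (snd (x n)) < s"
      by (auto simp: eventually_sequentially)
    then have "\<not> F (fst (x n)) \<le> ereal (snd (x n))" by (meson less_le_trans less_trans not_le)
    moreover have "x n \<in> epigraph F" using x by blast
    ultimately show False by (auto simp: epigraph_def split: prod.splits)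
  qed
  then show "l \<in> epigraph F" by (simp add: l epigraph_def)
qed

text \<open>The point \<open>(h0, r0)\<close> lies below the epigraph and is separated from it. A hyperplane that is not
  vertical is the graph of the desired minorant. A vertical one can occur only outside
  the domain of \<open>F\<close> and is then tilted by a minorant obtained at a point of the domain.\<close>

lemma ex_affine_minorant_above:
  fixes F :: "'h::{real_inner, complete_space} \<Rightarrow> ereal"
  assumes F: "proper_fun F" "lsc_fun F" "convex_fun F" and r0: "ereal r0 < F h0"
  shows "\<exists>(\<phi>, c)\<in>affine_minorants F. r0 < \<phi> \<bullet> h0 - c"
proof -
  have ninf: "F h \<noteq> -\<infinity>" for h using F(1) unfolding proper_fun_def by blast
  obtain h1 where "F h1 < \<infinity>" using F(1) unfolding proper_fun_def by blast
  with ninf[of h1] obtain f1 where f1: "F h1 = ereal f1" by (cases "F h1") auto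
  have separate: "\<exists>a \<alpha> b. \<alpha> \<ge> 0 \<and> a \<bullet> k + \<alpha> * r < b \<and> (\<forall>h s. F h \<le> ereal s \<longrightarrow> b \<le> a \<bullet> h + \<alpha> * s)"
    if "ereal r < F k" for r k
  proof -
    have "(k, r) \<notin> epigraph F" using that by (simp add: epigraph_def not_le)
    then obtain p b where p: "p \<bullet> (k, r) < b" "\<And>s. s \<in> epigraph F \<Longrightarrow> b \<le> p \<bullet> s"
      using closed_convex_separation[OF closed_epigraph[OF F(2)] convex_epigraph[OF F(3)]] by metis
    have le: "b \<le> fst p \<bullet> h + snd p * s" if "F h \<le> ereal s" for h s
      using p(2)[of "(h, s)"] that by (simp add: epigraph_def inner_prod_def)
    have "snd p \<ge> 0"
    proof (rule ccontr)
      assume neg: "\<not> snd p \<ge> 0"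
      define t where "t = (fst p \<bullet> h1 + snd p * f1 - b + 1) / - snd p"
      have "b \<le> fst p \<bullet> h1 + snd p * (f1 + max t 0)" by (rule le) (simp add: f1)
      also have "\<dots> = fst p \<bullet> h1 + snd p * f1 + snd p * max t 0" by (simp add: algebra_simps)
      also have "snd p * max t 0 \<le> snd p * t" using neg by (intro mult_left_mono_neg) auto
      also have "snd p * t = - (fst p \<bullet> h1 + snd p * f1 - b + 1)" using neg by (simp add: t_def)
      finally show False by simp
    qed
    with p(1) le show ?thesis by (intro exI[of _ "fst p"] exI[of _ "snd p"] exI[of _ b]) (auto simp: inner_prod_def)
  qed
  have oblique: "\<exists>(\<phi>, c)\<in>affine_minorants F. r < \<phi> \<bullet> k - c"
    if "\<alpha> > 0" "a \<bullet> k + \<alpha> * r < b" and le: "\<And>h s. F h \<le> ereal s \<Longrightarrow> b \<le> a \<bullet> h + \<alpha> * s" for \<alpha> a b k r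
  proof -
    have eq: "(- (1/\<alpha>) *\<^sub>R a) \<bullet> h - (- b / \<alpha>) = (b - a \<bullet> h) / \<alpha>" for h
      using \<open>\<alpha> > 0\<close> by (simp add: field_simps)
    have "(- (1/\<alpha>) *\<^sub>R a, - b / \<alpha>) \<in> affine_minorants F"
      unfolding affine_minorants_def
    proof (clarify)
      fix h
      show "ereal ((- (1/\<alpha>) *\<^sub>R a) \<bullet> h - (- b / \<alpha>)) \<le> F h"
        using ninf[of h] le[of h] \<open>\<alpha> > 0\<close> unfolding eq by (cases "F h") (auto simp: field_simps)
    qed
    moreover have "r < (- (1/\<alpha>) *\<^sub>R a) \<bullet> k - (- b / \<alpha>)"
      unfolding eq using that(1,2) by (simp add: field_simps)
    ultimately show ?thesis by (intro bexI[of _ "(- (1/\<alpha>) *\<^sub>R a, - b / \<alpha>)"]) auto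
  qed
  have "\<exists>(\<phi>, c)\<in>affine_minorants F. f1 - 1 < \<phi> \<bullet> h1 - c"
  proof -
    obtain a \<alpha> b where s: "\<alpha> \<ge> 0" "a \<bullet> h1 + \<alpha> * (f1 - 1) < b" "\<And>h s. F h \<le> ereal s \<Longrightarrow> b \<le> a \<bullet> h + \<alpha> * s"
      using separate[of "f1 - 1" h1] by (auto simp: f1)
    have "\<alpha> > 0" using s(2) s(3)[of h1 f1] by (simp add: f1 algebra_simps)
    then show ?thesis using s by (intro oblique) auto
  qed
  then obtain \<phi>1 c1 where m1: "(\<phi>1, c1) \<in> affine_minorants F" by auto
  obtain a \<alpha> b where s: "\<alpha> \<ge> 0" "a \<bullet> h0 + \<alpha> * r0 < b" "\<And>h s. F h \<le> ereal s \<Longrightarrow> b \<le> a \<bullet> h + \<alpha> * s"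
    using separate[OF r0] by blast
  show ?thesis
  proof (cases "\<alpha> = 0")
    case False
    then show ?thesis using s by (intro oblique) auto
  next
    \<comment> \<open>A vertical hyperplane: its equation is added, with a large factor, to a minorant.\<close>
    case True
    define n where "n = max 0 ((r0 - (\<phi>1 \<bullet> h0 - c1) + 1) / (b - a \<bullet> h0))"
    have pos: "b - a \<bullet> h0 > 0" using s(2) True by simp
    have eq: "(\<phi>1 - n *\<^sub>R a) \<bullet> h - (c1 - n * b) = (\<phi>1 \<bullet> h - c1) + n * (b - a \<bullet> h)" for h
      by (simp add: inner_diff_left algebra_simps)
    have "(\<phi>1 - n *\<^sub>R a, c1 - n * b) \<in> affine_minorants F"
      unfolding affine_minorants_def
    proof (clarify)
      fix h
      show "ereal ((\<phi>1 - n *\<^sub>R a) \<bullet> h - (c1 - n * b)) \<le> F h"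
      proof (cases "F h")
        case (real f)
        have "b \<le> a \<bullet> h" using s(3)[of h f] True real by simp
        then have "n * (b - a \<bullet> h) \<le> 0" by (intro mult_nonneg_nonpos) (auto simp: n_def)
        moreover have "\<phi>1 \<bullet> h - c1 \<le> f" using m1 real by (auto simp: affine_minorants_def dest: spec[of _ h])
        ultimately show ?thesis unfolding eq by (simp add: real)
      qed (use ninf in auto)
    qed
    moreover have "r0 < (\<phi>1 - n *\<^sub>R a) \<bullet> h0 - (c1 - n * b)"
    proof -
      have "r0 - (\<phi>1 \<bullet> h0 - c1) + 1 = (r0 - (\<phi>1 \<bullet> h0 - c1) + 1) / (b - a \<bullet> h0) * (b - a \<bullet> h0)"
        using pos by simp
      also have "\<dots> \<le> n * (b - a \<bullet> h0)" using pos by (intro mult_right_mono) (auto simp: n_def)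
      finally show ?thesis unfolding eq by simp
    qed
    ultimately show ?thesis by (intro bexI[of _ "(\<phi>1 - n *\<^sub>R a, c1 - n * b)"]) auto
  qed
qed

lemma affine_minorants_nonempty:
  fixes F :: "'h::{real_inner, complete_space} \<Rightarrow> ereal"
  assumes F: "proper_fun F" "lsc_fun F" "convex_fun F"
  shows "affine_minorants F \<noteq> {}"
proof -
  have "- \<infinity> < F 0" using F(1) unfolding proper_fun_def by auto
  then obtain r where "ereal r < F 0" using ereal_dense2 by blast
  from ex_affine_minorant_above[OF F this] show ?thesis by auto
qed

lemma eq_SUP_affine_minorants:
  fixes F :: "'h::{real_inner, complete_space} \<Rightarrow> ereal"
  assumes F: "proper_fun F" "lsc_fun F" "convex_fun F"
  shows "F h = (SUP p\<in>affine_minorants F. ereal (fst p \<bullet> h - snd p))"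
proof (rule antisym)
  show "F h \<le> (SUP p\<in>affine_minorants F. ereal (fst p \<bullet> h - snd p))"
  proof (rule dense_le)
    fix y assume "y < F h"
    then obtain r where r: "y < ereal r" "ereal r < F h" using ereal_dense2 by blast
    from ex_affine_minorant_above[OF F r(2)] obtain p
      where p: "p \<in> affine_minorants F" "r < fst p \<bullet> h - snd p" by fastforce
    have "y \<le> ereal (fst p \<bullet> h - snd p)" using r p by (meson ereal_less_eq(3) less_imp_le order_trans)
    with p show "y \<le> (SUP p\<in>affine_minorants F. ereal (fst p \<bullet> h - snd p))" by (meson SUP_upper2)
  qed
  show "(SUP p\<in>affine_minorants F. ereal (fst p \<bullet> h - snd p)) \<le> F h"
    by (rule SUP_least) (auto simp: affine_minorants_def)
qed

text \<open>The difference quotient from \<open>h0\<close> is at least \<open>\<phi> \<bullet> h + (\<phi> \<bullet> h0 - c - F h0) / t\<close> for every minorant, which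
  tends to the slope. Conversely \<open>\<phi> \<bullet> h0 - c \<le> F h0\<close> makes it at most the supremum of the slopes for every
  \<open>t > 0\<close>. In particular the limit exists and is independent of the base point.\<close>

lemma recession_eq_SUP_slopes:
  fixes F :: "'h::{real_inner, complete_space} \<Rightarrow> ereal"
  assumes F: "proper_fun F" "lsc_fun F" "convex_fun F"
  shows "recession_fun F h = (SUP p\<in>affine_minorants F. ereal (fst p \<bullet> h))"
proof -
  let ?S = "SUP p\<in>affine_minorants F. ereal (fst p \<bullet> h)"
  define h0 where "h0 = (SOME h0. F h0 < \<infinity>)"
  obtain h1 where "F h1 < \<infinity>" using F(1) unfolding proper_fun_def by blast
  then have "F h0 < \<infinity>" unfolding h0_def by (rule someI)
  moreover have "F h0 \<noteq> -\<infinity>" using F(1) unfolding proper_fun_def by blast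
  ultimately obtain f0 where f0: "F h0 = ereal f0" by (cases "F h0") auto
  let ?d = "\<lambda>t::real. (F (h0 + t *\<^sub>R h) - F h0) / ereal t"
  have "(?d \<longlongrightarrow> ?S) at_top"
  proof (rule order_tendstoI)
    fix y assume "y < ?S"
    then obtain \<phi> c where p: "(\<phi>, c) \<in> affine_minorants F" "y < ereal (\<phi> \<bullet> h)"
      by (auto simp: less_SUP_iff)
    have "((\<lambda>t. ereal (\<phi> \<bullet> h + (\<phi> \<bullet> h0 - c - f0) / t)) \<longlongrightarrow> ereal (\<phi> \<bullet> h + 0)) at_top"
      by (intro tendsto_intros tendsto_divide_0[OF tendsto_const] filterlim_at_top_imp_at_infinity filterlim_ident)
    then have "eventually (\<lambda>t. y < ereal (\<phi> \<bullet> h + (\<phi> \<bullet> h0 - c - f0) / t)) at_top"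
      by (rule order_tendstoD) (use p in simp)
    then show "eventually (\<lambda>t. y < ?d t) at_top" using eventually_gt_at_top[of 0]
    proof eventually_elim
      case (elim t)
      have "ereal (\<phi> \<bullet> (h0 + t *\<^sub>R h) - c) \<le> F (h0 + t *\<^sub>R h)"
        using p(1) by (auto simp: affine_minorants_def)
      then have "ereal (\<phi> \<bullet> h + (\<phi> \<bullet> h0 - c - f0) / t) \<le> ?d t"
      proof (cases "F (h0 + t *\<^sub>R h)")
        case (real r)
        have "\<phi> \<bullet> h + (\<phi> \<bullet> h0 - c - f0) / t = (\<phi> \<bullet> (h0 + t *\<^sub>R h) - c - f0) / t"
          using elim by (simp add: inner_add_right field_simps)
        also have "\<dots> \<le> (r - f0) / t"
          using \<open>ereal (\<phi> \<bullet> (h0 + t *\<^sub>R h) - c) \<le> _\<close> elim real by (intro divide_right_mono) auto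
        finally show ?thesis using elim by (simp add: real f0)
      qed (use elim \<open>ereal (\<phi> \<bullet> (h0 + t *\<^sub>R h) - c) \<le> _\<close> f0 in auto)
      with elim show ?case by (meson less_le_trans)
    qed
  next
    fix y assume y: "?S < y"
    have le_S: "?d t \<le> ?S" if t: "t > 0" for t
    proof (cases ?S)
      case (real s)
      have "F (h0 + t *\<^sub>R h) \<le> ereal (f0 + t * s)"
        unfolding eq_SUP_affine_minorants[OF F, of "h0 + t *\<^sub>R h"]
      proof (rule SUP_least)
        fix p assume p: "p \<in> affine_minorants F"
        then have "ereal (fst p \<bullet> h) \<le> ereal s" unfolding real[symmetric] by (rule SUP_upper)
        then have "t * (fst p \<bullet> h) \<le> t * s" using t by simp
        moreover have "fst p \<bullet> h0 - snd p \<le> f0"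
          using p f0 by (auto simp: affine_minorants_def dest: spec[of _ h0])
        ultimately show "ereal (fst p \<bullet> (h0 + t *\<^sub>R h) - snd p) \<le> ereal (f0 + t * s)"
          by (simp add: inner_add_right)
      qed
      then show ?thesis unfolding real f0 using t by (cases "F (h0 + t *\<^sub>R h)") (auto simp: field_simps)
    next
      case MInf
      then show ?thesis using affine_minorants_nonempty[OF F] by (auto simp: Sup_eq_MInfty image_def)
    qed auto
    show "eventually (\<lambda>t. ?d t < y) at_top"
      using eventually_gt_at_top[of 0]
    proof eventually_elim
      case (elim t)
      from le_S[OF elim] y show ?case by (rule le_less_trans)
    qed
  qed
  then show ?thesis unfolding recession_fun_def Let_def h0_def[symmetric]
    by (intro tendsto_Lim) auto
qed

lemma SUP_eq_SUP_dense_subset: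
  fixes g :: "'b::topological_space \<Rightarrow> real"
  assumes g: "continuous_on UNIV g" and T: "T \<subseteq> S" "S \<subseteq> closure T"
  shows "(SUP p\<in>S. ereal (g p)) = (SUP p\<in>T. ereal (g p))"
proof (rule antisym)
  show "(SUP p\<in>S. ereal (g p)) \<le> (SUP p\<in>T. ereal (g p))"
  proof (rule SUP_least)
    fix p assume "p \<in> S"
    show "ereal (g p) \<le> (SUP p\<in>T. ereal (g p))"
    proof (rule dense_le)
      fix y assume "y < ereal (g p)"
      moreover have "open {q. y < ereal (g q)}"
        using g by (intro open_Collect_less continuous_intros) auto
      ultimately have "{q. y < ereal (g q)} \<inter> T \<noteq> {}"
        using \<open>p \<in> S\<close> T(2) open_Int_closure_eq_empty[of "{q. y < ereal (g q)}" T] by auto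
      then obtain q where "q \<in> T" "y < ereal (g q)" by auto
      then show "y \<le> (SUP p\<in>T. ereal (g p))" by (meson SUP_upper2 less_imp_le)
    qed
  qed
qed (use T in \<open>auto intro: SUP_subset_mono\<close>)

text \<open>One countable set of minorants serves for \<open>F\<close> and for its recession function, because both are
  suprema of functions that depend continuously on the pair \<open>(\<phi>, c)\<close>. The countable form also makes
  both functions Borel measurable.\<close>

lemma countable_affine_representation:
  fixes F :: "'h::{real_inner, complete_space, second_countable_topology} \<Rightarrow> ereal"
  assumes F: "proper_fun F" "lsc_fun F" "convex_fun F"
  obtains \<phi> :: "nat \<Rightarrow> 'h" and c :: "nat \<Rightarrow> real"
  where "\<And>n. (\<phi> n, c n) \<in> affine_minorants F"
    "\<And>h. F h = (SUP n. ereal (\<phi> n \<bullet> h - c n))"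
    "\<And>h. recession_fun F h = (SUP n. ereal (\<phi> n \<bullet> h))"
proof -
  obtain T where T: "countable T" "T \<subseteq> affine_minorants F" "affine_minorants F \<subseteq> closure T"
    using separable by blast
  have "T \<noteq> {}" using T(3) affine_minorants_nonempty[OF F] by auto
  then have range: "range (from_nat_into T) = T" using T(1) by (rule range_from_nat_into)
  have SUP: "(SUP p\<in>affine_minorants F. ereal (g p)) = (SUP n. ereal (g (from_nat_into T n)))"
    if "continuous_on UNIV g" for g
    using SUP_eq_SUP_dense_subset[OF that T(2,3)] range by (metis (no_types) image_image)
  show ?thesis
  proof (rule that[of "\<lambda>n. fst (from_nat_into T n)" "\<lambda>n. snd (from_nat_into T n)"])
    show "(fst (from_nat_into T n), snd (from_nat_into T n)) \<in> affine_minorants F" for n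
      using range T(2) by auto
    show "F h = (SUP n. ereal (fst (from_nat_into T n) \<bullet> h - snd (from_nat_into T n)))" for h
      unfolding eq_SUP_affine_minorants[OF F, of h] by (rule SUP) (intro continuous_intros)
    show "recession_fun F h = (SUP n. ereal (fst (from_nat_into T n) \<bullet> h))" for h
      unfolding recession_eq_SUP_slopes[OF F, of h] by (rule SUP) (intro continuous_intros)
  qed
qed

text \<open>A supremum over all \<open>h\<close> becomes a supremum over the epigraph of \<open>F\<close> of functions that are
  continuous in the point of the epigraph, hence a countable supremum.\<close>

lemma borel_measurable_conjugate:
  fixes F :: "'h::{real_inner, second_countable_topology} \<Rightarrow> ereal"
  assumes F: "proper_fun F"
  shows "conjugate_fun F \<in> borel_measurable borel"
proof -
  have ninf: "F h \<noteq> -\<infinity>" for h using F unfolding proper_fun_def by blast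
  obtain T where T: "countable T" "T \<subseteq> epigraph F" "epigraph F \<subseteq> closure T"
    using separable by blast
  have "conjugate_fun F \<phi> = (SUP p\<in>epigraph F. ereal (\<phi> \<bullet> fst p - snd p))" for \<phi>
    unfolding conjugate_fun_def
  proof (rule antisym)
    show "(SUP h. ereal (\<phi> \<bullet> h) - F h) \<le> (SUP p\<in>epigraph F. ereal (\<phi> \<bullet> fst p - snd p))"
    proof (rule SUP_least)
      fix h
      show "ereal (\<phi> \<bullet> h) - F h \<le> (SUP p\<in>epigraph F. ereal (\<phi> \<bullet> fst p - snd p))"
      proof (cases "F h")
        case (real r)
        then show ?thesis by (intro SUP_upper2[of "(h, r)"]) (auto simp: epigraph_def)
      qed (use ninf in auto)
    qed
    show "(SUP p\<in>epigraph F. ereal (\<phi> \<bullet> fst p - snd p)) \<le> (SUP h. ereal (\<phi> \<bullet> h) - F h)"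
    proof (rule SUP_least)
      fix p assume "p \<in> epigraph F"
      then have "F (fst p) \<le> ereal (snd p)" by (auto simp: epigraph_def)
      then have "ereal (\<phi> \<bullet> fst p - snd p) \<le> ereal (\<phi> \<bullet> fst p) - F (fst p)"
        by (cases "F (fst p)") auto
      then show "ereal (\<phi> \<bullet> fst p - snd p) \<le> (SUP h. ereal (\<phi> \<bullet> h) - F h)" by (meson SUP_upper2 UNIV_I)
    qed
  qed
  also have "\<And>\<phi>. (SUP p\<in>epigraph F. ereal (\<phi> \<bullet> fst p - snd p)) = (SUP p\<in>T. ereal (\<phi> \<bullet> fst p - snd p))"
    by (rule SUP_eq_SUP_dense_subset[OF _ T(2,3)]) (intro continuous_intros)
  finally have "conjugate_fun F = (\<lambda>\<phi>. SUP p\<in>T. ereal (\<phi> \<bullet> fst p - snd p))" by auto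
  then show ?thesis using T(1) by (auto intro!: borel_measurable_SUP)
qed

section \<open>Integrals of extended real functions bounded below\<close>

lemma ereal_integral_mono:
  assumes "\<And>x. f x \<le> g x"
  shows "ereal_integral M f \<le> ereal_integral M g"
  unfolding ereal_integral_def
  by (intro ereal_minus_mono) (auto simp: less_eq_ennreal.rep_eq[symmetric] intro!: nn_integral_mono e2ennreal_mono assms)

text \<open>The definition subtracts the integrals of the positive and the negative part. The identity
  follows by integrating the equation \<open>(f + g)\<^sup>+ + f\<^sup>- = (f + g)\<^sup>- + f\<^sup>+ + g\<close>, in which only \<open>(f + g)\<^sup>+\<close> and \<open>g\<close>
  may have infinite integrals.\<close>

lemma ereal_integral_add_nonneg:
  assumes f: "integrable M f" and g: "g \<in> borel_measurable M"
  shows "ereal_integral M (\<lambda>x. ereal (f x) + enn2ereal (g x)) =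
    ereal (integral\<^sup>L M f) + enn2ereal (\<integral>\<^sup>+x. g x \<partial>M)"
proof -
  let ?h = "\<lambda>x. ereal (f x) + enn2ereal (g x)"
  let ?p = "\<integral>\<^sup>+x. e2ennreal (?h x) \<partial>M" and ?n = "\<integral>\<^sup>+x. e2ennreal (- ?h x) \<partial>M"
  let ?fp = "\<integral>\<^sup>+x. ennreal (f x) \<partial>M" and ?fn = "\<integral>\<^sup>+x. ennreal (- f x) \<partial>M"
  let ?g = "\<integral>\<^sup>+x. g x \<partial>M"
  have [measurable]: "f \<in> borel_measurable M" "g \<in> borel_measurable M" using f g by auto
  have fin: "?fp < \<infinity>" "?fn < \<infinity>"
    using f unfolding real_integrable_def by (auto simp: top.not_eq_extremum)
  have pt: "e2ennreal (?h x) + ennreal (- f x) = e2ennreal (- ?h x) + (ennreal (f x) + g x)" for x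
  proof (cases "g x")
    case (real r)
    have "e2ennreal (?h x) = ennreal (f x + r)" "e2ennreal (- ?h x) = ennreal (- (f x + r))"
      using real by (simp_all add: ennreal.rep_eq e2ennreal_ereal max_def[symmetric] max.absorb2)
    then show ?thesis using real
      by (cases "f x \<ge> 0"; cases "f x + r \<ge> 0")
        (auto simp: ennreal_neg ennreal_plus[symmetric] simp del: ennreal_plus)
  next
    case top
    then show ?thesis by simp
  qed
  have "(\<integral>\<^sup>+x. e2ennreal (?h x) + ennreal (- f x) \<partial>M) = (\<integral>\<^sup>+x. e2ennreal (- ?h x) + (ennreal (f x) + g x) \<partial>M)"
    by (simp only: pt)
  then have eq: "?p + ?fn = ?n + (?fp + ?g)"
    by (simp add: nn_integral_add)
  have "?n \<le> ?fn"
  proof (rule nn_integral_mono)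
    fix x
    have "- ?h x \<le> - ereal (f x)" by (cases "enn2ereal (g x)") (auto simp: enn2ereal_nonneg; metis enn2ereal_nonneg ereal_less_eq(5))+
    then have "e2ennreal (- ?h x) \<le> e2ennreal (- ereal (f x))" by (rule e2ennreal_mono)
    then show "e2ennreal (- ?h x) \<le> ennreal (- f x)" by (simp add: e2ennreal_ereal)
  qed
  then have "?n < \<infinity>" using fin(2) by (rule le_less_trans)
  have I: "integral\<^sup>L M f = enn2real ?fp - enn2real ?fn" by (rule real_lebesgue_integral_def[OF f])
  show ?thesis
    unfolding ereal_integral_def I
    using eq fin \<open>?n < \<infinity>\<close>
    by (cases ?p; cases ?n; cases ?fp; cases ?fn; cases ?g)
      (auto simp: ennreal_plus[symmetric] enn2real_def ennreal.rep_eq max_def simp del: ennreal_plus)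
qed

lemma ereal_integral_real:
  assumes "integrable M f"
  shows "ereal_integral M (\<lambda>x. ereal (f x)) = ereal (integral\<^sup>L M f)"
  using ereal_integral_add_nonneg[OF assms, of "\<lambda>_. 0"] by (simp add: zero_ennreal.rep_eq)

lemma ereal_eq_lower_plus_ennreal:
  assumes "ereal a \<le> b"
  shows "b = ereal a + enn2ereal (e2ennreal (b - ereal a))"
proof -
  have "0 \<le> b - ereal a" using assms by (cases b) auto
  then show ?thesis by (cases b) (auto simp: enn2ereal_e2ennreal)
qed

lemma ereal_integral_eq_lower_plus:
  assumes "integrable M f" "g \<in> borel_measurable M" "\<And>x. ereal (f x) \<le> g x"
  shows "ereal_integral M g = ereal (integral\<^sup>L M f) + enn2ereal (\<integral>\<^sup>+x. e2ennreal (g x - ereal (f x)) \<partial>M)"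
proof -
  have [measurable]: "f \<in> borel_measurable M" "g \<in> borel_measurable M" using assms by auto
  have "g = (\<lambda>x. ereal (f x) + enn2ereal (e2ennreal (g x - ereal (f x))))"
    using ereal_eq_lower_plus_ennreal[OF assms(3)] by auto
  then have "ereal_integral M g = ereal_integral M (\<lambda>x. ereal (f x) + enn2ereal (e2ennreal (g x - ereal (f x))))"
    by (rule arg_cong)
  also have "\<dots> = ereal (integral\<^sup>L M f) + enn2ereal (\<integral>\<^sup>+x. e2ennreal (g x - ereal (f x)) \<partial>M)"
    by (rule ereal_integral_add_nonneg[OF assms(1)]) simp
  finally show ?thesis .
qed

lemma ereal_integral_monotone_convergence:
  fixes f :: "nat \<Rightarrow> 'a \<Rightarrow> real"
  assumes f: "\<And>n. integrable M (f n)" and inc: "\<And>x. incseq (\<lambda>n. f n x)"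
    and g: "\<And>x. g x = (SUP n. ereal (f n x))"
  shows "(\<lambda>n. ereal (integral\<^sup>L M (f n))) \<longlonglongrightarrow> ereal_integral M g"
proof -
  have [measurable]: "\<And>n. f n \<in> borel_measurable M" using f by auto
  have le: "f 0 x \<le> f n x" for n x using inc[of x] by (auto simp: incseq_def)
  have gm: "g \<in> borel_measurable M" unfolding g[abs_def] by measurable
  let ?d = "\<lambda>n x. ennreal (f n x - f 0 x)"
  have d: "e2ennreal (ereal (f n x) - ereal (f 0 x)) = ?d n x" for n x
    by (simp add: e2ennreal_ereal)
  have incd: "incseq ?d"
    using inc by (auto simp: incseq_def le_fun_def intro!: ennreal_leI)
  have lim: "e2ennreal (g x - ereal (f 0 x)) = (SUP n. ?d n x)" for x
  proof (rule LIMSEQ_unique)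
    have "(\<lambda>n. ereal (f n x)) \<longlonglongrightarrow> g x"
      unfolding g using inc[of x] by (intro LIMSEQ_SUP) (auto simp: incseq_def)
    then have "(\<lambda>n. ereal (f n x) - ereal (f 0 x)) \<longlonglongrightarrow> g x - ereal (f 0 x)"
      by (intro tendsto_diff_ereal_general tendsto_const) auto
    then have "(\<lambda>n. e2ennreal (ereal (f n x) - ereal (f 0 x))) \<longlonglongrightarrow> e2ennreal (g x - ereal (f 0 x))"
      
      using continuous_at_e2ennreal[of _ UNIV] by (rule isCont_tendsto_compose[rotated])
    then show "(\<lambda>n. ?d n x) \<longlonglongrightarrow> e2ennreal (g x - ereal (f 0 x))" by (simp only: d)
    show "(\<lambda>n. ?d n x) \<longlonglongrightarrow> (SUP n. ?d n x)"
      using incd by (intro LIMSEQ_SUP) (auto simp: incseq_def le_fun_def)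
  qed
  have "(\<lambda>n. \<integral>\<^sup>+x. ?d n x \<partial>M) \<longlonglongrightarrow> (SUP n. \<integral>\<^sup>+x. ?d n x \<partial>M)"
    using incd by (intro LIMSEQ_SUP) (auto simp: incseq_def le_fun_def intro!: nn_integral_mono)
  also have "(SUP n. \<integral>\<^sup>+x. ?d n x \<partial>M) = (\<integral>\<^sup>+x. (SUP n. ?d n x) \<partial>M)"
    by (rule nn_integral_monotone_convergence_SUP[symmetric]) (use incd in auto)
  finally have "(\<lambda>n. enn2ereal (\<integral>\<^sup>+x. ?d n x \<partial>M)) \<longlonglongrightarrow> enn2ereal (\<integral>\<^sup>+x. (SUP n. ?d n x) \<partial>M)"
    
    using continuous_at_enn2ereal[of _ UNIV] by (rule isCont_tendsto_compose[rotated])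
  then have "(\<lambda>n. ereal (integral\<^sup>L M (f 0)) + enn2ereal (\<integral>\<^sup>+x. ?d n x \<partial>M))
      \<longlonglongrightarrow> ereal (integral\<^sup>L M (f 0)) + enn2ereal (\<integral>\<^sup>+x. (SUP n. ?d n x) \<partial>M)"
    by (intro tendsto_add_ereal_general tendsto_const) auto
  moreover have "ereal (integral\<^sup>L M (f 0)) + enn2ereal (\<integral>\<^sup>+x. ?d n x \<partial>M) = ereal (integral\<^sup>L M (f n))" for n
    using ereal_integral_eq_lower_plus[OF f, of "\<lambda>x. ereal (f n x)" 0] le ereal_integral_real[OF f, of n]
    by (simp only: d) simp
  moreover have "ereal (integral\<^sup>L M (f 0)) + enn2ereal (\<integral>\<^sup>+x. (SUP n. ?d n x) \<partial>M) = ereal_integral M g"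
  proof -
    have "ereal (f 0 x) \<le> g x" for x unfolding g by (rule SUP_upper) simp
    from ereal_integral_eq_lower_plus[OF f gm this] show ?thesis by (simp only: lim)
  qed
  ultimately show ?thesis by simp
qed

text \<open>Subtracting integrable lower bounds turns both functions into nonnegative ones, for which the
  integral is additive even when it is infinite.\<close>

lemma ereal_integral_add_ge:
  assumes f: "f \<in> borel_measurable M" "integrable M a" "\<And>x. ereal (a x) \<le> f x"
    and g: "g \<in> borel_measurable M" "integrable M b" "\<And>x. ereal (b x) \<le> g x"
    and c: "integrable M c" "\<And>x. ereal (c x) \<le> f x + g x"
  shows "ereal (integral\<^sup>L M c) \<le> ereal_integral M f + ereal_integral M g"
proof -
  have [measurable]: "f \<in> borel_measurable M" "a \<in> borel_measurable M" "g \<in> borel_measurable M"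
    "b \<in> borel_measurable M" using assms by auto
  let ?f = "\<lambda>x. e2ennreal (f x - ereal (a x))" and ?g = "\<lambda>x. e2ennreal (g x - ereal (b x))"
  have bound: "c x \<le> a x + b x + t" if "ereal t = enn2ereal (?f x + ?g x)" for x t
    using that c(2)[of x] f(3)[of x] g(3)[of x]
    by (cases "f x"; cases "g x") (auto simp: plus_ennreal.rep_eq enn2ereal_e2ennreal)
  have *: "ereal (c x) \<le> ereal (a x + b x) + enn2ereal (?f x + ?g x)" for x
  proof (cases "?f x + ?g x")
    case (real t)
    then have t: "ereal t = enn2ereal (?f x + ?g x)" by (simp add: ennreal.rep_eq max_def)
    from bound[OF t] show ?thesis by (simp flip: t)
  next
    case top
    then show ?thesis by (simp only:) (simp add: top_ennreal.rep_eq top_ereal_def)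
  qed
  have "ereal (integral\<^sup>L M c) = ereal_integral M (\<lambda>x. ereal (c x))"
    by (rule ereal_integral_real[symmetric, OF c(1)])
  also have "\<dots> \<le> ereal_integral M (\<lambda>x. ereal (a x + b x) + enn2ereal (?f x + ?g x))"
    by (rule ereal_integral_mono) (rule *)
  also have "\<dots> = ereal (\<integral>x. a x + b x \<partial>M) + enn2ereal (\<integral>\<^sup>+x. ?f x + ?g x \<partial>M)"
    using f g by (intro ereal_integral_add_nonneg) auto
  also have "\<dots> = (ereal (integral\<^sup>L M a) + enn2ereal (\<integral>\<^sup>+x. ?f x \<partial>M)) + (ereal (integral\<^sup>L M b) + enn2ereal (\<integral>\<^sup>+x. ?g x \<partial>M))"
    using f g by (simp add: nn_integral_add plus_ennreal.rep_eq plus_ereal.simps(1)[symmetric] ac_simps del: plus_ereal.simps(1))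
  also have "\<dots> = ereal_integral M f + ereal_integral M g"
    using ereal_integral_eq_lower_plus[OF f(2,1,3)] ereal_integral_eq_lower_plus[OF g(2,1,3)] by simp
  finally show ?thesis .
qed

section \<open>Pairing with cylindrical maps\<close>

lemma integrable_bounded_mult:
  fixes \<phi> a :: "'a::topological_space \<Rightarrow> real"
  assumes sets: "sets M = sets borel" and a: "integrable M a"
    and \<phi>: "\<phi> \<in> borel_measurable borel" "bounded (range \<phi>)"
  shows "integrable M (\<lambda>x. \<phi> x * a x)"
proof -
  obtain K where K: "\<And>x. \<bar>\<phi> x\<bar> \<le> K" using \<phi>(2) unfolding bounded_iff by auto
  have [measurable]: "\<phi> \<in> borel_measurable M" "a \<in> borel_measurable M"
    using \<phi>(1) a sets by (auto cong: measurable_cong_sets)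
  show ?thesis
  proof (rule Bochner_Integration.integrable_bound[of M "\<lambda>x. K * \<bar>a x\<bar>"])
    show "integrable M (\<lambda>x. K * \<bar>a x\<bar>)" using a by auto
    have "\<bar>\<phi> x * a x\<bar> \<le> \<bar>K * \<bar>a x\<bar>\<bar>" for x
    proof -
      have "\<bar>\<phi> x * a x\<bar> \<le> K * \<bar>a x\<bar>" unfolding abs_mult by (intro mult_right_mono K) simp
      then show ?thesis by linarith
    qed
    then show "AE x in M. norm (\<phi> x * a x) \<le> norm (K * \<bar>a x\<bar>)" by simp
  qed measurable
qed

text \<open>Equality of set integrals extends to bounded integrands by approximation with simple functions.\<close>

lemma integral_mult_additive:
  fixes \<phi> a b c :: "'a::topological_space \<Rightarrow> real"
  assumes sets: "sets M1 = sets borel" "sets M2 = sets borel" "sets M3 = sets borel"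
    and int: "integrable M1 a" "integrable M2 b" "integrable M3 c"
    and eq: "\<And>B. B \<in> sets borel \<Longrightarrow>
      set_lebesgue_integral M1 B a = set_lebesgue_integral M2 B b + set_lebesgue_integral M3 B c"
    and \<phi>: "\<phi> \<in> borel_measurable borel" "bounded (range \<phi>)"
  shows "(\<integral>x. \<phi> x * a x \<partial>M1) = (\<integral>x. \<phi> x * b x \<partial>M2) + (\<integral>x. \<phi> x * c x \<partial>M3)"
proof -
  obtain K where K: "\<And>x. \<bar>\<phi> x\<bar> \<le> K" using \<phi>(2) unfolding bounded_iff by auto
  obtain s where s: "\<And>i. simple_function borel (s i)" "\<And>x. (\<lambda>i. s i x) \<longlonglongrightarrow> \<phi> x"
    "\<And>i x. dist (s i x) 0 \<le> 2 * dist (\<phi> x) 0"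
    using borel_measurable_implies_sequence_metric[OF \<phi>(1), of 0] by auto
  have sb: "\<bar>s i x\<bar> \<le> 2 * K" for i x using s(3)[of i x] K[of x] by simp
  have sm: "s i \<in> borel_measurable borel" for i by (rule borel_measurable_simple_function[OF s(1)])
  have rep: "(\<integral>x. s i x * d x \<partial>M) = (\<Sum>y\<in>range (s i). y * set_lebesgue_integral M (s i -` {y}) d)"
    if M: "sets M = sets borel" and d: "integrable M d" for M d i
  proof -
    have fin: "finite (range (s i))" using simple_functionD(1)[OF s(1), of i] by simp
    have "s i x * d x = (\<Sum>y\<in>range (s i). y * (indicator (s i -` {y}) x *\<^sub>R d x))" for x
    proof -
      have "(\<Sum>y\<in>range (s i). y * (indicator (s i -` {y}) x *\<^sub>R d x)) = (\<Sum>y\<in>range (s i). if y = s i x then y * d x else 0)"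
        by (intro sum.cong) (auto simp: indicator_def)
      then show ?thesis using fin by simp
    qed
    then have "(\<integral>x. s i x * d x \<partial>M) = (\<integral>x. (\<Sum>y\<in>range (s i). y * (indicator (s i -` {y}) x *\<^sub>R d x)) \<partial>M)" by simp
    also have "\<dots> = (\<Sum>y\<in>range (s i). \<integral>x. y * (indicator (s i -` {y}) x *\<^sub>R d x) \<partial>M)"
    proof (rule Bochner_Integration.integral_sum)
      fix y
      have "s i -` {y} \<in> sets M" using simple_functionD(2)[OF s(1), of i "{y}"] M by simp
      then show "integrable M (\<lambda>x. y * (indicator (s i -` {y}) x *\<^sub>R d x))"
        by (intro integrable_mult_right integrable_mult_indicator d)
    qed
    finally show ?thesis by (simp only: integral_mult_right_zero set_lebesgue_integral_def)
  qed
  have lim: "(\<lambda>i. \<integral>x. s i x * d x \<partial>M) \<longlonglongrightarrow> (\<integral>x. \<phi> x * d x \<partial>M)"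
    if M: "sets M = sets borel" and d: "integrable M d" for M d
  proof (rule integral_dominated_convergence[where w = "\<lambda>x. 2 * K * \<bar>d x\<bar>"])
    show "(\<lambda>x. \<phi> x * d x) \<in> borel_measurable M" "\<And>i. (\<lambda>x. s i x * d x) \<in> borel_measurable M"
      using \<phi>(1) sm d M by (auto cong: measurable_cong_sets intro!: borel_measurable_times)
    show "integrable M (\<lambda>x. 2 * K * \<bar>d x\<bar>)" using d by auto
    show "AE x in M. (\<lambda>i. s i x * d x) \<longlonglongrightarrow> \<phi> x * d x" by (intro AE_I2 tendsto_intros s(2))
    show "AE x in M. norm (s i x * d x) \<le> 2 * K * \<bar>d x\<bar>" for i
      using sb by (intro AE_I2) (simp add: abs_mult mult_right_mono)
  qed
  have step: "(\<integral>x. s i x * a x \<partial>M1) = (\<integral>x. s i x * b x \<partial>M2) + (\<integral>x. s i x * c x \<partial>M3)" for i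
  proof -
    have "s i -` {y} \<in> sets borel" for y using simple_functionD(2)[OF s(1), of i "{y}"] by simp
    then show ?thesis
      by (simp add: rep[OF sets(1) int(1)] rep[OF sets(2) int(2)] rep[OF sets(3) int(3)] eq
          distrib_left sum.distrib)
  qed
  have "(\<lambda>i. \<integral>x. s i x * a x \<partial>M1) \<longlonglongrightarrow> (\<integral>x. \<phi> x * b x \<partial>M2) + (\<integral>x. \<phi> x * c x \<partial>M3)"
    unfolding step by (intro tendsto_add lim sets int)
  from LIMSEQ_unique[OF lim[OF sets(1) int(1)] this] show ?thesis .
qed

lemma FCb1_vec_inner_eq:
  fixes \<Phi> :: "'a::real_normed_vector \<Rightarrow> 'h::real_inner"
  assumes "\<Phi> \<in> FCb1_vec"
  obtains n :: nat and \<phi> h where "\<And>i. i < n \<Longrightarrow> \<phi> i \<in> FCb1"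
    "\<And>x v. \<Phi> x \<bullet> v = (\<Sum>i<n. \<phi> i x * (h i \<bullet> v))"
proof -
  obtain n :: nat and c \<phi> h where "\<And>i. i < n \<Longrightarrow> \<phi> i \<in> FCb1"
    and \<Phi>: "\<Phi> = (\<lambda>x. \<Sum>i<n. c i *\<^sub>R (\<phi> i x *\<^sub>R h i))"
    using assms unfolding FCb1_vec_def by blast
  moreover have "\<Phi> x \<bullet> v = (\<Sum>i<n. \<phi> i x * ((c i *\<^sub>R h i) \<bullet> v))" for x v
    unfolding \<Phi> by (simp add: inner_sum_left ac_simps)
  ultimately show ?thesis by (intro that[of n \<phi> "\<lambda>i. c i *\<^sub>R h i"])
qed

lemma integrable_FCb1_vec_inner:
  fixes \<Phi> :: "'a::real_normed_vector \<Rightarrow> 'h::{real_inner, banach, second_countable_topology}"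
  assumes \<Phi>: "\<Phi> \<in> FCb1_vec" and sets: "sets M = sets borel" and g: "integrable M g"
  shows "integrable M (\<lambda>x. \<Phi> x \<bullet> g x)"
proof -
  obtain n :: nat and \<phi> h where \<phi>: "\<And>i. i < n \<Longrightarrow> \<phi> i \<in> FCb1"
    and eq: "\<And>x v. \<Phi> x \<bullet> v = (\<Sum>i<n. \<phi> i x * (h i \<bullet> v))"
    using FCb1_vec_inner_eq[OF \<Phi>] by metis
  show ?thesis unfolding eq
    by (intro Bochner_Integration.integrable_sum integrable_bounded_mult[OF sets] integrable_inner_right g)
      (auto intro: FCb1_measurable FCb1_bounded \<phi>)
qed

text \<open>The pairing is defined through the polar density of \<open>\<mu>\<close> itself, whereas the two sides of the theorem
  are compared through \<open>\<mu>a\<close> and \<open>\<mu>s\<close>; this lemma passes from one to the other.\<close>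

lemma pairing_integral_decomposition:
  fixes \<Phi> :: "'a::real_normed_vector \<Rightarrow> 'h::{real_inner, banach, second_countable_topology}"
  assumes \<Phi>: "\<Phi> \<in> FCb1_vec" and sets: "sets \<gamma> = sets borel" and \<mu>: "\<mu> \<in> vector_measures"
    and rn: "radon_nikodym_decomposition \<gamma> \<mu> \<mu>a \<mu>s"
  shows "pairing_integral \<Phi> \<mu> = (\<integral>x. \<Phi> x \<bullet> \<mu>a x \<partial>\<gamma>) +
    (\<integral>x. \<Phi> x \<bullet> polar_density \<mu>s x \<partial>variation_measure \<mu>s)"
proof -
  have a: "integrable \<gamma> \<mu>a" and s: "\<mu>s \<in> vector_measures"
    and dec: "\<And>B. B \<in> sets borel \<Longrightarrow> \<mu> B = set_lebesgue_integral \<gamma> B \<mu>a + \<mu>s B"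
    using rn unfolding radon_nikodym_decomposition_def by auto
  note g = integrable_polar_density[OF \<mu>] and gs = integrable_polar_density[OF s]
  obtain n :: nat and \<phi> h where \<phi>: "\<And>i. i < n \<Longrightarrow> \<phi> i \<in> FCb1"
    and eq: "\<And>x v. \<Phi> x \<bullet> v = (\<Sum>i<n. \<phi> i x * (h i \<bullet> v))"
    using FCb1_vec_inner_eq[OF \<Phi>] by metis
  have I: "(\<integral>x. \<Phi> x \<bullet> d x \<partial>M) = (\<Sum>i<n. \<integral>x. \<phi> i x * (h i \<bullet> d x) \<partial>M)"
    if "sets M = sets borel" "integrable M d" for M and d :: "'a \<Rightarrow> 'h"
    unfolding eq using that \<phi>
    by (intro Bochner_Integration.integral_sum integrable_bounded_mult integrable_inner_right)
      (auto intro: FCb1_measurable FCb1_bounded)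
  have set_inner: "set_lebesgue_integral M B (\<lambda>x. k \<bullet> d x) = k \<bullet> set_lebesgue_integral M B d"
    if "sets M = sets borel" "integrable M d" "B \<in> sets borel" for M B k and d :: "'a \<Rightarrow> 'h"
    unfolding set_lebesgue_integral_def using integrable_mult_indicator[of B M d] that
    by (subst integral_inner_right[symmetric]) auto
  have "(\<integral>x. \<phi> i x * (h i \<bullet> polar_density \<mu> x) \<partial>variation_measure \<mu>) =
    (\<integral>x. \<phi> i x * (h i \<bullet> \<mu>a x) \<partial>\<gamma>) + (\<integral>x. \<phi> i x * (h i \<bullet> polar_density \<mu>s x) \<partial>variation_measure \<mu>s)"
    if "i < n" for i
  proof (rule integral_mult_additive)
    fix B :: "'a set" assume B: "B \<in> sets borel"
    show "set_lebesgue_integral (variation_measure \<mu>) B (\<lambda>x. h i \<bullet> polar_density \<mu> x) =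
      set_lebesgue_integral \<gamma> B (\<lambda>x. h i \<bullet> \<mu>a x) +
      set_lebesgue_integral (variation_measure \<mu>s) B (\<lambda>x. h i \<bullet> polar_density \<mu>s x)"
      by (simp add: set_inner g gs a sets B set_integral_polar_density[OF \<mu> B]
          set_integral_polar_density[OF s B] dec[OF B] inner_add_right)
  qed (use sets g gs a FCb1_measurable[OF \<phi>[OF that]] FCb1_bounded[OF \<phi>[OF that]] in
      \<open>auto intro: integrable_inner_right\<close>)
  then show ?thesis
    unfolding pairing_integral_def
    by (simp add: I g gs a sets sum.distrib)
qed

section \<open>The two inequalities\<close>

text \<open>At a point where the conjugate is finite, \<open>\<Phi> x\<close> is the slope of a minorant. Such points are found
  in every cylinder around \<open>x0\<close>, and \<open>\<Phi>\<close> is nearly constant on thin cylinders. So the bound holds at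
  every point and not merely almost everywhere.\<close>

lemma recession_bound_on_support:
  fixes \<gamma> :: "'a::{banach, second_countable_topology} measure"
    and F :: "'h::{real_inner, banach, second_countable_topology} \<Rightarrow> ereal"
  assumes \<gamma>: "centered_gaussian_measure \<gamma>" "nondegenerate_measure \<gamma>"
    and F: "proper_fun F" "lsc_fun F" "convex_fun F"
    and \<Phi>: "\<Phi> \<in> FCb1_vec" and AE: "AE x in \<gamma>. conjugate_fun F (\<Phi> x) \<noteq> \<infinity>"
  shows "ereal (\<Phi> x0 \<bullet> h) \<le> recession_fun F h"
proof -
  obtain p where "p \<in> affine_minorants F" using affine_minorants_nonempty[OF F] by auto
  then have "ereal (fst p \<bullet> h) \<le> recession_fun F h"
    unfolding recession_eq_SUP_slopes[OF F] by (rule SUP_upper)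
  obtain h1 where h1: "F h1 < \<infinity>" using F(1) unfolding proper_fun_def by blast
  have slope: "ereal (\<Phi> x \<bullet> h) \<le> recession_fun F h" if x: "conjugate_fun F (\<Phi> x) \<noteq> \<infinity>" for x
  proof -
    have "ereal (\<Phi> x \<bullet> h1) - F h1 \<le> conjugate_fun F (\<Phi> x)"
      unfolding conjugate_fun_def by (rule SUP_upper) simp
    then have "conjugate_fun F (\<Phi> x) \<noteq> -\<infinity>" using h1 by (cases "F h1") auto
    then obtain c where "conjugate_fun F (\<Phi> x) = ereal c" using x by (cases "conjugate_fun F (\<Phi> x)") auto
    then have "(\<Phi> x, c) \<in> affine_minorants F" unfolding conjugate_le_iff[symmetric] by simp
    then show ?thesis unfolding recession_eq_SUP_slopes[OF F] by (rule SUP_upper2) simp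
  qed
  show ?thesis
  proof (cases "recession_fun F h")
    case (real s)
    obtain L K where L: "finite (L :: ('a \<Rightarrow>\<^sub>L real) set)" "0 \<le> K"
      and lip: "\<And>x y. norm (\<Phi> x - \<Phi> y) \<le> K * (\<Sum>\<eta>\<in>L. \<bar>blinfun_apply \<eta> (x - y)\<bar>)"
      using FCb1_vec_lipschitz[OF \<Phi>] by blast
    have "\<Phi> x0 \<bullet> h \<le> s + \<epsilon>" if \<epsilon>: "0 < \<epsilon>" for \<epsilon>
    proof -
      define C where "C = 1 + K * card L * norm h"
      have "1 \<le> C" unfolding C_def using L(2) by simp
      define \<delta> where "\<delta> = \<epsilon> / C"
      have "0 < \<delta>" unfolding \<delta>_def using \<epsilon> \<open>1 \<le> C\<close> by simp
      obtain x where x: "conjugate_fun F (\<Phi> x) \<noteq> \<infinity>" "\<And>\<eta>. \<eta> \<in> L \<Longrightarrow> \<bar>blinfun_apply \<eta> (x - x0)\<bar> < \<delta>"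
        using gaussian_cylinder_positive[OF \<gamma> L(1) \<open>0 < \<delta>\<close> AE] by blast
      have "norm (\<Phi> x - \<Phi> x0) \<le> K * (\<Sum>\<eta>\<in>L. \<bar>blinfun_apply \<eta> (x - x0)\<bar>)" by (rule lip)
      also have "\<dots> \<le> K * (\<Sum>\<eta>\<in>L. \<delta>)"
        using x(2) by (intro mult_left_mono[OF _ L(2)] sum_mono) (simp add: less_imp_le)
      finally have d: "norm (\<Phi> x - \<Phi> x0) \<le> K * card L * \<delta>" by simp
      have "\<Phi> x0 \<bullet> h = \<Phi> x \<bullet> h - (\<Phi> x - \<Phi> x0) \<bullet> h" by (simp add: inner_diff_left)
      also have "\<dots> \<le> \<Phi> x \<bullet> h + norm (\<Phi> x - \<Phi> x0) * norm h"
        using Cauchy_Schwarz_ineq2[of "\<Phi> x - \<Phi> x0" h] by linarith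
      also have "\<Phi> x \<bullet> h \<le> s" using slope[OF x(1)] real by simp
      also have "norm (\<Phi> x - \<Phi> x0) * norm h \<le> K * card L * \<delta> * norm h"
        by (intro mult_right_mono d) simp
      also have "K * card L * \<delta> * norm h \<le> C * \<delta>"
        unfolding C_def using \<open>0 < \<delta>\<close> by (simp add: algebra_simps)
      also have "C * \<delta> = \<epsilon>" unfolding \<delta>_def using \<open>1 \<le> C\<close> by simp
      finally show ?thesis by simp
    qed
    then have "\<Phi> x0 \<bullet> h \<le> s" by (rule field_le_epsilon)
    then show ?thesis by (simp add: real)
  qed (use \<open>ereal (fst p \<bullet> h) \<le> recession_fun F h\<close> in auto)
qed

theorem theorem3p2:
  fixes \<gamma> :: "('a :: {banach, second_countable_topology}) measure"
    and J :: "'h :: {real_inner, banach, second_countable_topology} \<Rightarrow> 'a"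
    and F :: "'h \<Rightarrow> ereal"
    and \<mu> \<mu>s :: "'a set \<Rightarrow> 'h"
    and \<mu>a :: "'a \<Rightarrow> 'h"
  assumes "centered_gaussian_measure \<gamma>"
    and "nondegenerate_measure \<gamma>"
    and "represents_cameron_martin \<gamma> J"
    and "proper_fun F" and "lsc_fun F" and "convex_fun F"
    and "\<mu> \<in> vector_measures"
    and "radon_nikodym_decomposition \<gamma> \<mu> \<mu>a \<mu>s"
  shows "measure_functional \<gamma> F \<mu>a \<mu>s =
    (SUP \<Phi> \<in> FCb1_vec.
       ereal (pairing_integral \<Phi> \<mu>) - ereal_integral \<gamma> (\<lambda>x. conjugate_fun F (\<Phi> x)))"
proof -
  note F = assms(4-6)
  let ?V = "variation_measure \<mu>s" and ?g = "polar_density \<mu>s"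
  let ?A = "ereal_integral \<gamma> (\<lambda>x. F (\<mu>a x))" and ?S = "ereal_integral ?V (\<lambda>x. recession_fun F (?g x))"
  let ?val = "\<lambda>\<Phi>. ereal (pairing_integral \<Phi> \<mu>) - ereal_integral \<gamma> (\<lambda>x. conjugate_fun F (\<Phi> x))"
  interpret prob_space \<gamma> by (rule gaussian_prob_space[OF assms(1)])
  have sets\<gamma>: "sets \<gamma> = sets borel" by (rule gaussian_sets[OF assms(1)])
  have \<mu>a: "integrable \<gamma> \<mu>a" and \<mu>s: "\<mu>s \<in> vector_measures"
    and sing: "\<exists>N\<in>sets borel. emeasure \<gamma> N = 0 \<and> total_variation \<mu>s (- N) = 0"
    using assms(8) unfolding radon_nikodym_decomposition_def by auto
  have g: "integrable ?V ?g" by (rule integrable_polar_density[OF \<mu>s])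
  have [measurable]: "\<mu>a \<in> borel_measurable \<gamma>" "?g \<in> borel_measurable ?V" using \<mu>a g by auto
  have pairing: "pairing_integral \<Phi> \<mu> = (\<integral>x. \<Phi> x \<bullet> \<mu>a x \<partial>\<gamma>) + (\<integral>x. \<Phi> x \<bullet> ?g x \<partial>?V)"
    if "\<Phi> \<in> FCb1_vec" for \<Phi> by (rule pairing_integral_decomposition[OF that sets\<gamma> assms(7,8)])
  obtain \<phi> c where minorant: "\<And>n. (\<phi> n, c n) \<in> affine_minorants F"
    and F_eq: "\<And>h. F h = (SUP n::nat. ereal (\<phi> n \<bullet> h - c n))"
    and R_eq: "\<And>h. recession_fun F h = (SUP n. ereal (\<phi> n \<bullet> h))"
    by (rule countable_affine_representation[OF F]) (rule that, assumption+)
  have F_meas: "(\<lambda>x. F (\<mu>a x)) \<in> borel_measurable \<gamma>" unfolding F_eq by measurable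
  define f where "f = (\<lambda>n x. \<phi> n \<bullet> \<mu>a x - c n)"
  define k where "k = (\<lambda>n x. \<phi> n \<bullet> ?g x)"
  have f_int: "integrable \<gamma> (f n)" for n
    unfolding f_def using \<mu>a by (intro Bochner_Integration.integrable_diff integrable_inner_right) auto
  have k_int: "integrable ?V (k n)" for n
    unfolding k_def using g by (intro integrable_inner_right)
  have limA: "(\<lambda>n. ereal (\<integral>x. running_max f n x \<partial>\<gamma>)) \<longlonglongrightarrow> ?A"
    by (intro ereal_integral_monotone_convergence integrable_running_max f_int incseq_running_max)
      (simp add: F_eq f_def SUP_running_max[symmetric])
  have limS: "(\<lambda>n. ereal (\<integral>x. running_max k n x \<partial>?V)) \<longlonglongrightarrow> ?S"
    by (intro ereal_integral_monotone_convergence integrable_running_max k_int incseq_running_max)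
      (simp add: R_eq k_def SUP_running_max[symmetric])
  have A_lower: "ereal (\<integral>x. f 0 x \<partial>\<gamma>) \<le> ?A"
    unfolding ereal_integral_real[OF f_int, symmetric]
    by (rule ereal_integral_mono) (auto simp: F_eq f_def intro: SUP_upper)
  have S_lower: "ereal (\<integral>x. k 0 x \<partial>?V) \<le> ?S"
    unfolding ereal_integral_real[OF k_int, symmetric]
    by (rule ereal_integral_mono) (auto simp: R_eq k_def intro: SUP_upper)
  \<comment> \<open>Fenchel--Young on the absolutely continuous part, full support of \<open>\<gamma>\<close> on the singular part. The lower
    bounds by \<open>f 0\<close> and \<open>k 0\<close> exclude the value \<open>-\<infinity>\<close>.\<close>
  have "?val \<Phi> \<le> ?A + ?S" if \<Phi>: "\<Phi> \<in> FCb1_vec" for \<Phi>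
  proof (cases "ereal_integral \<gamma> (\<lambda>x. conjugate_fun F (\<Phi> x)) = \<infinity>")
    case True
    then show ?thesis by simp
  next
    case False
    let ?C = "ereal_integral \<gamma> (\<lambda>x. conjugate_fun F (\<Phi> x))"
    obtain h1 where "F h1 < \<infinity>" using F(1) unfolding proper_fun_def by blast
    moreover have "F h1 \<noteq> -\<infinity>" using F(1) unfolding proper_fun_def by blast
    ultimately obtain f1 where f1: "F h1 = ereal f1" by (cases "F h1") auto
    have lower: "ereal (\<Phi> x \<bullet> h1 - f1) \<le> conjugate_fun F (\<Phi> x)" for x
      unfolding conjugate_fun_def by (rule SUP_upper2[of h1]) (simp_all add: f1)
    have l_int: "integrable \<gamma> (\<lambda>x. \<Phi> x \<bullet> h1 - f1)"
      using integrable_FCb1_vec_inner[OF \<Phi> sets\<gamma>, of "\<lambda>_. h1"] by auto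
    have [measurable]: "\<Phi> \<in> borel_measurable \<gamma>"
      using borel_measurable_continuous_onI[OF FCb1_vec_continuous[OF \<Phi>]] sets\<gamma>
      by (simp cong: measurable_cong_sets)
    have C_meas: "(\<lambda>x. conjugate_fun F (\<Phi> x)) \<in> borel_measurable \<gamma>"
      using borel_measurable_conjugate[OF F(1)] by measurable
    have C_eq: "?C = ereal (\<integral>x. \<Phi> x \<bullet> h1 - f1 \<partial>\<gamma>)
        + enn2ereal (\<integral>\<^sup>+x. e2ennreal (conjugate_fun F (\<Phi> x) - ereal (\<Phi> x \<bullet> h1 - f1)) \<partial>\<gamma>)"
      by (rule ereal_integral_eq_lower_plus[OF l_int C_meas lower])
    then have "(\<integral>\<^sup>+x. e2ennreal (conjugate_fun F (\<Phi> x) - ereal (\<Phi> x \<bullet> h1 - f1)) \<partial>\<gamma>) \<noteq> \<infinity>"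
      using False by (auto simp: top_ennreal.rep_eq top_ereal_def)
    then have "AE x in \<gamma>. e2ennreal (conjugate_fun F (\<Phi> x) - ereal (\<Phi> x \<bullet> h1 - f1)) \<noteq> \<infinity>"
      using C_meas by (intro nn_integral_PInf_AE) auto
    then have "AE x in \<gamma>. conjugate_fun F (\<Phi> x) \<noteq> \<infinity>" by eventually_elim auto
    then have slope: "ereal (\<Phi> x \<bullet> ?g x) \<le> recession_fun F (?g x)" for x
      by (rule recession_bound_on_support[OF assms(1,2) F \<Phi>])
    have "ereal (\<integral>x. \<Phi> x \<bullet> ?g x \<partial>?V) = ereal_integral ?V (\<lambda>x. ereal (\<Phi> x \<bullet> ?g x))"
      by (rule ereal_integral_real[symmetric, OF integrable_FCb1_vec_inner[OF \<Phi> _ g]]) simp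
    also have "\<dots> \<le> ?S" by (rule ereal_integral_mono) (rule slope)
    finally have S: "ereal (\<integral>x. \<Phi> x \<bullet> ?g x \<partial>?V) \<le> ?S" .
    have A: "ereal (\<integral>x. \<Phi> x \<bullet> \<mu>a x \<partial>\<gamma>) \<le> ?A + ?C"
    proof (rule ereal_integral_add_ge[OF F_meas f_int[of 0] _ C_meas l_int lower])
      show "ereal (f 0 x) \<le> F (\<mu>a x)" for x unfolding F_eq f_def by (rule SUP_upper) simp
      show "integrable \<gamma> (\<lambda>x. \<Phi> x \<bullet> \<mu>a x)" by (rule integrable_FCb1_vec_inner[OF \<Phi> sets\<gamma> \<mu>a])
      fix x
      have "ereal (\<Phi> x \<bullet> \<mu>a x) - F (\<mu>a x) \<le> conjugate_fun F (\<Phi> x)"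
        unfolding conjugate_fun_def by (rule SUP_upper) simp
      moreover have "F (\<mu>a x) \<noteq> -\<infinity>" using F(1) unfolding proper_fun_def by blast
      ultimately show "ereal (\<Phi> x \<bullet> \<mu>a x) \<le> F (\<mu>a x) + conjugate_fun F (\<Phi> x)"
        by (cases "F (\<mu>a x)"; cases "conjugate_fun F (\<Phi> x)") auto
    qed
    have "ereal (\<integral>x. \<Phi> x \<bullet> h1 - f1 \<partial>\<gamma>) \<le> ?C"
      unfolding ereal_integral_real[OF l_int, symmetric] by (rule ereal_integral_mono) (rule lower)
    with False obtain C where "?C = ereal C" by (cases ?C) auto
    then show ?thesis
      using A S A_lower S_lower unfolding pairing[OF \<Phi>]
      by (cases ?A; cases ?S) auto
  qed
  \<comment> \<open>The maximum over finitely many minorants is approximated by convex combinations of them whose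
    weights are cylindrical functions.\<close>
  moreover have "?A + ?S \<le> (SUP \<Phi>\<in>FCb1_vec. ?val \<Phi>)"
  proof (rule LIMSEQ_le_const2)
    show "(\<lambda>n. ereal (\<integral>x. running_max f n x \<partial>\<gamma>) + ereal (\<integral>x. running_max k n x \<partial>?V)) \<longlonglongrightarrow> ?A + ?S"
      using A_lower S_lower by (intro tendsto_add_ereal_general limA limS) auto
    have "ereal (\<integral>x. running_max f n x \<partial>\<gamma>) + ereal (\<integral>x. running_max k n x \<partial>?V)
      \<le> (SUP \<Phi>\<in>FCb1_vec. ?val \<Phi>)" for n
    proof (rule ereal_le_epsilon2)
      fix \<epsilon> :: real assume \<epsilon>: "0 < \<epsilon>"
      obtain N where N: "N \<in> sets borel" "emeasure \<gamma> N = 0" "emeasure ?V (- N) = 0"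
        using sing by (auto simp: emeasure_variation_measure[OF \<mu>s])
      have "0 < \<epsilon> / 2" using \<epsilon> by simp
      from FCb1_partition_of_unity_approximates_Max[where f = f and g = k and n = n,
          OF sets\<gamma> sets_variation_measure N f_int k_int this]
      obtain \<theta> where \<theta>: "\<And>i. i \<le> n \<Longrightarrow> \<theta> i \<in> FCb1" "\<And>i x. i \<le> n \<Longrightarrow> 0 \<le> \<theta> i x" "\<And>x. (\<Sum>i\<le>n. \<theta> i x) = 1"
        and ef: "selection_error \<gamma> \<theta> f n < \<epsilon> / 2"
        and ek: "selection_error ?V \<theta> k n < \<epsilon> / 2"
        by blast
      define \<Phi> where "\<Phi> = (\<lambda>x. \<Sum>i\<le>n. \<theta> i x *\<^sub>R \<phi> i)"
      define d where "d = (\<lambda>x. \<Sum>i\<le>n. \<theta> i x * c i)"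
      have \<Phi>: "\<Phi> \<in> FCb1_vec"
        unfolding FCb1_vec_def \<Phi>_def using \<theta>(1)
        by (intro CollectI exI[of _ "Suc n"] exI[of _ "\<lambda>_. 1"] exI[of _ \<theta>] exI[of _ \<phi>])
          (auto simp: lessThan_Suc_atMost)
      have conj: "conjugate_fun F (\<Phi> x) \<le> ereal (d x)" for x
        unfolding conjugate_le_iff affine_minorants_def
      proof clarify
        fix h
        show "ereal (\<Phi> x \<bullet> h - d x) \<le> F h"
        proof (cases "F h")
          case (real r)
          have "\<Phi> x \<bullet> h - d x = (\<Sum>i\<le>n. \<theta> i x * (\<phi> i \<bullet> h - c i))"
            by (simp add: \<Phi>_def d_def inner_sum_left sum_subtractf right_diff_distrib)
          also have "\<dots> \<le> (\<Sum>i\<le>n. \<theta> i x * r)"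
          proof (intro sum_mono mult_left_mono)
            fix i
            show "\<phi> i \<bullet> h - c i \<le> r"
              using minorant[of i] real by (auto simp: affine_minorants_def dest: spec[of _ h])
          qed (use \<theta>(2) in auto)
          also have "\<dots> = r" by (simp add: sum_distrib_right[symmetric] \<theta>(3))
          finally show ?thesis by (simp add: real)
        next
          case MInf
          then show ?thesis using F(1) unfolding proper_fun_def by blast
        qed simp
      qed
      have int_\<theta>: "integrable M (\<lambda>x. \<theta> i x * a x)" if "i \<le> n" "sets M = sets borel" "integrable M a" for i M a
        using that FCb1_measurable[OF \<theta>(1)] FCb1_bounded[OF \<theta>(1)] by (intro integrable_bounded_mult) auto
      have d_int: "integrable \<gamma> d"
        unfolding d_def by (intro Bochner_Integration.integrable_sum int_\<theta>[OF _ sets\<gamma>]) auto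
      have f_eq: "(\<Sum>i\<le>n. \<theta> i x * f i x) = \<Phi> x \<bullet> \<mu>a x - d x" for x
        by (simp add: \<Phi>_def d_def f_def inner_sum_left sum_subtractf right_diff_distrib)
      have k_eq: "(\<Sum>i\<le>n. \<theta> i x * k i x) = \<Phi> x \<bullet> ?g x" for x
        by (simp add: \<Phi>_def k_def inner_sum_left)
      have near: "(\<integral>x. b x \<partial>M) \<le> (\<integral>x. a x \<partial>M) + \<epsilon> / 2"
        if "integrable M a" "integrable M b" "(\<integral>x. \<bar>a x - b x\<bar> \<partial>M) < \<epsilon> / 2" for M and a b :: "'a \<Rightarrow> real"
      proof -
        have "(\<integral>x. b x \<partial>M) - (\<integral>x. a x \<partial>M) = (\<integral>x. b x - a x \<partial>M)"
          using that by (intro Bochner_Integration.integral_diff[symmetric])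
        also have "\<dots> \<le> (\<integral>x. \<bar>a x - b x\<bar> \<partial>M)"
          using that by (intro integral_mono) auto
        finally show ?thesis using that(3) by simp
      qed
      have \<Phi>a: "integrable \<gamma> (\<lambda>x. \<Phi> x \<bullet> \<mu>a x)" by (rule integrable_FCb1_vec_inner[OF \<Phi> sets\<gamma> \<mu>a])
      have \<Phi>g: "integrable ?V (\<lambda>x. \<Phi> x \<bullet> ?g x)" by (rule integrable_FCb1_vec_inner[OF \<Phi> _ g]) simp
      have "(\<integral>x. running_max f n x \<partial>\<gamma>) \<le> (\<integral>x. \<Phi> x \<bullet> \<mu>a x - d x \<partial>\<gamma>) + \<epsilon> / 2"
        using ef unfolding selection_error_def f_eq by (intro near integrable_running_max f_int Bochner_Integration.integrable_diff \<Phi>a d_int)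
      moreover have "(\<integral>x. running_max k n x \<partial>?V) \<le> (\<integral>x. \<Phi> x \<bullet> ?g x \<partial>?V) + \<epsilon> / 2"
        using ek unfolding selection_error_def k_eq by (intro near integrable_running_max k_int \<Phi>g)
      ultimately have le: "(\<integral>x. running_max f n x \<partial>\<gamma>) + (\<integral>x. running_max k n x \<partial>?V) \<le> pairing_integral \<Phi> \<mu> - (\<integral>x. d x \<partial>\<gamma>) + \<epsilon>"
        unfolding pairing[OF \<Phi>] using \<Phi>a d_int by simp
      have "ereal_integral \<gamma> (\<lambda>x. conjugate_fun F (\<Phi> x)) \<le> ereal (\<integral>x. d x \<partial>\<gamma>)"
        unfolding ereal_integral_real[OF d_int, symmetric] by (rule ereal_integral_mono) (rule conj)
      then have "ereal (pairing_integral \<Phi> \<mu>) - ereal (\<integral>x. d x \<partial>\<gamma>) \<le> ?val \<Phi>"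
        by (intro ereal_minus_mono) auto
      also have "?val \<Phi> \<le> (SUP \<Phi>\<in>FCb1_vec. ?val \<Phi>)" using \<Phi> by (rule SUP_upper)
      finally have "ereal (pairing_integral \<Phi> \<mu> - (\<integral>x. d x \<partial>\<gamma>)) + ereal \<epsilon> \<le> (SUP \<Phi>\<in>FCb1_vec. ?val \<Phi>) + ereal \<epsilon>"
        by (intro add_right_mono) simp
      moreover have "ereal (\<integral>x. running_max f n x \<partial>\<gamma>) + ereal (\<integral>x. running_max k n x \<partial>?V) \<le> ereal (pairing_integral \<Phi> \<mu> - (\<integral>x. d x \<partial>\<gamma>)) + ereal \<epsilon>"
        using le by simp
      ultimately show "ereal (\<integral>x. running_max f n x \<partial>\<gamma>) + ereal (\<integral>x. running_max k n x \<partial>?V) \<le> (SUP \<Phi>\<in>FCb1_vec. ?val \<Phi>) + ereal \<epsilon>"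
        by (rule order_trans[rotated])
    qed
    then show "\<exists>m. \<forall>n\<ge>m. ereal (\<integral>x. running_max f n x \<partial>\<gamma>) + ereal (\<integral>x. running_max k n x \<partial>?V)
      \<le> (SUP \<Phi>\<in>FCb1_vec. ?val \<Phi>)" by blast
  qed
  ultimately show ?thesis
    unfolding measure_functional_def by (intro antisym SUP_least) auto
qed

end
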